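(* Let $m\ge1$ be an integer and let the square $B=[-1,1]^2$ be dissected into the quadrilaterals $Q_j$, $j\ge0$, described in the context. Then for every positive $C$ there exists $L$ such that for every function $f$ on the square such that - $f$ is constant on each quadrilateral, - $1/C\le f\le C$ everywhere, there exists a locally piecewise affine $L$-biLipschitz mapping from the square to itself whose Jacobian equals $f$ almost everywhere.
   Context: A mapping $F$ is $L$-biLipschitz if $\frac1L\,\mathrm{dist}(z,w)\le\mathrm{dist}(F(z),F(w))\le L\,\mathrm{dist}(z,w)$ for all $z,w$. A mapping of an open set $\Omega\subset\mathbb R^2$ is locally piecewise affine if $\Omega$ is a locally finite union of triangles on which the mapping is affine (for a mapping of the square, this refers to its interior). The Jacobian is the determinant of the differential. The dissection: let $B_i=(1-2^{-im})\cdot B$ for $i\ge1$, where $r\cdot B=[-r,r]^2$. The square $B$ is divided into the square $Q_0=B_1$ and the annuli $B_{i+1}\setminus B_i$, $i\ge1$. For each $i\ge 1$, each side of the two squares $B_i$ and $B_{i+1}$ is divided into $2^{im}$ equal segments, and corresponding division points (and corresponding vertices) of $\partial B_i$ and $\partial B_{i+1}$ are joined by straight segments; this divides the annulus $B_{i+1}\setminus B_i$ into $4\cdot2^{im}$ quadrilaterals. The quadrilaterals of all annuli are numbered arbitrarily by positive integers and denoted $Q_j$, $j\ge1$.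
   Formalization: The function f is additionally required to have integral over the square equal to the square's area; without this the claim fails (C = 2, f = 2 everywhere), and it is necessary for a map of the square onto itself. *)

theory Defs
  imports "HOL-Analysis.Analysis"
begin

section \<open>The dissection of the square\<close>

definition csquare :: "real \<Rightarrow> (real^2) set" where
  "csquare r = cbox (vector [-r, -r]) (vector [r, r])"

definition radius :: "nat \<Rightarrow> nat \<Rightarrow> real" where
  "radius m i = 1 - 1 / 2 ^ (i * m)"

text \<open>The sides of \<open>csquare 1\<close> as pairs of endpoints; the corresponding sides of \<open>csquare r\<close>
  are their images under scaling by \<open>r\<close>.\<close>

definition unit_sides :: "((real^2) \<times> (real^2)) set" where
  "unit_sides =
    {(vector [1, -1], vector [1, 1]), (vector [1, 1], vector [-1, 1]),
     (vector [-1, 1], vector [-1, -1]), (vector [-1, -1], vector [1, -1])}"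

text \<open>The \<open>k\<close>-th point of the division of the side of \<open>csquare r\<close> from \<open>r *\<^sub>R a\<close> to
  \<open>r *\<^sub>R b\<close> into \<open>N\<close> equal segments.\<close>

definition div_point :: "nat \<Rightarrow> real \<Rightarrow> real^2 \<Rightarrow> real^2 \<Rightarrow> nat \<Rightarrow> real^2" where
  "div_point N r a b k = r *\<^sub>R a + (real k / real N) *\<^sub>R (r *\<^sub>R b - r *\<^sub>R a)"

text \<open>The quadrilaterals (closed trapezoids) of the annulus between \<open>csquare (radius m i)\<close> and
  \<open>csquare (radius m (i + 1))\<close>. Both boundaries are divided into the same number
  \<open>2 ^ (i * m)\<close> of segments per side.\<close>

definition annulus_quads :: "nat \<Rightarrow> nat \<Rightarrow> (real^2) set set" where
  "annulus_quads m i =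
    (let N = 2 ^ (i * m); r = radius m i; s = radius m (i + 1) in
      {convex hull {div_point N r a b k, div_point N r a b (k + 1),
                    div_point N s a b (k + 1), div_point N s a b k} | a b k.
        (a, b) \<in> unit_sides \<and> k < N})"

definition dissection :: "nat \<Rightarrow> (nat \<Rightarrow> (real^2) set) \<Rightarrow> bool" where
  "dissection m Q \<longleftrightarrow>
    Q 0 = csquare (radius m 1) \<and> bij_betw Q {1..} (\<Union>i\<in>{1..}. annulus_quads m i)"

section \<open>Mappings\<close>

definition bilipschitz_on :: "real \<Rightarrow> 'a::metric_space set \<Rightarrow> ('a \<Rightarrow> 'b::metric_space) \<Rightarrow> bool" where
  "bilipschitz_on L S F \<longleftrightarrow>
    (\<forall>z\<in>S. \<forall>w\<in>S. 1 / L * dist z w \<le> dist (F z) (F w) \<and> dist (F z) (F w) \<le> L * dist z w)"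

definition is_triangle :: "(real^2) set \<Rightarrow> bool" where
  "is_triangle T \<longleftrightarrow> (\<exists>a b c. \<not> collinear {a, b, c} \<and> T = convex hull {a, b, c})"

definition affine_map_on :: "'a::real_vector set \<Rightarrow> ('a \<Rightarrow> 'b::real_vector) \<Rightarrow> bool" where
  "affine_map_on T F \<longleftrightarrow> (\<exists>A b. linear A \<and> (\<forall>x\<in>T. F x = A x + b))"

text \<open>Local finiteness is required at the points of \<open>\<Omega>\<close> only, so the triangles may accumulate at
  the boundary of \<open>\<Omega>\<close>.\<close>

definition locally_piecewise_affine_on :: "(real^2) set \<Rightarrow> (real^2 \<Rightarrow> real^2) \<Rightarrow> bool" where
  "locally_piecewise_affine_on \<Omega> F \<longleftrightarrow>
    (\<exists>\<T>. (\<forall>T\<in>\<T>. is_triangle T \<and> affine_map_on T F) \<and> \<Union>\<T> = \<Omega> \<and>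
         locally_finite_in (top_of_set \<Omega>) \<T>)"

definition has_jacobian_at :: "(real^'n \<Rightarrow> real^'n) \<Rightarrow> real \<Rightarrow> real^'n \<Rightarrow> bool" where
  "has_jacobian_at F j z \<longleftrightarrow> (\<exists>D. (F has_derivative D) (at z) \<and> det (matrix D) = j)"

text \<open>Conventions for the densities \<open>f\<close> prescribed as Jacobians. The closed pieces of the
  dissection share edges, so ``constant on each quadrilateral'' means constant on the interior of
  each piece; on the edges, a null set, only the bounds on \<open>f\<close> are imposed. The integral of \<open>f\<close>
  must equal the area of the square: a bi-Lipschitz map of the square onto itself with Jacobian
  \<open>f \<ge> 0\<close> almost everywhere exists only under this normalisation, by the change of variables
  formula.\<close>

end

theory Submission
  imports Defs
begin

text \<open>The dissection for \<open>m = 1\<close> refines all the others, so \<open>f\<close> is constant on the triangles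
  of one fixed triangulation of the interior of the square, and the adjacencies of these triangles
  contain a tree. Two triangles joined by an edge of the tree form a convex quadrilateral; moving
  the intersection of its diagonals along one of them is a piecewise affine map, fixed outside the
  quadrilateral, that averages the densities on the two triangles. Comparing with a second such map,
  mass can be sent from one triangle to the other arbitrarily. The tree edges have four colours, and
  the exchanges along edges of one colour have disjoint supports.

  To turn \<open>f\<close> into the constant density 1, every triangle passes the excess mass of its
  descendants to its parent. The descendants of a triangle occupy an area comparable to its own, so
  the flux through an edge is at most a constant times the areas of the adjacent triangles. Splitting
  the flux into a bounded number of equal rounds therefore keeps all densities in
  \<open>[1/(2C), 2C]\<close>, and the composition of the boundedly many maps is the required one.\<close>

section \<open>Locally finite piecewise affine maps\<close>

text \<open>A nonzero shift of the centre carries the triangle on one side of an edge to a set that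
  is not that triangle, so the transported density is again constant on both triangles only if it is
  the same on both. Averaging is thus the one exchange that a single move can perform, and a general
  exchange has to pass through the common average and return by an inverse map. Infinitely many
  edges must be treated while biLipschitz constants multiply under composition. This forces
  simultaneous moves, whose cost does not depend on how many there are, and a number of maps
  depending on \<open>C\<close> alone. A tree is used because the fluxes through its edges are
  determined by the excess masses, with no system of equations to solve; the flux that would leave
  the root is zero because the integral of \<open>f\<close> is the area of the square. Sending a
  whole flux at once could make a density negative, since the part of the square below a triangle
  may lack more mass than the triangle has; hence the rounds.\<close>

lemma locally_finite_in_UN:
  assumes "locally_finite_in X \<P>"
    and "\<And>P. P \<in> \<P> \<Longrightarrow> finite (R P)" and "\<And>P. P \<in> \<P> \<Longrightarrow> \<Union>(R P) \<subseteq> P"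
  shows "locally_finite_in X (\<Union>(R ` \<P>))"
  unfolding locally_finite_in_def
proof (intro conjI ballI)
  show "\<Union>(\<Union>(R ` \<P>)) \<subseteq> topspace X"
    using assms(1,3) unfolding locally_finite_in_def by blast
  fix x assume "x \<in> topspace X"
  then obtain V where V: "openin X V" "x \<in> V" "finite {U \<in> \<P>. U \<inter> V \<noteq> {}}"
    using assms(1) unfolding locally_finite_in_def by blast
  have "{U \<in> \<Union>(R ` \<P>). U \<inter> V \<noteq> {}} \<subseteq> \<Union>(R ` {U \<in> \<P>. U \<inter> V \<noteq> {}})"
    using assms(3) by blast
  moreover have "finite (\<Union>(R ` {U \<in> \<P>. U \<inter> V \<noteq> {}}))"
    using V(3) assms(2) by blast
  ultimately show "\<exists>V. openin X V \<and> x \<in> V \<and> finite {U \<in> \<Union>(R ` \<P>). U \<inter> V \<noteq> {}}"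
    using V finite_subset by blast
qed

lemma locally_finite_inE:
  assumes "locally_finite_in (top_of_set \<Omega>) \<P>" "x \<in> \<Omega>"
  obtains V where "openin (top_of_set \<Omega>) V" "x \<in> V" "finite {U \<in> \<P>. U \<inter> V \<noteq> {}}"
  using assms unfolding locally_finite_in_def by auto

lemma Union_Union_image_eq:
  assumes "\<And>P. P \<in> \<P> \<Longrightarrow> \<Union>(R P) = P"
  shows "\<Union>(\<Union>(R ` \<P>)) = \<Union>\<P>"
proof -
  have "\<Union>(\<Union>(R ` \<P>)) = (\<Union>P\<in>\<P>. \<Union>(R P))" by blast
  then show ?thesis using assms by simp
qed

text \<open>Near a point only finitely many pieces matter. The nondegenerate ones have a closed
  union, and an open set avoiding it would lie in a finite union of null pieces, hence be
  empty.\<close>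

lemma locally_finite_drop_negligible:
  fixes \<Omega> :: "'a::euclidean_space set"
  assumes "open \<Omega>" and lf: "locally_finite_in (top_of_set \<Omega>) \<P>" and "\<Union>\<P> = \<Omega>"
    and cl: "\<And>P. P \<in> \<P> \<Longrightarrow> closed P"
  shows "\<Union>{P \<in> \<P>. \<not> negligible P} = \<Omega>"
proof
  show "\<Union>{P \<in> \<P>. \<not> negligible P} \<subseteq> \<Omega>" using assms by blast
  show "\<Omega> \<subseteq> \<Union>{P \<in> \<P>. \<not> negligible P}"
  proof
    fix x assume x: "x \<in> \<Omega>"
    then obtain V where V: "openin (top_of_set \<Omega>) V" "x \<in> V" and fin: "finite {U \<in> \<P>. U \<inter> V \<noteq> {}}"
      using lf unfolding locally_finite_in_def by auto
    have "open V" and "V \<subseteq> \<Omega>"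
      using V \<open>open \<Omega>\<close> openin_open_eq by blast+
    let ?N = "\<Union>{U \<in> \<P>. U \<inter> V \<noteq> {} \<and> negligible U}"
    let ?G = "\<Union>{U \<in> \<P>. U \<inter> V \<noteq> {} \<and> \<not> negligible U}"
    have f1: "finite {U \<in> \<P>. U \<inter> V \<noteq> {} \<and> negligible U}" "finite {U \<in> \<P>. U \<inter> V \<noteq> {} \<and> \<not> negligible U}"
      using fin by (auto elim!: rev_finite_subset)
    have N: "negligible ?N" by (rule negligible_Union[OF f1(1)]) auto
    have G: "closed ?G" using f1(2) cl by (intro closed_Union) auto
    have "x \<in> ?G"
    proof (rule ccontr)
      assume "x \<notin> ?G"
      have "open (V - ?G)" using \<open>open V\<close> G by (rule open_Diff)
      moreover have "V - ?G \<subseteq> ?N" using \<open>V \<subseteq> \<Omega>\<close> \<open>\<Union>\<P> = \<Omega>\<close> by blast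
      ultimately have "negligible (V - ?G)" using N negligible_subset by blast
      with \<open>open (V - ?G)\<close> have "V - ?G = {}" using open_not_negligible by blast
      with \<open>x \<notin> ?G\<close> V(2) show False by blast
    qed
    then show "x \<in> \<Union>{P \<in> \<P>. \<not> negligible P}" by blast
  qed
qed

text \<open>Allowing degenerate polytopes as pieces makes the notion closed under composition;
  lower-dimensional pieces are discarded at the end.\<close>

definition polytopewise_affine_on :: "'a::euclidean_space set \<Rightarrow> ('a \<Rightarrow> 'b::real_vector) \<Rightarrow> bool" where
  "polytopewise_affine_on \<Omega> F \<longleftrightarrow>
    (\<exists>\<P>. (\<forall>P\<in>\<P>. polytope P \<and> affine_map_on P F) \<and> \<Union>\<P> = \<Omega> \<and>
         locally_finite_in (top_of_set \<Omega>) \<P>)"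

lemma affine_map_on_subset: "affine_map_on T F \<Longrightarrow> S \<subseteq> T \<Longrightarrow> affine_map_on S F"
  unfolding affine_map_on_def by blast

lemma polytopewise_affine_on_refine:
  assumes "locally_finite_in (top_of_set \<Omega>) \<P>" "\<Union>\<P> = \<Omega>"
    and "\<And>P. P \<in> \<P> \<Longrightarrow> \<exists>R. finite R \<and> \<Union>R = P \<and> (\<forall>S\<in>R. polytope S \<and> affine_map_on S F)"
  shows "polytopewise_affine_on \<Omega> F"
proof -
  obtain R where R: "\<And>P. P \<in> \<P> \<Longrightarrow> finite (R P) \<and> \<Union>(R P) = P \<and> (\<forall>S\<in>R P. polytope S \<and> affine_map_on S F)"
    using assms(3) by metis
  have "locally_finite_in (top_of_set \<Omega>) (\<Union>(R ` \<P>))"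
    using R by (intro locally_finite_in_UN[OF assms(1)]) auto
  moreover have "\<Union>(\<Union>(R ` \<P>)) = \<Omega>" using Union_Union_image_eq[of \<P> R] R assms(2) by blast
  moreover have "\<forall>P\<in>\<Union>(R ` \<P>). polytope P \<and> affine_map_on P F" using R by auto
  ultimately show ?thesis unfolding polytopewise_affine_on_def by (intro exI conjI)
qed

lemma is_triangle_hull3:
  assumes "finite S" "card S \<le> 3" "\<not> negligible (convex hull S)"
  shows "is_triangle (convex hull S)"
proof -
  have "S \<noteq> {}" using assms(3) by auto
  have "\<exists>a b c. S = {a, b, c}"
  proof -
    have "card S = 1 \<or> card S = 2 \<or> card S = 3" using assms(1,2) \<open>S \<noteq> {}\<close>
      by (metis One_nat_def Suc_1 card_0_eq le_SucE le_zero_eq numeral_3_eq_3)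
    then show ?thesis
      by (metis card_1_singletonE card_2_iff card_3_iff insert_absorb2)
  qed
  then obtain a b c where S: "S = {a, b, c}" by blast
  have "\<not> collinear {a, b, c}"
  proof
    assume "collinear {a, b, c}"
    then have "aff_dim (convex hull S) \<le> 1" 
      by (simp add: S collinear_aff_dim aff_dim_convex_hull)
    moreover have "interior (convex hull S) \<noteq> {}"
      using assms(3) negligible_convex_interior convex_convex_hull by metis
    then have "aff_dim (convex hull S) = 2"
      using aff_dim_nonempty_interior by fastforce
    ultimately show False by simp
  qed
  then show ?thesis unfolding is_triangle_def S by blast
qed

text \<open>Caratheodory in the plane: the hulls of at most three vertices already cover. They may
  overlap, which the notion of a locally finite union of triangles permits, so no triangulation of
  the polytope has to be built.\<close>

lemma polytope_Union_hull3:
  fixes P :: "(real^2) set"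
  assumes "polytope P"
  shows "\<exists>R. finite R \<and> \<Union>R = P \<and> (\<forall>T\<in>R. \<exists>S. finite S \<and> card S \<le> 3 \<and> T = convex hull S)"
proof -
  obtain V where V: "finite V" "P = convex hull V" using assms polytope_def by blast
  let ?R = "(\<lambda>S. convex hull S) ` {S. S \<subseteq> V \<and> card S \<le> 3}"
  have fin: "finite {S. S \<subseteq> V \<and> card S \<le> 3}" using V by auto
  have "\<Union>?R = P"
  proof
    show "\<Union>?R \<subseteq> P" unfolding V(2) by (auto simp: hull_mono[THEN subsetD])
    show "P \<subseteq> \<Union>?R" unfolding V(2) by (subst caratheodory) auto
  qed
  moreover have "\<forall>T\<in>?R. \<exists>S. finite S \<and> card S \<le> 3 \<and> T = convex hull S"
    using V(1) finite_subset by blast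
  ultimately show ?thesis using fin by blast
qed

lemma polytopewise_affine_imp_locally_piecewise_affine:
  assumes "open \<Omega>" "polytopewise_affine_on \<Omega> F"
  shows "locally_piecewise_affine_on \<Omega> F"
proof -
  obtain \<P> where \<P>: "\<And>P. P\<in>\<P> \<Longrightarrow> polytope P \<and> affine_map_on P F" "\<Union>\<P> = \<Omega>"
      "locally_finite_in (top_of_set \<Omega>) \<P>"
    using assms(2) unfolding polytopewise_affine_on_def by blast
  obtain R where R: "\<And>P. P \<in> \<P> \<Longrightarrow> finite (R P) \<and> \<Union>(R P) = P \<and>
      (\<forall>T\<in>R P. \<exists>S. finite S \<and> card S \<le> 3 \<and> T = convex hull S)"
    using polytope_Union_hull3 \<P>(1) by metis
  define \<Q> where "\<Q> = \<Union>(R ` \<P>)"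
  have lf: "locally_finite_in (top_of_set \<Omega>) \<Q>"
    unfolding \<Q>_def using R by (intro locally_finite_in_UN[OF \<P>(3)]) auto
  have U: "\<Union>\<Q> = \<Omega>" using Union_Union_image_eq[of \<P> R] R \<P>(2) unfolding \<Q>_def by blast
  have hull: "\<exists>S. finite S \<and> card S \<le> 3 \<and> T = convex hull S" if "T \<in> \<Q>" for T
    using that R unfolding \<Q>_def by blast
  have cl: "closed T" if "T \<in> \<Q>" for T
    using hull[OF that] by (auto simp: finite_imp_compact compact_convex_hull compact_imp_closed)
  define \<T> where "\<T> = {T \<in> \<Q>. \<not> negligible T}"
  have "\<Union>\<T> = \<Omega>"
    unfolding \<T>_def by (rule locally_finite_drop_negligible[OF assms(1) lf U cl])
  moreover have "locally_finite_in (top_of_set \<Omega>) \<T>"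
    by (rule locally_finite_in_subset[OF lf]) (auto simp: \<T>_def)
  moreover have "is_triangle T \<and> affine_map_on T F" if T': "T \<in> \<T>" for T
  proof
    have T: "T \<in> \<Q>" "\<not> negligible T" using T' unfolding \<T>_def by auto
    obtain S where S: "finite S" "card S \<le> 3" "T = convex hull S" using hull[OF T(1)] by blast
    show "is_triangle T" using is_triangle_hull3[OF S(1,2)] T(2) S(3) by simp
    obtain P where "P \<in> \<P>" "T \<in> R P" using T' unfolding \<T>_def \<Q>_def by blast
    then show "affine_map_on T F"
      using R[of P] \<P>(1)[of P] affine_map_on_subset[of P F T] by blast
  qed
  ultimately show ?thesis unfolding locally_piecewise_affine_on_def by blast
qed

section \<open>Compositions of piecewise affine maps\<close>

lemma polyhedron_affine_preimage:
  fixes A :: "'a::euclidean_space \<Rightarrow> 'b::euclidean_space"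
  assumes "linear A" "polyhedron P"
  shows "polyhedron {x. A x + b \<in> P}"
proof -
  obtain F where F: "finite F" "P = \<Inter>F" "\<And>h. h\<in>F \<Longrightarrow> \<exists>a c. a \<noteq> 0 \<and> h = {x. a \<bullet> x \<le> c}"
    using assms(2) unfolding polyhedron_def by blast
  have half: "polyhedron {x. A x + b \<in> h}" if h: "h \<in> F" for h
  proof -
    obtain a c where h: "h = {x. a \<bullet> x \<le> c}" using F(3)[OF h] by blast
    have "{x. A x + b \<in> h} = {x. adjoint A a \<bullet> x \<le> c - a \<bullet> b}"
      using adjoint_works[OF assms(1)] by (auto simp: h inner_add_right inner_commute algebra_simps)
    \<comment> \<open>A vanishing normal turns the half-space into the whole space or the empty set,
      according to the sign of the right-hand side.\<close>
    moreover have "polyhedron {x. adjoint A a \<bullet> x \<le> c - a \<bullet> b}"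
      by (cases "adjoint A a = 0"; cases "0 \<le> c - a \<bullet> b")
         (simp_all add: polyhedron_halfspace_le)
    ultimately show ?thesis by simp
  qed
  have "{x. A x + b \<in> P} = \<Inter>((\<lambda>h. {x. A x + b \<in> h}) ` F)" using F(2) by auto
  then show ?thesis using half F(1) by (auto intro!: polyhedron_Inter)
qed

lemma polytope_Int_polyhedron:
  fixes P :: "'a::euclidean_space set"
  shows "polytope P \<Longrightarrow> polyhedron Q \<Longrightarrow> polytope (P \<inter> Q)"
  unfolding polytope_eq_bounded_polyhedron by (blast intro: polyhedron_Int bounded_Int)

text \<open>The pieces are the sets of points of \<open>P\<close> that \<open>F\<close> sends into
  \<open>Q\<close>. They are polytopes because \<open>F\<close> is affine on \<open>P\<close>, and
  continuity of \<open>F\<close> pulls a neighbourhood meeting few sets \<open>Q\<close> back to one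
  meeting few pieces.\<close>

lemma polytopewise_affine_on_compose:
  fixes F :: "'a::euclidean_space \<Rightarrow> 'b::euclidean_space" and G :: "'b \<Rightarrow> 'c::real_vector"
  assumes F: "polytopewise_affine_on \<Omega> F" and G: "polytopewise_affine_on \<Omega>' G"
    and cont: "continuous_on \<Omega> F" and im: "F ` \<Omega> \<subseteq> \<Omega>'"
  shows "polytopewise_affine_on \<Omega> (G \<circ> F)"
proof -
  obtain \<P> where \<P>: "\<And>P. P\<in>\<P> \<Longrightarrow> polytope P \<and> affine_map_on P F" "\<Union>\<P> = \<Omega>"
      "locally_finite_in (top_of_set \<Omega>) \<P>"
    using F unfolding polytopewise_affine_on_def by blast
  obtain \<Q> where \<Q>: "\<And>P. P\<in>\<Q> \<Longrightarrow> polytope P \<and> affine_map_on P G" "\<Union>\<Q> = \<Omega>'"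
      "locally_finite_in (top_of_set \<Omega>') \<Q>"
    using G unfolding polytopewise_affine_on_def by blast
  define \<S> where "\<S> = {P \<inter> F -` Q | P Q. P \<in> \<P> \<and> Q \<in> \<Q>}"
  have "polytope S \<and> affine_map_on S (G \<circ> F)" if S': "S \<in> \<S>" for S
  proof -
    obtain P Q where PQ: "P \<in> \<P>" "Q \<in> \<Q>" and S: "S = P \<inter> F -` Q"
      using S' unfolding \<S>_def by blast
    obtain A b where A: "linear A" "\<And>x. x \<in> P \<Longrightarrow> F x = A x + b"
      using \<P>(1)[OF PQ(1)] unfolding affine_map_on_def by blast
    obtain A' b' where A': "linear A'" "\<And>x. x \<in> Q \<Longrightarrow> G x = A' x + b'"
      using \<Q>(1)[OF PQ(2)] unfolding affine_map_on_def by blast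
    have "S = P \<inter> {x. A x + b \<in> Q}" using A(2) S by auto
    then have "polytope S"
      using \<P>(1)[OF PQ(1)] \<Q>(1)[OF PQ(2)] polyhedron_affine_preimage[OF A(1)]
        polytope_Int_polyhedron polytope_imp_polyhedron by metis
    moreover have "affine_map_on S (G \<circ> F)"
      unfolding affine_map_on_def
    proof (intro exI conjI ballI)
      show "linear (A' \<circ> A)" using A(1) A'(1) by (rule linear_compose)
      fix x assume "x \<in> S"
      then have "F x = A x + b" "G (F x) = A' (F x) + b'" using A(2) A'(2) S by auto
      then show "(G \<circ> F) x = (A' \<circ> A) x + (A' b + b')"
        by (simp add: linear_add[OF A'(1)])
    qed
    ultimately show ?thesis by simp
  qed
  moreover have "\<Union>\<S> = \<Omega>"
  proof
    show "\<Union>\<S> \<subseteq> \<Omega>" using \<P>(2) unfolding \<S>_def by auto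
    show "\<Omega> \<subseteq> \<Union>\<S>"
    proof
      fix x assume "x \<in> \<Omega>"
      moreover from this have "F x \<in> \<Omega>'" using im by blast
      ultimately obtain P Q where "P \<in> \<P>" "Q \<in> \<Q>" "x \<in> P" "F x \<in> Q"
        using \<P>(2) \<Q>(2) by blast
      then show "x \<in> \<Union>\<S>" unfolding \<S>_def by blast
    qed
  qed
  moreover have "locally_finite_in (top_of_set \<Omega>) \<S>"
    unfolding locally_finite_in_def
  proof (intro conjI ballI)
    show "\<Union>\<S> \<subseteq> topspace (top_of_set \<Omega>)" using \<open>\<Union>\<S> = \<Omega>\<close> by simp
    fix x assume "x \<in> topspace (top_of_set \<Omega>)"
    then have x: "x \<in> \<Omega>" by simp
    obtain V where V: "openin (top_of_set \<Omega>) V" "x \<in> V" "finite {U \<in> \<P>. U \<inter> V \<noteq> {}}"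
      using locally_finite_inE[OF \<P>(3) x] .
    have Fx: "F x \<in> \<Omega>'" using x im by blast
    obtain W where W: "openin (top_of_set \<Omega>') W" "F x \<in> W" "finite {U \<in> \<Q>. U \<inter> W \<noteq> {}}"
      using locally_finite_inE[OF \<Q>(3) Fx] .
    have op: "openin (top_of_set \<Omega>) (V \<inter> (\<Omega> \<inter> F -` W))"
    proof (rule openin_Int[OF V(1)])
      show "openin (top_of_set \<Omega>) (\<Omega> \<inter> F -` W)"
        by (rule continuous_openin_preimage[OF cont _ W(1)]) (use im in blast)
    qed
    have "{U \<in> \<S>. U \<inter> (V \<inter> (\<Omega> \<inter> F -` W)) \<noteq> {}} \<subseteq>
      (\<lambda>(P,Q). P \<inter> F -` Q) ` ({U \<in> \<P>. U \<inter> V \<noteq> {}} \<times> {U \<in> \<Q>. U \<inter> W \<noteq> {}})"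
      unfolding \<S>_def by blast
    then have "finite {U \<in> \<S>. U \<inter> (V \<inter> (\<Omega> \<inter> F -` W)) \<noteq> {}}"
      by (rule finite_subset) (intro finite_imageI finite_cartesian_product V(3) W(3))
    moreover have "x \<in> V \<inter> (\<Omega> \<inter> F -` W)" using V(2) W(2) x by simp
    ultimately show "\<exists>V. openin (top_of_set \<Omega>) V \<and> x \<in> V \<and> finite {U \<in> \<S>. U \<inter> V \<noteq> {}}"
      using op by (intro exI conjI)
  qed
  ultimately show ?thesis unfolding polytopewise_affine_on_def by blast
qed

section \<open>Changing densities by piecewise affine maps\<close>

text \<open>With \<open>f\<close> and \<open>g\<close> read as mass densities, \<open>F\<close>
  transports the first mass distribution to the second. Such maps are also run backwards, so the
  inverse and its piecewise affinity are part of the notion; the clause on interiors keeps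
  compositions where local finiteness is known.\<close>

definition density_equiv :: "real \<Rightarrow> (real^2) set \<Rightarrow> (real^2 \<Rightarrow> real) \<Rightarrow> (real^2 \<Rightarrow> real) \<Rightarrow> bool" where
  "density_equiv L B f g \<longleftrightarrow> (\<exists>F G.
    (\<forall>z\<in>B. F z \<in> B \<and> G (F z) = z) \<and> (\<forall>z\<in>B. G z \<in> B \<and> F (G z) = z) \<and>
    (\<forall>z\<in>interior B. F z \<in> interior B \<and> G z \<in> interior B) \<and>
    bilipschitz_on L B F \<and>
    polytopewise_affine_on (interior B) F \<and> polytopewise_affine_on (interior B) G \<and>
    negligible {z \<in> B. \<not> has_jacobian_at F (f z / g (F z)) z})"

lemma bilipschitz_on_lipschitz:
  assumes "bilipschitz_on L B F" "z \<in> B" "w \<in> B"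
  shows "dist (F z) (F w) \<le> L * dist z w"
  using assms unfolding bilipschitz_on_def by blast

lemma bilipschitz_on_imp_continuous_on:
  assumes "bilipschitz_on L B F" "L > 0"
  shows "continuous_on B F"
proof (rule lipschitz_on_continuous_on)
  show "L-lipschitz_on B F"
    using assms bilipschitz_on_lipschitz by (intro lipschitz_onI) auto
qed

lemma bilipschitz_on_inverse:
  assumes "bilipschitz_on L B F" "L > 0" and "\<forall>z\<in>B. G z \<in> B \<and> F (G z) = z"
  shows "bilipschitz_on L B G"
  unfolding bilipschitz_on_def
proof (intro ballI)
  fix z w assume "z \<in> B" "w \<in> B"
  then have "1 / L * dist (G z) (G w) \<le> dist z w" "dist z w \<le> L * dist (G z) (G w)"
    using assms unfolding bilipschitz_on_def by metis+
  then show "1 / L * dist z w \<le> dist (G z) (G w) \<and> dist (G z) (G w) \<le> L * dist z w"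
    using \<open>L > 0\<close> by (simp add: field_simps)
qed

lemma bilipschitz_on_compose:
  assumes "bilipschitz_on L B F" "bilipschitz_on M B G" "F ` B \<subseteq> B" "L > 0" "M > 0"
  shows "bilipschitz_on (L * M) B (G \<circ> F)"
  unfolding bilipschitz_on_def
proof (intro ballI conjI)
  fix z w assume zw: "z \<in> B" "w \<in> B"
  then have F: "F z \<in> B" "F w \<in> B" using assms by auto
  have 1: "1 / L * dist z w \<le> dist (F z) (F w)" "dist (F z) (F w) \<le> L * dist z w"
    using assms(1) zw unfolding bilipschitz_on_def by auto
  have 2: "1 / M * dist (F z) (F w) \<le> dist (G (F z)) (G (F w))"
          "dist (G (F z)) (G (F w)) \<le> M * dist (F z) (F w)"
    using assms(2) F unfolding bilipschitz_on_def by auto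
  have "1 / (L * M) * dist z w = 1 / M * (1 / L * dist z w)" by simp
  also have "\<dots> \<le> 1 / M * dist (F z) (F w)" using 1(1) assms(5) by (intro mult_left_mono) auto
  finally show "1 / (L * M) * dist z w \<le> dist ((G \<circ> F) z) ((G \<circ> F) w)" using 2(1) by simp
  have "M * dist (F z) (F w) \<le> M * (L * dist z w)" using 1(2) assms(5) by (intro mult_left_mono) auto
  then show "dist ((G \<circ> F) z) ((G \<circ> F) w) \<le> L * M * dist z w" using 2(2) by (simp add: mult_ac)
qed

lemma negligible_bilipschitz_image:
  fixes F :: "'a::euclidean_space \<Rightarrow> 'a"
  assumes "bilipschitz_on L B F" "N \<subseteq> B" "negligible N"
  shows "negligible (F ` N)"
proof (rule negligible_locally_Lipschitz_image)
  fix x assume "x \<in> N"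
  then have "\<forall>y\<in>N \<inter> UNIV. norm (F y - F x) \<le> L * norm (y - x)"
    using bilipschitz_on_lipschitz[OF assms(1)] assms(2) by (auto simp: dist_norm)
  then show "\<exists>T C. open T \<and> x \<in> T \<and> (\<forall>y\<in>N \<inter> T. norm (F y - F x) \<le> C * norm (y - x))"
    by blast
qed (use assms in auto)

lemma has_jacobian_at_compose:
  assumes "has_jacobian_at F j z" "has_jacobian_at G k (F z)"
  shows "has_jacobian_at (G \<circ> F) (j * k) z"
proof -
  obtain D E where D: "(F has_derivative D) (at z)" "det (matrix D) = j"
    and E: "(G has_derivative E) (at (F z))" "det (matrix E) = k"
    using assms unfolding has_jacobian_at_def by blast
  have "linear D" "linear E" using D(1) E(1) has_derivative_linear by auto
  then have "det (matrix (E \<circ> D)) = j * k"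
    by (simp add: matrix_compose det_mul D E)
  then show ?thesis
    unfolding has_jacobian_at_def using diff_chain_at[OF D(1) E(1)] by blast
qed

text \<open>The inverse function rule at a single point: an invertible derivative of
  \<open>F\<close> at \<open>z\<close> and continuity of \<open>G\<close> at \<open>F z\<close>
  suffice, so it applies to maps that are differentiable only almost everywhere.\<close>

lemma has_jacobian_at_inverse:
  assumes "has_jacobian_at F j z" "j \<noteq> 0" "isCont G (F z)"
    and "open T" "F z \<in> T" "\<And>y. y \<in> T \<Longrightarrow> F (G y) = y" "G (F z) = z"
  shows "has_jacobian_at G (1 / j) (F z)"
proof -
  obtain D where D: "(F has_derivative D) (at z)" "det (matrix D) = j"
    using assms(1) unfolding has_jacobian_at_def by blast
  have lin: "linear D" using D(1) has_derivative_linear by auto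
  have "inj D" using det_nz_iff_inj[OF lin] D(2) assms(2) by blast
  then obtain E where E: "linear E" "E \<circ> D = id"
    using linear_injective_left_inverse[OF lin] by blast
  have "(G has_derivative E) (at (F z))"
  proof (rule has_derivative_inverse_basic)
    show "(F has_derivative D) (at (G (F z)))" using D(1) assms(7) by simp
  qed (use assms E linear_conv_bounded_linear in auto)
  moreover have "det (matrix E) * j = 1"
  proof -
    have "det (matrix E) * j = det (matrix (E \<circ> D))"
      using matrix_compose[OF lin E(1)] D(2) by (simp add: det_mul)
    then show ?thesis by (simp add: E(2) matrix_id_mat_1)
  qed
  then have "det (matrix E) = 1 / j" using assms(2) by (simp add: field_simps)
  ultimately show ?thesis unfolding has_jacobian_at_def by blast
qed

text \<open>The exceptional set of the inverse is contained in the image of the old one, null by the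
  Lipschitz bound, together with the frontier of \<open>B\<close>, where \<open>F\<close> and
  \<open>G\<close> are not known to be inverse to each other on a full neighbourhood.\<close>

lemma density_equiv_sym:
  assumes fg: "density_equiv L B f g" and "L > 0" "convex B"
    and pos: "\<And>z. f z > 0" "\<And>z. g z > 0"
  shows "density_equiv L B g f"
proof -
  obtain F G where F: "\<forall>z\<in>B. F z \<in> B \<and> G (F z) = z" "\<forall>z\<in>B. G z \<in> B \<and> F (G z) = z"
    "\<forall>z\<in>interior B. F z \<in> interior B \<and> G z \<in> interior B"
    and bil: "bilipschitz_on L B F"
    and pl: "polytopewise_affine_on (interior B) F" "polytopewise_affine_on (interior B) G"
    and neg: "negligible {z \<in> B. \<not> has_jacobian_at F (f z / g (F z)) z}"
    using fg unfolding density_equiv_def by blast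
  have bilG: "bilipschitz_on L B G" using bilipschitz_on_inverse[OF bil \<open>L > 0\<close> F(2)] .
  define N where "N = {z \<in> B. \<not> has_jacobian_at F (f z / g (F z)) z}"
  have jac: "has_jacobian_at G (g y / f (G y)) y" if y: "y \<in> interior B" "y \<notin> F ` N" for y
  proof -
    define z where "z = G y"
    have yB: "y \<in> B" using y(1) interior_subset by blast
    have z: "z \<in> B" "F z = y" using F(2) yB z_def by auto
    have "z \<notin> N" using z y(2) by blast
    then have "has_jacobian_at F (f z / g (F z)) z" using z unfolding N_def by blast
    moreover have "f z / g (F z) \<noteq> 0" using pos[of z] pos(2)[of "F z"] by simp
    moreover have "isCont G (F z)"
    proof -
      have "continuous_on (interior B) G"
        using bilipschitz_on_imp_continuous_on[OF bilG \<open>L > 0\<close>] continuous_on_subset interior_subset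
        by blast
      then show ?thesis using y(1) z(2) by (simp add: continuous_on_eq_continuous_at)
    qed
    ultimately have "has_jacobian_at G (1 / (f z / g (F z))) (F z)"
      by (rule has_jacobian_at_inverse[where T = "interior B"])
         (use y z F interior_subset[of B] in auto)
    then show ?thesis using z(2) z_def by simp
  qed
  have "negligible (F ` N \<union> frontier B)"
    using negligible_bilipschitz_image[OF bil, of N] neg negligible_convex_frontier[OF \<open>convex B\<close>]
    unfolding N_def by auto
  moreover have "{z \<in> B. \<not> has_jacobian_at G (g z / f (G z)) z} \<subseteq> F ` N \<union> frontier B"
    using jac closure_subset[of B] unfolding frontier_def by blast
  ultimately have "negligible {z \<in> B. \<not> has_jacobian_at G (g z / f (G z)) z}"
    by (rule negligible_subset)
  then show ?thesis unfolding density_equiv_def using F bilG pl by blast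
qed

lemma density_equiv_trans:
  assumes fg: "density_equiv L B f g" and gh: "density_equiv M B g h" and "L > 0" "M > 0"
    and pos: "\<And>z. g z > 0"
  shows "density_equiv (L * M) B f h"
proof -
  obtain F G where F: "\<forall>z\<in>B. F z \<in> B \<and> G (F z) = z" "\<forall>z\<in>B. G z \<in> B \<and> F (G z) = z"
    "\<forall>z\<in>interior B. F z \<in> interior B \<and> G z \<in> interior B"
    and bil: "bilipschitz_on L B F"
    and pl: "polytopewise_affine_on (interior B) F" "polytopewise_affine_on (interior B) G"
    and neg: "negligible {z \<in> B. \<not> has_jacobian_at F (f z / g (F z)) z}"
    using fg unfolding density_equiv_def by blast
  obtain F' G' where F': "\<forall>z\<in>B. F' z \<in> B \<and> G' (F' z) = z" "\<forall>z\<in>B. G' z \<in> B \<and> F' (G' z) = z"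
    "\<forall>z\<in>interior B. F' z \<in> interior B \<and> G' z \<in> interior B"
    and bil': "bilipschitz_on M B F'"
    and pl': "polytopewise_affine_on (interior B) F'" "polytopewise_affine_on (interior B) G'"
    and neg': "negligible {z \<in> B. \<not> has_jacobian_at F' (g z / h (F' z)) z}"
    using gh unfolding density_equiv_def by blast
  have bilG: "bilipschitz_on L B G" using bilipschitz_on_inverse[OF bil \<open>L > 0\<close> F(2)] .
  have bilG': "bilipschitz_on M B G'" using bilipschitz_on_inverse[OF bil' \<open>M > 0\<close> F'(2)] .
  have cont: "continuous_on (interior B) F" "continuous_on (interior B) G'"
    using bilipschitz_on_imp_continuous_on bil bilG' \<open>L > 0\<close> \<open>M > 0\<close> continuous_on_subset
      interior_subset by blast+
  have "bilipschitz_on (L * M) B (F' \<circ> F)"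
    using bilipschitz_on_compose[OF bil bil'] F(1) assms by blast
  moreover have "polytopewise_affine_on (interior B) (F' \<circ> F)"
    by (rule polytopewise_affine_on_compose[OF pl(1) pl'(1) cont(1)]) (use F(3) in blast)
  moreover have "polytopewise_affine_on (interior B) (G \<circ> G')"
    by (rule polytopewise_affine_on_compose[OF pl'(2) pl(2) cont(2)]) (use F'(3) in blast)
  moreover have "negligible {z \<in> B. \<not> has_jacobian_at (F' \<circ> F) (f z / h ((F' \<circ> F) z)) z}"
  proof (rule negligible_subset)
    let ?N = "{z \<in> B. \<not> has_jacobian_at F (f z / g (F z)) z}"
    let ?N' = "{z \<in> B. \<not> has_jacobian_at F' (g z / h (F' z)) z}"
    \<comment> \<open>A point can fail for the composition only if it fails for \<open>F\<close> or
      if \<open>F\<close> moves it to a point failing for \<open>F'\<close>; the latter points form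
      the image of a null set under the Lipschitz map \<open>G\<close>.\<close>
    show "negligible (?N \<union> G ` ?N')"
      using neg negligible_bilipschitz_image[OF bilG _ neg'] by (intro negligible_Un) auto
    show "{z \<in> B. \<not> has_jacobian_at (F' \<circ> F) (f z / h ((F' \<circ> F) z)) z} \<subseteq> ?N \<union> G ` ?N'"
    proof (rule ccontr)
      assume "\<not> ?thesis"
      then obtain z where z: "z \<in> B" "\<not> has_jacobian_at (F' \<circ> F) (f z / h ((F' \<circ> F) z)) z"
        "z \<notin> ?N" "z \<notin> G ` ?N'" by blast
      have 1: "has_jacobian_at F (f z / g (F z)) z" using z by blast
      have "F z \<in> B" "G (F z) = z" using F(1) z(1) by auto
      then have 2: "has_jacobian_at F' (g (F z) / h (F' (F z))) (F z)"
        using z(4) image_eqI[of z G "F z" ?N'] by auto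
      have "g (F z) \<noteq> 0" using pos[of "F z"] by simp
      \<comment> \<open>The intermediate density cancels in the chain rule.\<close>
      then have "f z / g (F z) * (g (F z) / h (F' (F z))) = f z / h ((F' \<circ> F) z)" by simp
      then show False using has_jacobian_at_compose[OF 1 2] z(2) by metis
    qed
  qed
  ultimately show ?thesis
    unfolding density_equiv_def
    using F F' by (intro exI[of _ "F' \<circ> F"] exI[of _ "G \<circ> G'"]) auto
qed

lemma density_equiv_AE:
  assumes "density_equiv L B f g" and "negligible {z \<in> B. f z \<noteq> f' z}"
  shows "density_equiv L B f' g"
proof -
  obtain F G where F: "\<forall>z\<in>B. F z \<in> B \<and> G (F z) = z" "\<forall>z\<in>B. G z \<in> B \<and> F (G z) = z"
    "\<forall>z\<in>interior B. F z \<in> interior B \<and> G z \<in> interior B"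
    and bil: "bilipschitz_on L B F"
    and pl: "polytopewise_affine_on (interior B) F" "polytopewise_affine_on (interior B) G"
    and neg: "negligible {z \<in> B. \<not> has_jacobian_at F (f z / g (F z)) z}"
    using assms(1) unfolding density_equiv_def by blast
  have "negligible {z \<in> B. \<not> has_jacobian_at F (f' z / g (F z)) z}"
    by (rule negligible_subset[OF negligible_Un[OF neg assms(2)]]) auto
  then show ?thesis unfolding density_equiv_def using F bil pl by blast
qed

section \<open>Moving the apex of a tent\<close>

text \<open>The tent over the polygon where all the affine functions are nonnegative. The map
  \<open>z \<mapsto> z + tent g h z *\<^sub>R w\<close> moves the apex by \<open>w\<close> and has Jacobian
  \<open>1 + g i \<bullet> w\<close> where the \<open>i\<close>-th affine function is the smallest; its inverse is of the same
  form, with the functions divided by these Jacobians and \<open>w\<close> replaced by \<open>- w\<close>.\<close>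

definition tent :: "('i::finite \<Rightarrow> 'a::euclidean_space) \<Rightarrow> ('i \<Rightarrow> real) \<Rightarrow> 'a \<Rightarrow> real" where
  "tent g h z = max 0 (Min (range (\<lambda>i. g i \<bullet> z + h i)))"

lemma tent_nonneg: "0 \<le> tent g h z" unfolding tent_def by simp

lemma tent_pos_iff: "tent g h z > 0 \<longleftrightarrow> (\<forall>i. g i \<bullet> z + h i > 0)"
  unfolding tent_def less_max_iff_disj by (subst Min_gr_iff) auto

lemma tent_le: "tent g h z > 0 \<Longrightarrow> tent g h z \<le> g i \<bullet> z + h i"
proof -
  assume "tent g h z > 0"
  then have "tent g h z = Min (range (\<lambda>i. g i \<bullet> z + h i))" unfolding tent_def by linarith
  then show ?thesis by simp
qed

lemma tent_eqI:
  assumes "t \<ge> 0" "\<And>j. t \<le> g j \<bullet> z + h j" "t = g i \<bullet> z + h i"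
  shows "tent g h z = t"
proof -
  have "Min (range (\<lambda>i. g i \<bullet> z + h i)) = t"
    using assms by (intro Min_eqI) auto
  then show ?thesis using assms(1) by (simp add: tent_def)
qed

lemma Min_range_attained:
  fixes f :: "'i::finite \<Rightarrow> real"
  obtains i where "Min (range f) = f i"
proof -
  have "Min (range f) \<in> range f" by (rule Min_in) auto
  then show thesis using that unfolding image_iff by blast
qed

lemma tent_attained:
  assumes "tent g h z > 0"
  obtains i where "tent g h z = g i \<bullet> z + h i"
proof -
  have "tent g h z = Min (range (\<lambda>i. g i \<bullet> z + h i))" using assms unfolding tent_def by linarith
  then show ?thesis using Min_range_attained that by metis
qed

lemma tent_eq_0I: "g i \<bullet> z + h i \<le> 0 \<Longrightarrow> tent g h z = 0"
  using tent_pos_iff[of g h z] tent_nonneg[of g h z] by (metis less_eq_real_def linorder_not_less)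

text \<open>The factor \<open>c\<close> stands for the length of the displacement \<open>w\<close>:
  gradients grow as a tent shrinks, and only the product of both lengths is bounded independently of
  the scale.\<close>

lemma tent_lipschitz:
  assumes "\<And>i. norm (g i) * c \<le> K" "c \<ge> 0"
  shows "\<bar>tent g h z - tent g h y\<bar> * c \<le> K * dist z y"
proof -
  have K: "0 \<le> K" using assms by (meson norm_ge_zero mult_nonneg_nonneg order_trans)
  have 1: "(tent g h z - tent g h y) * c \<le> K * dist z y" for z y
  proof (cases "tent g h z \<le> tent g h y")
    case True
    then have "(tent g h z - tent g h y) * c \<le> 0" using assms(2) by (simp add: mult_nonpos_nonneg)
    also have "0 \<le> K * dist z y" using K by simp
    finally show ?thesis .
  next
    case False
    then have pos: "tent g h z > 0" using tent_nonneg[of g h y] by linarith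
    \<comment> \<open>The function that is smallest at \<open>y\<close> bounds the tent from below
      at \<open>y\<close> and from above at \<open>z\<close>, so one gradient controls the
      difference.\<close>
    obtain i where i: "Min (range (\<lambda>i. g i \<bullet> y + h i)) = g i \<bullet> y + h i"
      by (rule Min_range_attained)
    have "tent g h z - tent g h y \<le> (g i \<bullet> z + h i) - (g i \<bullet> y + h i)"
      using tent_le[OF pos, of i] i unfolding tent_def[of g h y] by linarith
    also have "\<dots> = g i \<bullet> (z - y)" by (simp add: inner_diff_right)
    also have "\<dots> \<le> norm (g i) * norm (z - y)" by (rule norm_cauchy_schwarz)
    finally have "(tent g h z - tent g h y) * c \<le> norm (g i) * norm (z - y) * c"
      using assms(2) by (intro mult_right_mono) auto
    also have "\<dots> = (norm (g i) * c) * norm (z - y)" by simp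
    also have "\<dots> \<le> K * norm (z - y)" using assms(1) by (intro mult_right_mono) auto
    finally show ?thesis by (simp add: dist_norm)
  qed
  show ?thesis using 1[of z y] 1[of y z] by (cases "tent g h z \<le> tent g h y") (auto simp: dist_commute)
qed

lemma tent_scaled_pos_iff:
  assumes "\<And>i. 1 + g i \<bullet> w > 0"
  shows "tent (\<lambda>i. g i /\<^sub>R (1 + g i \<bullet> w)) (\<lambda>i. h i / (1 + g i \<bullet> w)) z > 0 \<longleftrightarrow> tent g h z > 0"
proof -
  have eq: "(g i /\<^sub>R (1 + g i \<bullet> w)) \<bullet> z + h i / (1 + g i \<bullet> w) = (g i \<bullet> z + h i) / (1 + g i \<bullet> w)" for i
    by (simp add: divide_inverse algebra_simps)
  show ?thesis unfolding tent_pos_iff eq by (simp add: pos_less_divide_eq[OF assms])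
qed

text \<open>With \<open>t\<close> the value of the tent, moving by \<open>t *\<^sub>R w\<close> adds
  \<open>t * (g j \<bullet> w)\<close> to the \<open>j\<close>-th function. This makes it at least
  \<open>t * (1 + g j \<bullet> w)\<close>, with equality for a minimal index, so that after
  division the minimum is \<open>t\<close> again.\<close>

lemma tent_scaled_moved:
  assumes "\<And>i. 1 + g i \<bullet> w > 0" "tent g h z > 0"
  shows "tent (\<lambda>i. g i /\<^sub>R (1 + g i \<bullet> w)) (\<lambda>i. h i / (1 + g i \<bullet> w)) (z + tent g h z *\<^sub>R w) = tent g h z"
proof -
  let ?t = "tent g h z"
  have eq: "(g j /\<^sub>R (1 + g j \<bullet> w)) \<bullet> (z + ?t *\<^sub>R w) + h j / (1 + g j \<bullet> w)
      = (g j \<bullet> z + h j + ?t * (g j \<bullet> w)) / (1 + g j \<bullet> w)" for j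
    by (simp add: inner_add_right add_divide_distrib divide_inverse algebra_simps)
  obtain i where i: "?t = g i \<bullet> z + h i" using tent_attained[OF assms(2)] .
  show ?thesis
  proof (rule tent_eqI)
    fix j
    have "?t * (1 + g j \<bullet> w) \<le> g j \<bullet> z + h j + ?t * (g j \<bullet> w)"
      using tent_le[OF assms(2), of j] by (simp add: algebra_simps)
    then show "?t \<le> (g j /\<^sub>R (1 + g j \<bullet> w)) \<bullet> (z + ?t *\<^sub>R w) + h j / (1 + g j \<bullet> w)"
      unfolding eq using assms(1)[of j] by (simp add: pos_le_divide_eq)
  next
    have "?t * (1 + g i \<bullet> w) = g i \<bullet> z + h i + ?t * (g i \<bullet> w)"
      using i by (simp add: algebra_simps)
    then show "?t = (g i /\<^sub>R (1 + g i \<bullet> w)) \<bullet> (z + ?t *\<^sub>R w) + h i / (1 + g i \<bullet> w)"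
      unfolding eq using assms(1)[of i] by (simp add: eq_divide_eq)
  qed (use assms in auto)
qed

lemma det_rank_one_update:
  fixes g w :: "real^2"
  shows "det (matrix (\<lambda>v. v + (g \<bullet> v) *\<^sub>R w)) = 1 + g \<bullet> w"
  by (simp add: det_2 matrix_def inner_axis inner_vec_def sum_2 axis_def algebra_simps)

section \<open>Simultaneous moves of tents with disjoint supports\<close>

locale star_moves =
  fixes E :: "'q set" and g :: "'q \<Rightarrow> 'i::finite \<Rightarrow> real^2" and h :: "'q \<Rightarrow> 'i \<Rightarrow> real"
    and w :: "'q \<Rightarrow> real^2"
  assumes disj: "\<And>q q' z. q \<in> E \<Longrightarrow> q' \<in> E \<Longrightarrow> tent (g q) (h q) z > 0 \<Longrightarrow> tent (g q') (h q') z > 0 \<Longrightarrow> q = q'"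
    and pos: "\<And>q i. q \<in> E \<Longrightarrow> 1 + g q i \<bullet> w q > 0"
begin

text \<open>Disjoint supports make the choice unique, so all single moves are performed at once,
  even if \<open>E\<close> is infinite.\<close>

definition move :: "real^2 \<Rightarrow> real^2" where
  "move z = (if \<exists>q\<in>E. tent (g q) (h q) z > 0
     then (let q = SOME q. q \<in> E \<and> tent (g q) (h q) z > 0 in z + tent (g q) (h q) z *\<^sub>R w q) else z)"

lemma move_eq:
  assumes "q \<in> E" "tent (g q) (h q) z > 0"
  shows "move z = z + tent (g q) (h q) z *\<^sub>R w q"
proof -
  have "(SOME q. q \<in> E \<and> tent (g q) (h q) z > 0) = q"
    by (rule some_equality) (use assms disj in auto)
  then show ?thesis unfolding move_def using assms by auto
qed

lemma move_id: "(\<And>q. q \<in> E \<Longrightarrow> tent (g q) (h q) z = 0) \<Longrightarrow> move z = z"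
  unfolding move_def by auto

text \<open>Each point is displaced by at most one tent. Two points therefore involve at most two
  tents, each contributing \<open>K\<close>, whence the factor 2 irrespective of the size of
  \<open>E\<close>.\<close>

lemma move_lipschitz:
  assumes K: "\<And>q i. q \<in> E \<Longrightarrow> norm (g q i) * norm (w q) \<le> K" "K \<ge> 0"
  shows "dist (move z) (move y) \<le> (1 + 2 * K) * dist z y"
proof -
  have T: "norm ((tent (g q) (h q) z - tent (g q) (h q) y) *\<^sub>R w q) \<le> K * dist z y" if "q \<in> E" for q z y
    using tent_lipschitz[of "g q" "norm (w q)" K "h q" z y] K(1)[OF that] by simp
  have zero: "tent (g q) (h q) z = 0" if "q \<in> E" "\<not> tent (g q) (h q) z > 0" for q z
    using that tent_nonneg[of "g q" "h q" z] by linarith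
  have nn: "0 \<le> K * dist z y" using K(2) by simp
  have D: "norm ((move z - z) - (move y - y)) \<le> 2 * (K * dist z y)"
  proof (cases "\<exists>q\<in>E. tent (g q) (h q) z > 0")
    case True
    then obtain q where q: "q \<in> E" "tent (g q) (h q) z > 0" by blast
    show ?thesis
    proof (cases "\<exists>q\<in>E. tent (g q) (h q) y > 0")
      case True
      then obtain p where p: "p \<in> E" "tent (g p) (h p) y > 0" by blast
      show ?thesis
      proof (cases "p = q")
        case True
        then have "(move z - z) - (move y - y) = (tent (g q) (h q) z - tent (g q) (h q) y) *\<^sub>R w q"
          using move_eq q p by (simp add: scaleR_diff_left)
        then show ?thesis using T[OF q(1), of z y] nn by simp
      next
        case False
        then have 0: "tent (g p) (h p) z = 0" "tent (g q) (h q) y = 0"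
          using disj zero q p by metis+
        \<comment> \<open>With the vanishing terms inserted, each displacement is a multiple of the
          increment of one tent between the two points.\<close>
        have "(move z - z) - (move y - y) = (tent (g q) (h q) z - tent (g q) (h q) y) *\<^sub>R w q
           + (tent (g p) (h p) z - tent (g p) (h p) y) *\<^sub>R w p"
          using move_eq[OF q] move_eq[OF p] by (simp add: 0)
        also have "norm \<dots> \<le> K * dist z y + K * dist z y"
          by (rule order_trans[OF norm_triangle_ineq add_mono]) (rule T q p)+
        finally show ?thesis by simp
      qed
    next
      case False
      then have "tent (g q) (h q) y = 0" "move y = y" using zero q move_id by auto
      then have "(move z - z) - (move y - y) = (tent (g q) (h q) z - tent (g q) (h q) y) *\<^sub>R w q"
        using move_eq q by simp
      then show ?thesis using T[OF q(1), of z y] nn by simp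
    qed
  next
    case False
    then have z: "move z = z" using zero move_id by metis
    show ?thesis
    proof (cases "\<exists>q\<in>E. tent (g q) (h q) y > 0")
      case True
      then obtain p where p: "p \<in> E" "tent (g p) (h p) y > 0" by blast
      then have "tent (g p) (h p) z = 0" using zero False by auto
      then have "(move z - z) - (move y - y) = (tent (g p) (h p) z - tent (g p) (h p) y) *\<^sub>R w p"
        using move_eq p z by simp
      then show ?thesis using T[OF p(1), of z y] nn by simp
    next
      case False
      then have "move y = y" using zero move_id by metis
      then show ?thesis using z nn by simp
    qed
  qed
  have "norm (move z - move y) = norm ((z - y) + ((move z - z) - (move y - y)))" by simp
  also have "\<dots> \<le> norm (z - y) + norm ((move z - z) - (move y - y))" by (rule norm_triangle_ineq)
  also have "\<dots> \<le> norm (z - y) + 2 * (K * dist z y)" using D by (rule add_left_mono)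
  finally show ?thesis by (simp add: dist_norm algebra_simps)
qed

lemma has_jacobian_at_move:
  assumes q: "q \<in> E" and i: "g q i \<bullet> z + h q i > 0"
    and min: "\<And>j. j \<noteq> i \<Longrightarrow> g q i \<bullet> z + h q i < g q j \<bullet> z + h q j"
  shows "has_jacobian_at move (1 + g q i \<bullet> w q) z"
proof -
  define U where "U = {y. g q i \<bullet> y + h q i > 0} \<inter> (\<Inter>j\<in>-{i}. {y. g q i \<bullet> y + h q i < g q j \<bullet> y + h q j})"
  have "open U" unfolding U_def
    by (intro open_Int open_INT ballI open_Collect_less continuous_intros) auto
  moreover have "z \<in> U" using i min unfolding U_def by auto
  moreover have "y + (g q i \<bullet> y + h q i) *\<^sub>R w q = move y" if "y \<in> U" for y
  proof -
    have *: "g q i \<bullet> y + h q i \<le> g q j \<bullet> y + h q j" for j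
      using that unfolding U_def by (cases "j = i") (auto simp: less_imp_le)
    have "tent (g q) (h q) y = g q i \<bullet> y + h q i"
      by (rule tent_eqI) (use that * in \<open>auto simp: U_def\<close>)
    moreover have "g q i \<bullet> y + h q i > 0" using that unfolding U_def by auto
    ultimately show ?thesis using move_eq[OF q, of y] by simp
  qed
  moreover have "((\<lambda>y. y + (g q i \<bullet> y + h q i) *\<^sub>R w q) has_derivative (\<lambda>v. v + (g q i \<bullet> v) *\<^sub>R w q)) (at z)"
    by (auto intro!: derivative_eq_intros)
  ultimately have "(move has_derivative (\<lambda>v. v + (g q i \<bullet> v) *\<^sub>R w q)) (at z)"
    using has_derivative_transform_within_open[of _ _ z UNIV U move] by blast
  then show ?thesis unfolding has_jacobian_at_def using det_rank_one_update by blast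
qed

lemma has_jacobian_at_move_id:
  assumes "open U" "z \<in> U" "\<And>y q. y \<in> U \<Longrightarrow> q \<in> E \<Longrightarrow> tent (g q) (h q) y = 0"
  shows "has_jacobian_at move 1 z"
proof -
  have "((\<lambda>y. y) has_derivative (\<lambda>v. v)) (at z)" by (rule has_derivative_ident)
  then have "(move has_derivative (\<lambda>v. v)) (at z)"
    by (rule has_derivative_transform_within_open[OF _ assms(1,2)]) (use move_id assms(3) in metis)
  moreover have "det (matrix (\<lambda>v::real^2. v)) = 1"
    using det_rank_one_update[of 0 0] by simp
  ultimately show ?thesis unfolding has_jacobian_at_def by blast
qed

text \<open>A piece \<open>P\<close> meets the support of one tent at most. It is cut according to
  which affine function is the smallest, as long as that one is nonnegative; where some function is
  nonpositive the map is the identity.\<close>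

lemma polytopewise_affine_move:
  assumes "locally_finite_in (top_of_set \<Omega>) \<P>" "\<Union>\<P> = \<Omega>"
    and poly: "\<And>P. P \<in> \<P> \<Longrightarrow> polytope P"
    and one: "\<And>P. P \<in> \<P> \<Longrightarrow> \<exists>q. \<forall>p\<in>E. p \<noteq> q \<longrightarrow> (\<forall>z\<in>P. tent (g p) (h p) z = 0)"
  shows "polytopewise_affine_on \<Omega> move"
proof (rule polytopewise_affine_on_refine[OF assms(1,2)])
  fix P assume P: "P \<in> \<P>"
  obtain q where q: "\<And>p z. p \<in> E \<Longrightarrow> p \<noteq> q \<Longrightarrow> z \<in> P \<Longrightarrow> tent (g p) (h p) z = 0"
    using one[OF P] by blast
  show "\<exists>R. finite R \<and> \<Union>R = P \<and> (\<forall>S\<in>R. polytope S \<and> affine_map_on S move)"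
  proof (cases "q \<in> E")
    case False
    then have "move z = z" if "z \<in> P" for z using move_id q that by metis
    then have "affine_map_on P move" unfolding affine_map_on_def
      by (intro exI[of _ "\<lambda>z. z"] exI[of _ 0]) (auto simp: linear_ident)
    then show ?thesis using poly[OF P] by (intro exI[of _ "{P}"]) auto
  next
    case True
    let ?l = "\<lambda>i z. g q i \<bullet> z + h q i"
    have mv: "move z = z + tent (g q) (h q) z *\<^sub>R w q" if "z \<in> P" for z
    proof (cases "tent (g q) (h q) z > 0")
      case True then show ?thesis using move_eq \<open>q \<in> E\<close> by blast
    next
      case False
      then have 0: "tent (g q) (h q) z = 0" using tent_nonneg[of "g q" "h q" z] by linarith
      then have "move z = z" using move_id q that by metis
      then show ?thesis using 0 by simp
    qed
    define up where "up i = P \<inter> ({z. - g q i \<bullet> z \<le> h q i} \<inter> (\<Inter>j. {z. (g q i - g q j) \<bullet> z \<le> h q j - h q i}))" for i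
    define dn where "dn i = P \<inter> {z. g q i \<bullet> z \<le> - h q i}" for i
    have hs: "polyhedron {z. a \<bullet> z \<le> b}" for a :: "real^2" and b
      by (cases "a = 0"; cases "0 \<le> b") (simp_all add: polyhedron_halfspace_le)
    have "polytope (up i)" "polytope (dn i)" for i
      unfolding up_def dn_def
      by (intro polytope_Int_polyhedron poly[OF P] polyhedron_Int polyhedron_Inter hs; auto simp: hs)+
    moreover have "affine_map_on (up i) move" for i
      unfolding affine_map_on_def
    proof (intro exI conjI ballI)
      show "linear (\<lambda>v. v + (g q i \<bullet> v) *\<^sub>R w q)"
        by (intro linearI) (auto simp: inner_add_right algebra_simps)
      fix z assume z: "z \<in> up i"
      have "tent (g q) (h q) z = ?l i z"
        by (rule tent_eqI) (use z in \<open>auto simp: up_def inner_diff_left algebra_simps\<close>)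
      then show "move z = z + (g q i \<bullet> z) *\<^sub>R w q + h q i *\<^sub>R w q"
        using mv[of z] z by (simp add: up_def algebra_simps)
    qed
    moreover have "affine_map_on (dn i) move" for i
      unfolding affine_map_on_def
    proof (intro exI conjI ballI)
      show "linear (\<lambda>v::real^2. v)" by (rule linear_ident)
      fix z assume z: "z \<in> dn i"
      have "tent (g q) (h q) z = 0" by (rule tent_eq_0I[of _ i]) (use z in \<open>auto simp: dn_def\<close>)
      then show "move z = z + 0" using mv[of z] z by (simp add: dn_def)
    qed
    moreover have "\<Union>(range up \<union> range dn) = P"
    proof
      show "\<Union>(range up \<union> range dn) \<subseteq> P" by (auto simp: up_def dn_def)
      show "P \<subseteq> \<Union>(range up \<union> range dn)"
      proof
        fix z assume z: "z \<in> P"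
        obtain i where i: "Min (range (\<lambda>i. ?l i z)) = ?l i z"
          by (rule Min_range_attained)
        have "?l i z \<le> ?l j z" for j
        proof -
          have "Min (range (\<lambda>i. ?l i z)) \<le> ?l j z" by (rule Min_le) auto
          then show ?thesis using i by simp
        qed
        then have "z \<in> up i \<or> z \<in> dn i"
          using z unfolding up_def dn_def
          by (cases "?l i z \<le> 0") (auto simp: inner_diff_left algebra_simps)
        then show "z \<in> \<Union>(range up \<union> range dn)" by blast
      qed
    qed
    moreover have "finite (range up \<union> range dn)" by simp
    ultimately show ?thesis by (intro exI[of _ "range up \<union> range dn"]) auto
  qed
qed

end

section \<open>The inverse of a simultaneous move\<close>

context star_moves
begin

abbreviation inv_g where "inv_g q i \<equiv> g q i /\<^sub>R (1 + g q i \<bullet> w q)"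
abbreviation inv_h where "inv_h q i \<equiv> h q i / (1 + g q i \<bullet> w q)"

lemma inv_tent_pos_iff:
  "q \<in> E \<Longrightarrow> tent (inv_g q) (inv_h q) z > 0 \<longleftrightarrow> tent (g q) (h q) z > 0"
  by (rule tent_scaled_pos_iff) (rule pos)

lemma star_moves_inv: "star_moves E inv_g inv_h (\<lambda>q. - w q)"
proof
  show "q = q'" if "q \<in> E" "q' \<in> E" "tent (inv_g q) (inv_h q) z > 0" "tent (inv_g q') (inv_h q') z > 0" for q q' z
    using that disj inv_tent_pos_iff by blast
  show "1 + inv_g q i \<bullet> - w q > 0" if "q \<in> E" for q i
  proof -
    have "1 + inv_g q i \<bullet> - w q = 1 / (1 + g q i \<bullet> w q)"
      using pos[OF that, of i] by (simp add: field_simps)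
    then show ?thesis using pos[OF that, of i] by simp
  qed
qed

lemma inv_move_move: "star_moves.move E inv_g inv_h (\<lambda>q. - w q) (move z) = z"
proof -
  interpret inv: star_moves E inv_g inv_h "\<lambda>q. - w q" by (rule star_moves_inv)
  show ?thesis
  proof (cases "\<exists>q\<in>E. tent (g q) (h q) z > 0")
    case True
    then obtain q where q: "q \<in> E" "tent (g q) (h q) z > 0" by blast
    have "tent (inv_g q) (inv_h q) (move z) = tent (g q) (h q) z"
      using tent_scaled_moved[OF pos q(2)] q move_eq[OF q] by simp
    then show ?thesis using inv.move_eq[OF q(1), of "move z"] q move_eq[OF q] by simp
  next
    case False
    then have 0: "tent (g q) (h q) z = 0" if "q \<in> E" for q
      using that tent_nonneg[of "g q" "h q" z] by force
    have "tent (inv_g q) (inv_h q) z = 0" if "q \<in> E" for q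
      using 0[OF that] tent_scaled_pos_iff[of "g q" "w q" "h q" z] pos[OF that]
        tent_nonneg[of "inv_g q" "inv_h q" z] by simp
    then show ?thesis using 0 move_id inv.move_id by simp
  qed
qed

lemma move_inv_move: "move (star_moves.move E inv_g inv_h (\<lambda>q. - w q) z) = z"
proof -
  interpret inv: star_moves E inv_g inv_h "\<lambda>q. - w q" by (rule star_moves_inv)
  show ?thesis
  proof (cases "\<exists>q\<in>E. tent (inv_g q) (inv_h q) z > 0")
    case True
    then obtain q where q: "q \<in> E" "tent (inv_g q) (inv_h q) z > 0" by blast
    have p: "1 + g q i \<bullet> w q \<noteq> 0" for i using pos[OF q(1), of i] by simp
    have e: "1 + inv_g q i \<bullet> - w q = 1 / (1 + g q i \<bullet> w q)" for i
      using p[of i] by (simp add: field_simps)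
    \<comment> \<open>Inverting the parameters twice restores the original tent, so the formula for
      a moved tent applies to the inverse move as well.\<close>
    have "inv.inv_g q i = g q i" "inv.inv_h q i = h q i" for i
      unfolding e using p[of i] by simp_all
    then have t: "tent (g q) (h q) (inv.move z) = tent (inv_g q) (inv_h q) z"
      using tent_scaled_moved[OF inv.pos q(2)] q inv.move_eq[OF q] by simp
    then show ?thesis using move_eq[OF q(1), of "inv.move z"] q inv.move_eq[OF q] by simp
  next
    case False
    then have 0: "tent (inv_g q) (inv_h q) z = 0" if "q \<in> E" for q
      using that tent_nonneg[of "inv_g q" "inv_h q" z] by force
    have "tent (g q) (h q) z = 0" if "q \<in> E" for q
      using 0[OF that] tent_scaled_pos_iff[of "g q" "w q" "h q" z] pos[OF that]
        tent_nonneg[of "g q" "h q" z] by simp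
    then show ?thesis using 0 move_id inv.move_id by simp
  qed
qed

text \<open>A point of a support stays in that support, and every other point is fixed.\<close>

lemma move_preserves:
  assumes "\<And>q z. q \<in> E \<Longrightarrow> tent (g q) (h q) z > 0 \<Longrightarrow> z \<in> S" "z \<in> S"
  shows "move z \<in> S"
proof (cases "\<exists>q\<in>E. tent (g q) (h q) z > 0")
  case True
  then obtain q where q: "q \<in> E" "tent (g q) (h q) z > 0" by blast
  have "tent (inv_g q) (inv_h q) (move z) > 0"
    using tent_scaled_moved[OF pos q(2)] q move_eq[OF q] by simp
  then have "tent (g q) (h q) (move z) > 0" using inv_tent_pos_iff q(1) by blast
  then show ?thesis using assms(1) q(1) by blast
next
  case False
  then have "tent (g q) (h q) z = 0" if "q \<in> E" for q
    using that tent_nonneg[of "g q" "h q" z] by force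
  then show ?thesis using assms(2) move_id by simp
qed

text \<open>In the inverse move the gradients are divided by Jacobians that are at least
  \<open>\<eta>\<close>, so \<open>K / \<eta>\<close> replaces \<open>K\<close>; as
  \<open>\<eta> \<le> 1\<close>, the resulting constant serves both directions.\<close>

theorem density_equiv_move:
  assumes K: "\<And>q i. q \<in> E \<Longrightarrow> norm (g q i) * norm (w q) \<le> K" "K \<ge> 0"
    and eta: "\<And>q i. q \<in> E \<Longrightarrow> \<eta> \<le> 1 + g q i \<bullet> w q" "0 < \<eta>" "\<eta> \<le> 1"
    and supp: "\<And>q z. q \<in> E \<Longrightarrow> tent (g q) (h q) z > 0 \<Longrightarrow> z \<in> interior B"
    and lf: "locally_finite_in (top_of_set (interior B)) \<P>" "\<Union>\<P> = interior B"
    and poly: "\<And>P. P \<in> \<P> \<Longrightarrow> polytope P"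
    and one: "\<And>P. P \<in> \<P> \<Longrightarrow> \<exists>q. \<forall>p\<in>E. p \<noteq> q \<longrightarrow> (\<forall>z\<in>P. tent (g p) (h p) z = 0)"
    and neg: "negligible {z \<in> B. \<not> has_jacobian_at move (f1 z / f2 (move z)) z}"
  shows "density_equiv (1 + 2 * K / \<eta>) B f1 f2"
proof -
  interpret inv: star_moves E inv_g inv_h "\<lambda>q. - w q" by (rule star_moves_inv)
  have B: "tent (g q) (h q) z > 0 \<Longrightarrow> z \<in> B" if "q \<in> E" for q z
    using supp[OF that] interior_subset by blast
  have le: "1 + 2 * K \<le> 1 + 2 * K / \<eta>"
    using K(2) eta(2,3) by (simp add: pos_le_divide_eq mult_left_le)
  have Kinv: "norm (inv_g q i) * norm (- w q) \<le> K / \<eta>" if q: "q \<in> E" for q i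
  proof -
    have "norm (inv_g q i) * norm (- w q) = norm (g q i) * norm (w q) / (1 + g q i \<bullet> w q)"
      using pos[OF q, of i] by (simp add: divide_inverse mult_ac)
    also have "\<dots> \<le> K / \<eta>" using K(1)[OF q] eta(1)[OF q, of i] eta(2) K(2) by (intro frac_le) auto
    finally show ?thesis .
  qed
  have "bilipschitz_on (1 + 2 * K / \<eta>) B move"
    unfolding bilipschitz_on_def
  proof (intro ballI conjI)
    fix z y
    have d: "0 < 1 + 2 * K / \<eta>" using K(2) eta(2) by (simp add: add_pos_nonneg)
    have "dist (inv.move (move z)) (inv.move (move y)) \<le> (1 + 2 * (K / \<eta>)) * dist (move z) (move y)"
      using Kinv K(2) eta(2) by (intro inv.move_lipschitz) auto
    then show "1 / (1 + 2 * K / \<eta>) * dist z y \<le> dist (move z) (move y)"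
      using d by (simp add: inv_move_move pos_divide_le_eq mult.commute)
    have "dist (move z) (move y) \<le> (1 + 2 * K) * dist z y" using K by (rule move_lipschitz)
    also have "\<dots> \<le> (1 + 2 * K / \<eta>) * dist z y" using le by (intro mult_right_mono) auto
    finally show "dist (move z) (move y) \<le> (1 + 2 * K / \<eta>) * dist z y" .
  qed
  moreover have "polytopewise_affine_on (interior B) move"
    by (rule polytopewise_affine_move[OF lf poly one])
  moreover have "polytopewise_affine_on (interior B) inv.move"
  proof (rule inv.polytopewise_affine_move[OF lf poly])
    fix P assume "P \<in> \<P>"
    then obtain q where q: "\<forall>p\<in>E. p \<noteq> q \<longrightarrow> (\<forall>z\<in>P. tent (g p) (h p) z = 0)" using one by blast
    have "tent (inv_g p) (inv_h p) z = 0" if "p \<in> E" "p \<noteq> q" "z \<in> P" for p z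
      using q that inv_tent_pos_iff[OF that(1), of z] tent_nonneg[of "inv_g p" "inv_h p" z] by force
    then show "\<exists>q. \<forall>p\<in>E. p \<noteq> q \<longrightarrow> (\<forall>z\<in>P. tent (inv_g p) (inv_h p) z = 0)" by blast
  qed
  moreover have "\<forall>z\<in>B. move z \<in> B" "\<forall>z\<in>interior B. move z \<in> interior B"
    using move_preserves[of B] move_preserves[of "interior B"] B supp by simp_all
  moreover have "\<forall>z\<in>B. inv.move z \<in> B" "\<forall>z\<in>interior B. inv.move z \<in> interior B"
    using inv.move_preserves[of B] inv.move_preserves[of "interior B"] B supp inv_tent_pos_iff by simp_all
  ultimately show ?thesis
    unfolding density_equiv_def using neg inv_move_move move_inv_move
    by (intro exI[of _ move] exI[of _ inv.move]) auto
qed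

end

section \<open>Moving the centre of a quadrilateral\<close>

definition cross2 :: "real^2 \<Rightarrow> real^2 \<Rightarrow> real" where
  "cross2 p q = p $ 1 * q $ 2 - p $ 2 * q $ 1"

definition perp :: "real^2 \<Rightarrow> real^2" where
  "perp v = vector [v $ 2, - v $ 1]"

lemma inner_perp: "perp v \<bullet> z = cross2 z v"
  by (simp add: perp_def cross2_def inner_vec_def sum_2)

lemma norm_perp: "norm (perp v) = norm v"
  by (simp add: norm_eq_sqrt_inner inner_vec_def sum_2 perp_def add.commute)

lemma cross2_bilinear:
  "cross2 (x + y) z = cross2 x z + cross2 y z" "cross2 z (x + y) = cross2 z x + cross2 z y"
  "cross2 (x - y) z = cross2 x z - cross2 y z" "cross2 z (x - y) = cross2 z x - cross2 z y"
  "cross2 (- x) z = - cross2 x z" "cross2 z (- x) = - cross2 z x"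
  "cross2 (r *\<^sub>R x) z = r * cross2 x z" "cross2 z (r *\<^sub>R x) = r * cross2 z x"
  "cross2 x x = 0"
  by (simp_all add: cross2_def algebra_simps)

lemma cross2_commute: "cross2 y x = - cross2 x y"
  by (simp add: cross2_def)

lemma content_triangle_cross2:
  "measure lebesgue (convex hull {a, b, c}) = \<bar>cross2 (b - a) (c - a)\<bar> / 2"
proof -
  have "measure lebesgue (convex hull {a, b, c}) = measure lborel (convex hull {a, b, c})"
    by (simp add: borel_compact finite_imp_compact_convex_hull)
  then show ?thesis
    by (simp add: content_triangle cross2_def algebra_simps abs_minus_commute)
qed

lemma interior_triangleE:
  fixes a b c :: "real^2"
  assumes "z \<in> interior (convex hull {a, b, c})"
  obtains x y t where "0 < x" "0 < y" "0 < t" "x + y + t = 1" "z = x *\<^sub>R a + y *\<^sub>R b + t *\<^sub>R c"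
proof -
  have "\<not> collinear {a, b, c}"
  proof
    assume "collinear {a, b, c}"
    then have "aff_dim (convex hull {a, b, c}) \<le> 1"
      by (simp add: collinear_aff_dim aff_dim_convex_hull)
    moreover have "aff_dim (convex hull {a, b, c}) = 2"
      using aff_dim_nonempty_interior[of "convex hull {a, b, c}"] assms by auto
    ultimately show False by simp
  qed
  then have "z \<in> {v. \<exists>x y z. 0 < x \<and> 0 < y \<and> 0 < z \<and> x + y + z = 1 \<and> x *\<^sub>R a + y *\<^sub>R b + z *\<^sub>R c = v}"
    using assms interior_convex_hull_3_minimal[of a b c] by simp
  then show thesis using that by blast
qed

lemma in_triangleI:
  assumes "0 \<le> x" "0 \<le> y" "0 \<le> t" "x + y + t = 1" "z = x *\<^sub>R a + y *\<^sub>R b + t *\<^sub>R c"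
  shows "z \<in> convex hull {a, b, c}"
  unfolding convex_hull_3 using assms by blast

text \<open>The convex quadrilateral with diagonals \<open>a b\<close> and \<open>u w\<close>, which meet in \<open>c\<close>.\<close>

locale diamond =
  fixes a b u w :: "real^2" and \<nu> \<mu> :: real
  assumes lam: "0 < \<nu>" "\<nu> < 1" and mu: "0 < \<mu>" "\<mu> < 1"
    and meet: "a + \<nu> *\<^sub>R (b - a) = w + \<mu> *\<^sub>R (u - w)"
    and nondeg: "cross2 (b - a) (u - w) \<noteq> 0"
begin

definition "c = a + \<nu> *\<^sub>R (b - a)"
definition "\<Delta> = cross2 (b - a) (u - w)"
definition "\<xi> = (1 / \<Delta>) *\<^sub>R perp (u - w)"
definition "\<upsilon> = - (1 / \<Delta>) *\<^sub>R perp (b - a)"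

text \<open>The index selects a side of the quadrilateral: the first entry tells whether it ends at
  \<open>b\<close> or at \<open>a\<close>, the second whether at \<open>u\<close> or at
  \<open>w\<close>. The affine function with gradient \<open>grad i\<close> and constant
  \<open>const i\<close> is 1 at \<open>c\<close> and 0 on that side; \<open>\<xi>\<close> and
  \<open>\<upsilon>\<close> form the basis dual to the diagonals.\<close>

definition grad :: "bool \<times> bool \<Rightarrow> real^2" where
  "grad i = - ((if fst i then 1 / (1 - \<nu>) else - 1 / \<nu>) *\<^sub>R \<xi>) - (if snd i then 1 / (1 - \<mu>) else - 1 / \<mu>) *\<^sub>R \<upsilon>"

definition const :: "bool \<times> bool \<Rightarrow> real" where
  "const i = 1 - grad i \<bullet> c"

lemma vertices:
  "a = c - \<nu> *\<^sub>R (b - a)" "b = c + (1 - \<nu>) *\<^sub>R (b - a)"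
  "u = c + (1 - \<mu>) *\<^sub>R (u - w)" "w = c - \<mu> *\<^sub>R (u - w)"
  using meet unfolding c_def by (auto simp: algebra_simps)

lemma dual_basis:
  "\<xi> \<bullet> (b - a) = 1" "\<xi> \<bullet> (u - w) = 0" "\<upsilon> \<bullet> (b - a) = 0" "\<upsilon> \<bullet> (u - w) = 1"
proof -
  have "\<Delta> \<noteq> 0" using nondeg \<Delta>_def by simp
  moreover have "cross2 (u - w) (b - a) = - \<Delta>" unfolding \<Delta>_def by (rule cross2_commute)
  moreover have "cross2 (b - a) (u - w) = \<Delta>" unfolding \<Delta>_def by simp
  moreover have "cross2 (b - a) (b - a) = 0" "cross2 (u - w) (u - w) = 0"
    unfolding cross2_def by simp_all
  ultimately show "\<xi> \<bullet> (b - a) = 1" "\<xi> \<bullet> (u - w) = 0" "\<upsilon> \<bullet> (b - a) = 0" "\<upsilon> \<bullet> (u - w) = 1"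
    unfolding \<xi>_def \<upsilon>_def inner_scaleR_left inner_perp by simp_all
qed

lemma expand: "z = c + (\<xi> \<bullet> (z - c)) *\<^sub>R (b - a) + (\<upsilon> \<bullet> (z - c)) *\<^sub>R (u - w)"
proof -
  have *: "\<Delta> *\<^sub>R v = cross2 v (u - w) *\<^sub>R (b - a) + cross2 (b - a) v *\<^sub>R (u - w)" for v
    unfolding \<Delta>_def by (simp add: vec_eq_iff forall_2 cross2_def algebra_simps)
  have "\<Delta> \<noteq> 0" using nondeg \<Delta>_def by simp
  then have "z - c = (1 / \<Delta>) *\<^sub>R (\<Delta> *\<^sub>R (z - c))" by simp
  also have "\<dots> = (cross2 (z - c) (u - w) / \<Delta>) *\<^sub>R (b - a) + (cross2 (b - a) (z - c) / \<Delta>) *\<^sub>R (u - w)"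
    unfolding *[of "z - c"] scaleR_add_right by simp
  also have "cross2 (z - c) (u - w) / \<Delta> = \<xi> \<bullet> (z - c)"
    unfolding \<xi>_def inner_scaleR_left inner_perp by simp
  also have "cross2 (b - a) (z - c) / \<Delta> = \<upsilon> \<bullet> (z - c)"
    unfolding \<upsilon>_def inner_scaleR_left inner_perp by (simp add: cross2_commute[of "b - a" "z - c"])
  finally show ?thesis by (simp add: algebra_simps)
qed

lemma ell_eq:
  "grad i \<bullet> z + const i = 1 - (if fst i then 1 / (1 - \<nu>) else - 1 / \<nu>) * (\<xi> \<bullet> (z - c))
    - (if snd i then 1 / (1 - \<mu>) else - 1 / \<mu>) * (\<upsilon> \<bullet> (z - c))"
  unfolding const_def grad_def by (simp add: inner_diff_left inner_diff_right algebra_simps)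

text \<open>The shift is parallel to the diagonal \<open>u w\<close>, so the Jacobian depends only
  on the side of \<open>a b\<close> to which the affine function belongs. It is therefore the same
  on both halves of each of the two triangles.\<close>

lemma grad_shift:
  "grad i \<bullet> (\<tau> *\<^sub>R (u - w)) = - \<tau> * (if snd i then 1 / (1 - \<mu>) else - 1 / \<mu>)"
  unfolding grad_def using dual_basis by (simp add: inner_diff_left)

lemma in_upper_triangle:
  assumes "tent grad const z > 0" "\<upsilon> \<bullet> (z - c) \<ge> 0"
  shows "z \<in> convex hull {a, b, u}"
proof (rule in_triangleI)
  let ?x = "\<xi> \<bullet> (z - c)" and ?y = "\<upsilon> \<bullet> (z - c)"
  have l: "grad i \<bullet> z + const i > 0" for i using assms(1) unfolding tent_pos_iff by blast
  have 1: "1 - ?x / (1 - \<nu>) - ?y / (1 - \<mu>) > 0" using l[of "(True, True)"] unfolding ell_eq by simp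
  have 2: "1 + ?x / \<nu> - ?y / (1 - \<mu>) > 0" using l[of "(False, True)"] unfolding ell_eq by simp
  \<comment> \<open>These three numbers are the barycentric coordinates of \<open>z\<close> with
    respect to \<open>a\<close>, \<open>b\<close>, \<open>u\<close>.\<close>
  show "0 \<le> (1 - \<nu>) * (1 - ?x / (1 - \<nu>) - ?y / (1 - \<mu>))" using 1 lam by simp
  show "0 \<le> \<nu> * (1 + ?x / \<nu> - ?y / (1 - \<mu>))" using 2 lam by simp
  show "0 \<le> ?y / (1 - \<mu>)" using assms(2) mu by simp
  define s where "s = ?y / (1 - \<mu>)"
  have y: "?y = s * (1 - \<mu>)" unfolding s_def using mu by simp
  have A: "(1 - \<nu>) * (1 - x / (1 - \<nu>) - s) = (1 - \<nu>) * (1 - s) - x"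
    and Bb: "\<nu> * (1 + x / \<nu> - s) = \<nu> * (1 - s) + x" for x
    using lam by (simp_all add: right_diff_distrib distrib_left)
  show "(1 - \<nu>) * (1 - ?x / (1 - \<nu>) - ?y / (1 - \<mu>)) + \<nu> * (1 + ?x / \<nu> - ?y / (1 - \<mu>)) + ?y / (1 - \<mu>) = 1"
    unfolding s_def[symmetric] A Bb by (simp add: algebra_simps)
  have "((1 - \<nu>) * (1 - s) - ?x) *\<^sub>R a + (\<nu> * (1 - s) + ?x) *\<^sub>R b + s *\<^sub>R u
     = (1 - s) *\<^sub>R c + ?x *\<^sub>R (b - a) + s *\<^sub>R u"
    unfolding c_def by (simp add: algebra_simps)
  also have "\<dots> = c + ?x *\<^sub>R (b - a) + s *\<^sub>R (u - c)" by (simp add: algebra_simps)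
  also have "u - c = (1 - \<mu>) *\<^sub>R (u - w)" using vertices(3) by (simp add: algebra_simps)
  finally have "((1 - \<nu>) * (1 - s) - ?x) *\<^sub>R a + (\<nu> * (1 - s) + ?x) *\<^sub>R b + s *\<^sub>R u = z"
    using expand[of z] y by simp
  then show "z = ((1 - \<nu>) * (1 - ?x / (1 - \<nu>) - ?y / (1 - \<mu>))) *\<^sub>R a
      + (\<nu> * (1 + ?x / \<nu> - ?y / (1 - \<mu>))) *\<^sub>R b + (?y / (1 - \<mu>)) *\<^sub>R u"
    unfolding s_def[symmetric] A Bb by simp
qed

text \<open>Inside the triangle on \<open>u\<close>, a function belonging to \<open>u\<close> is
  smaller than its counterpart belonging to \<open>w\<close>, and between the two belonging to
  \<open>u\<close> the sign of the \<open>\<xi>\<close>-coordinate decides. They tie on the excluded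
  line through \<open>u\<close> and \<open>w\<close>.\<close>

lemma upper_min:
  assumes z: "z \<in> interior (convex hull {a, b, u})" and "\<xi> \<bullet> (z - c) \<noteq> 0"
  obtains i where "grad i \<bullet> z + const i > 0" "snd i"
    "\<And>j. j \<noteq> i \<Longrightarrow> grad i \<bullet> z + const i < grad j \<bullet> z + const j"
proof -
  let ?x = "\<xi> \<bullet> (z - c)" and ?y = "\<upsilon> \<bullet> (z - c)"
  obtain p q r where pqr: "0 < p" "0 < q" "0 < r" "p + q + r = 1" "z = p *\<^sub>R a + q *\<^sub>R b + r *\<^sub>R u"
    using interior_triangleE[OF z] by metis
  have "z - c = p *\<^sub>R (a - c) + q *\<^sub>R (b - c) + r *\<^sub>R (u - c)"
  proof -
    have "c = (p + q + r) *\<^sub>R c" using pqr(4) by simp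
    then show ?thesis using pqr(5) by (simp add: algebra_simps)
  qed
  also have "\<dots> = (q * (1 - \<nu>) - p * \<nu>) *\<^sub>R (b - a) + (r * (1 - \<mu>)) *\<^sub>R (u - w)"
  proof -
    have "a - c = - \<nu> *\<^sub>R (b - a)" "b - c = (1 - \<nu>) *\<^sub>R (b - a)" "u - c = (1 - \<mu>) *\<^sub>R (u - w)"
      using vertices by (auto simp: algebra_simps)
    then show ?thesis by (simp only: scaleR_scaleR) (simp add: algebra_simps)
  qed
  finally have zc: "z - c = (q * (1 - \<nu>) - p * \<nu>) *\<^sub>R (b - a) + (r * (1 - \<mu>)) *\<^sub>R (u - w)" .
  have x: "?x = q * (1 - \<nu>) - p * \<nu>" and y: "?y = r * (1 - \<mu>)"
    unfolding zc by (simp_all only: inner_add_right inner_scaleR_right dual_basis) simp_all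
  have y0: "?y / (1 - \<mu>) = r" using y mu by simp
  have ypos: "?y > 0" using y pqr mu by simp
  have p: "(1 - r) * \<nu> + ?x = q" "(1 - r) * (1 - \<nu>) - ?x = p"
  proof -
    have r: "1 - r = p + q" using pqr(4) by simp
    show "(1 - r) * \<nu> + ?x = q" "(1 - r) * (1 - \<nu>) - ?x = p"
      unfolding r x by (simp_all add: algebra_simps)
  qed
  have l1: "1 - ?x / (1 - \<nu>) - r = p / (1 - \<nu>)" using p(2) lam by (simp add: field_simps)
  have l2: "1 + ?x / \<nu> - r = q / \<nu>" using p(1) lam by (simp add: field_simps)
  have up: "grad (s, True) \<bullet> z + const (s, True) = (if s then p / (1 - \<nu>) else q / \<nu>)" for s
    unfolding ell_eq using l1 l2 y0 by simp
  have dn: "grad (s, False) \<bullet> z + const (s, False) = (if s then p / (1 - \<nu>) else q / \<nu>) + r + ?y / \<mu>" for s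
    unfolding ell_eq using l1 l2 by simp
  have yp: "?y / \<mu> > 0" using ypos mu by simp
  have d: "p / (1 - \<nu>) - q / \<nu> = - ?x * (1 / (1 - \<nu>) + 1 / \<nu>)"
  proof -
    have "(1 - x / (1 - \<nu>) - r) - (1 + x / \<nu> - r) = - x * (1 / (1 - \<nu>) + 1 / \<nu>)" for x
      by (simp add: algebra_simps)
    then show ?thesis unfolding l1[symmetric] l2[symmetric] .
  qed
  have ne: "p / (1 - \<nu>) \<noteq> q / \<nu>"
  proof
    assume "p / (1 - \<nu>) = q / \<nu>"
    then have "?x * (1 / (1 - \<nu>) + 1 / \<nu>) = 0" using d by simp
    moreover have "1 / (1 - \<nu>) + 1 / \<nu> > 0" using lam by (simp add: add_pos_pos)
    ultimately show False using assms(2) by (metis less_irrefl mult_eq_0_iff)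
  qed
  have pos: "p / (1 - \<nu>) > 0" "q / \<nu> > 0" using pqr lam by simp_all
  define s where "s \<longleftrightarrow> p / (1 - \<nu>) < q / \<nu>"
  show thesis
  proof (rule that[of "(s, True)"])
    show "grad (s, True) \<bullet> z + const (s, True) > 0" unfolding up using pos by simp
    fix j :: "bool \<times> bool" assume "j \<noteq> (s, True)"
    obtain t v where j: "j = (t, v)" by (cases j)
    show "grad (s, True) \<bullet> z + const (s, True) < grad j \<bullet> z + const j"
      unfolding j using \<open>j \<noteq> (s, True)\<close> j ne pqr(3) yp
      by (cases v; cases t; cases s) (auto simp: up dn s_def)
  qed simp
qed

lemma interior_upper_tent_pos:
  assumes z: "z \<in> interior (convex hull {a, b, u})" and "\<xi> \<bullet> (z - c) \<noteq> 0"
  shows "tent grad const z > 0"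
proof -
  obtain i where i: "grad i \<bullet> z + const i > 0" "snd i" "\<And>j. j \<noteq> i \<Longrightarrow> grad i \<bullet> z + const i < grad j \<bullet> z + const j"
    using upper_min[OF assms] by metis
  have "grad j \<bullet> z + const j > 0" for j using i(1) i(3)[of j] by (cases "j = i") auto
  then show ?thesis unfolding tent_pos_iff by blast
qed

lemma area_upper: "measure lebesgue (convex hull {a, b, u}) = (1 - \<mu>) * \<bar>\<Delta>\<bar> / 2"
proof -
  have "u - a = \<nu> *\<^sub>R (b - a) + (1 - \<mu>) *\<^sub>R (u - w)"
    using vertices(1,3) by (simp add: algebra_simps)
  then have "cross2 (b - a) (u - a) = (1 - \<mu>) * \<Delta>"
    unfolding \<Delta>_def by (simp only: cross2_bilinear)
  then show ?thesis unfolding content_triangle_cross2 using mu by (simp add: abs_mult)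
qed

text \<open>One factor \<open>\<kappa>\<close> bounds the reciprocals of \<open>\<nu>\<close>,
  \<open>1 - \<nu>\<close>, \<open>\<mu>\<close>, \<open>1 - \<mu>\<close>. The other comes from the
  dual basis, whose vectors have the length of a diagonal divided by
  \<open>\<bar>\<Delta>\<bar>\<close>, because the squared diagonals are comparable to
  \<open>\<bar>\<Delta>\<bar>\<close>. The bound does not depend on the scale.\<close>

lemma norm_grad_le:
  assumes "1 / \<kappa> \<le> \<nu>" "1 / \<kappa> \<le> 1 - \<nu>" "1 / \<kappa> \<le> \<mu>" "1 / \<kappa> \<le> 1 - \<mu>" "\<kappa> > 0"
    and "(norm (b - a))\<^sup>2 + (norm (u - w))\<^sup>2 \<le> \<kappa> * \<bar>\<Delta>\<bar>" and "\<bar>\<tau>\<bar> \<le> 1"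
  shows "norm (grad i) * norm (\<tau> *\<^sub>R (u - w)) \<le> 2 * \<kappa>\<^sup>2"
proof -
  let ?b = "norm (b - a)" and ?u = "norm (u - w)"
  have D: "\<bar>\<Delta>\<bar> > 0" using nondeg \<Delta>_def by simp
  have inv: "1 / s \<le> \<kappa>" if "1 / \<kappa> \<le> s" "s > 0" for s
    using that \<open>\<kappa> > 0\<close> by (simp add: field_simps)
  have c1: "\<bar>if p then 1 / (1 - \<nu>) else - 1 / \<nu>\<bar> \<le> \<kappa>" for p
    using inv[OF assms(1)] inv[OF assms(2)] lam by simp
  have c2: "\<bar>if p then 1 / (1 - \<mu>) else - 1 / \<mu>\<bar> \<le> \<kappa>" for p
    using inv[OF assms(3)] inv[OF assms(4)] mu by simp
  have "norm (grad i) \<le> \<kappa> * norm \<xi> + \<kappa> * norm \<upsilon>"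
    unfolding grad_def
    by (rule order_trans[OF norm_triangle_ineq4 add_mono])
       (simp_all only: norm_minus_cancel norm_scaleR, (intro mult_right_mono c1 c2 norm_ge_zero)+)
  also have "\<dots> = \<kappa> * ((?u + ?b) / \<bar>\<Delta>\<bar>)"
    unfolding \<xi>_def \<upsilon>_def by (simp add: norm_perp algebra_simps add_divide_distrib)
  finally have "norm (grad i) * norm (\<tau> *\<^sub>R (u - w)) \<le> \<kappa> * ((?u + ?b) / \<bar>\<Delta>\<bar>) * ?u"
  proof (rule mult_mono)
    show "norm (\<tau> *\<^sub>R (u - w)) \<le> ?u" using mult_right_mono[OF assms(7), of ?u] by simp
  qed (use assms(5) D in auto)
  also have "\<dots> = \<kappa> * ((?u * ?u + ?b * ?u) / \<bar>\<Delta>\<bar>)" by (simp add: algebra_simps add_divide_distrib)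
  also have "\<dots> \<le> \<kappa> * (2 * \<kappa>)"
  proof -
    have "0 \<le> (?b - ?u)\<^sup>2" by simp
    then have "?u * ?u + ?b * ?u \<le> 2 * (?b\<^sup>2 + ?u\<^sup>2)"
      unfolding power2_diff by (simp add: power2_eq_square algebra_simps add_increasing2)
         (smt (verit) zero_le_square)
    also have "\<dots> \<le> 2 * (\<kappa> * \<bar>\<Delta>\<bar>)" using assms(6) by simp
    finally have "(?u * ?u + ?b * ?u) / \<bar>\<Delta>\<bar> \<le> 2 * \<kappa>" using D by (simp add: pos_divide_le_eq)
    then show ?thesis using assms(5) by (intro mult_left_mono) auto
  qed
  finally show ?thesis by (simp add: power2_eq_square)
qed

text \<open>Exchanging \<open>u\<close> and \<open>w\<close> preserves the quadrilateral, so each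
  fact about the triangle on \<open>u\<close> yields one about the triangle on
  \<open>w\<close>.\<close>

lemma flip: "diamond a b w u \<nu> (1 - \<mu>)"
proof
  show "a + \<nu> *\<^sub>R (b - a) = u + (1 - \<mu>) *\<^sub>R (w - u)" using meet by (simp add: algebra_simps)
  have "cross2 (b - a) (w - u) = - cross2 (b - a) (u - w)" unfolding cross2_def by (simp add: algebra_simps)
  then show "cross2 (b - a) (w - u) \<noteq> 0" using nondeg by simp
qed (use lam mu in auto)

end

context diamond
begin

interpretation fl: diamond a b w u \<nu> "1 - \<mu>" by (rule flip)

lemma flip_eqs: "fl.\<Delta> = - \<Delta>" "fl.\<xi> = \<xi>" "fl.\<upsilon> = - \<upsilon>"
proof -
  show D: "fl.\<Delta> = - \<Delta>" unfolding fl.\<Delta>_def \<Delta>_def cross2_def by (simp add: algebra_simps)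
  have "perp (w - u) = - perp (u - w)" unfolding perp_def by (simp add: vec_eq_iff forall_2)
  then show "fl.\<xi> = \<xi>" unfolding fl.\<xi>_def \<xi>_def D by simp
  show "fl.\<upsilon> = - \<upsilon>" unfolding fl.\<upsilon>_def \<upsilon>_def D by simp
qed

lemma flip_grad: "fl.grad (s, t) = grad (s, \<not> t)" "fl.const (s, t) = const (s, \<not> t)"
proof -
  show 1: "fl.grad (s, t) = grad (s, \<not> t)" unfolding fl.grad_def grad_def flip_eqs by (cases t) simp_all
  show "fl.const (s, t) = const (s, \<not> t)" unfolding fl.const_def const_def flip_eqs 1 ..
qed

lemma flip_tent: "tent fl.grad fl.const z > 0 \<longleftrightarrow> tent grad const z > 0"
proof -
  have eq: "fl.grad i \<bullet> z + fl.const i = grad (fst i, \<not> snd i) \<bullet> z + const (fst i, \<not> snd i)" for i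
    using flip_grad[of "fst i" "snd i"] by simp
  have "(\<forall>i. 0 < grad (fst i, \<not> snd i) \<bullet> z + const (fst i, \<not> snd i)) \<longleftrightarrow>
        (\<forall>i. 0 < grad i \<bullet> z + const i)" (is "(\<forall>i. ?P (fst i, \<not> snd i)) \<longleftrightarrow> _")
  proof (intro iffI allI)
    fix j assume "\<forall>i. ?P (fst i, \<not> snd i)"
    from this[rule_format, of "(fst j, \<not> snd j)"] show "?P j" by simp
  qed blast
  then show ?thesis unfolding tent_pos_iff eq .
qed

lemma support:
  assumes "tent grad const z > 0"
  shows "z \<in> convex hull {a, b, u} \<union> convex hull {a, b, w}"
proof (cases "\<upsilon> \<bullet> (z - c) \<ge> 0")
  case True
  then show ?thesis using in_upper_triangle[OF assms] by simp
next
  case False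
  then have "fl.\<upsilon> \<bullet> (z - c) \<ge> 0" unfolding flip_eqs by simp
  moreover have "tent fl.grad fl.const z > 0" using assms flip_tent by simp
  ultimately have "z \<in> convex hull {a, b, w}" by (intro fl.in_upper_triangle)
  then show ?thesis by simp
qed

lemma lower_min:
  assumes z: "z \<in> interior (convex hull {a, b, w})" and "\<xi> \<bullet> (z - c) \<noteq> 0"
  obtains i where "grad i \<bullet> z + const i > 0" "\<not> snd i"
    "\<And>j. j \<noteq> i \<Longrightarrow> grad i \<bullet> z + const i < grad j \<bullet> z + const j"
proof -
  have "fl.\<xi> \<bullet> (z - c) \<noteq> 0" using assms(2) unfolding flip_eqs .
  then obtain i where i: "fl.grad i \<bullet> z + fl.const i > 0" "snd i"
    "\<And>j. j \<noteq> i \<Longrightarrow> fl.grad i \<bullet> z + fl.const i < fl.grad j \<bullet> z + fl.const j"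
    using fl.upper_min[OF z] by metis
  obtain s where s: "i = (s, True)" using i(2) by (cases i) auto
  show thesis
  proof (rule that[of "(s, False)"])
    show "grad (s, False) \<bullet> z + const (s, False) > 0" using i(1) unfolding s flip_grad by simp
    fix j :: "bool \<times> bool" assume j: "j \<noteq> (s, False)"
    have "(fst j, \<not> snd j) \<noteq> i" using j s by (cases j) auto
    then show "grad (s, False) \<bullet> z + const (s, False) < grad j \<bullet> z + const j"
      using i(3)[of "(fst j, \<not> snd j)"] unfolding s flip_grad by simp
  qed simp
qed

lemma interior_lower_tent_pos:
  assumes "z \<in> interior (convex hull {a, b, w})" and "\<xi> \<bullet> (z - c) \<noteq> 0"
  shows "tent grad const z > 0"
proof -
  have "fl.\<xi> \<bullet> (z - c) \<noteq> 0" using assms(2) unfolding flip_eqs .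
  then have "tent fl.grad fl.const z > 0" by (rule fl.interior_upper_tent_pos[OF assms(1)])
  then show ?thesis using flip_tent by simp
qed

lemma area_lower: "measure lebesgue (convex hull {a, b, w}) = \<mu> * \<bar>\<Delta>\<bar> / 2"
  using fl.area_upper unfolding flip_eqs by simp

end

section \<open>Exchanging mass along a tree of triangles\<close>

text \<open>The triangles form a tree; \<open>col\<close> splits its edges into matchings, so that the moves of the
  diamonds belonging to the edges of one colour have disjoint supports.\<close>

locale triangle_tree =
  fixes B :: "(real^2) set" and V :: "'v set" and tri :: "'v \<Rightarrow> (real^2) set" and root :: 'v
    and par :: "'v \<Rightarrow> 'v" and col :: "'v \<Rightarrow> nat" and ea eb eu ew :: "'v \<Rightarrow> real^2"
    and lam mu :: "'v \<Rightarrow> real" and \<kappa> :: real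
  assumes convex_B: "convex B"
    and countable_V: "countable V"
    and root: "root \<in> V"
    and poly: "v \<in> V \<Longrightarrow> polytope (tri v)"
    and interior_ne: "v \<in> V \<Longrightarrow> interior (tri v) \<noteq> {}"
    and interior_disj: "v \<in> V \<Longrightarrow> v' \<in> V \<Longrightarrow> v \<noteq> v' \<Longrightarrow> interior (tri v) \<inter> interior (tri v') = {}"
    and cover: "(\<Union>v\<in>V. tri v) = interior B"
    and locfin: "locally_finite_in (top_of_set (interior B)) (tri ` V)"
    and par: "v \<in> V - {root} \<Longrightarrow> par v \<in> V"
    and dia: "v \<in> V - {root} \<Longrightarrow> diamond (ea v) (eb v) (eu v) (ew v) (lam v) (mu v)"
    and child: "v \<in> V - {root} \<Longrightarrow> tri v = convex hull {ea v, eb v, eu v}"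
    and parent: "v \<in> V - {root} \<Longrightarrow> tri (par v) = convex hull {ea v, eb v, ew v}"
    and not_par: "v \<in> V - {root} \<Longrightarrow> v' \<in> V - {root} \<Longrightarrow> col v = col v' \<Longrightarrow> v \<noteq> par v'"
    and par_inj: "v \<in> V - {root} \<Longrightarrow> v' \<in> V - {root} \<Longrightarrow> col v = col v' \<Longrightarrow> par v = par v' \<Longrightarrow> v = v'"
    and kappa: "\<kappa> > 0" "v \<in> V - {root} \<Longrightarrow> 1 / \<kappa> \<le> lam v" "v \<in> V - {root} \<Longrightarrow> 1 / \<kappa> \<le> 1 - lam v"
      "v \<in> V - {root} \<Longrightarrow> 1 / \<kappa> \<le> mu v" "v \<in> V - {root} \<Longrightarrow> 1 / \<kappa> \<le> 1 - mu v"
      "v \<in> V - {root} \<Longrightarrow> (norm (eb v - ea v))\<^sup>2 + (norm (eu v - ew v))\<^sup>2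
         \<le> \<kappa> * \<bar>cross2 (eb v - ea v) (eu v - ew v)\<bar>"
begin

definition area :: "'v \<Rightarrow> real" where "area v = measure lebesgue (tri v)"

text \<open>The value 1 off the open triangles makes the density of the constant family 1 the
  constant function 1 everywhere, and it keeps the density of a positive family positive.\<close>

definition dens :: "('v \<Rightarrow> real) \<Rightarrow> real^2 \<Rightarrow> real" where
  "dens d z = (if \<exists>v\<in>V. z \<in> interior (tri v) then d (THE v. v \<in> V \<and> z \<in> interior (tri v)) else 1)"

lemma dens_eq:
  assumes "v \<in> V" "z \<in> interior (tri v)"
  shows "dens d z = d v"
proof -
  have "(THE v. v \<in> V \<and> z \<in> interior (tri v)) = v"
    by (rule the_equality) (use assms interior_disj in blast)+
  then show ?thesis unfolding dens_def using assms by auto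
qed

lemma dens_pos: "(\<And>v. v \<in> V \<Longrightarrow> d v > 0) \<Longrightarrow> dens d z > 0"
  by (cases "\<exists>v\<in>V. z \<in> interior (tri v)") (auto simp: dens_eq, auto simp: dens_def)

lemma convex_tri: "v \<in> V \<Longrightarrow> convex (tri v)" and closed_tri: "v \<in> V \<Longrightarrow> closed (tri v)"
  using poly polytope_imp_convex polytope_imp_closed by auto

lemma negligible_inter:
  assumes "v \<in> V" "v' \<in> V" "v \<noteq> v'"
  shows "negligible (tri v \<inter> tri v')"
proof -
  have "tri v \<inter> tri v' \<subseteq> frontier (tri v) \<union> frontier (tri v')"
    using interior_disj[OF assms] closed_tri assms unfolding frontier_def by auto
  moreover have "negligible (frontier (tri v) \<union> frontier (tri v'))"
    by (simp add: negligible_convex_frontier convex_tri assms)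
  ultimately show ?thesis using negligible_subset by blast
qed

lemma negligible_skeleton: "negligible (B - (\<Union>v\<in>V. interior (tri v)))"
proof -
  have "B - (\<Union>v\<in>V. interior (tri v)) \<subseteq> frontier B \<union> (\<Union>v\<in>V. frontier (tri v))"
  proof
    fix z assume z: "z \<in> B - (\<Union>v\<in>V. interior (tri v))"
    show "z \<in> frontier B \<union> (\<Union>v\<in>V. frontier (tri v))"
    proof (cases "z \<in> interior B")
      case True
      then obtain v where "v \<in> V" "z \<in> tri v" using cover by blast
      then show ?thesis using z closure_subset[of "tri v"] unfolding frontier_def by blast
    next
      case False
      then show ?thesis using z closure_subset[of B] unfolding frontier_def by blast
    qed
  qed
  moreover have "negligible (\<Union>v\<in>V. frontier (tri v))"
    by (rule negligible_countable_Union)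
       (use countable_V negligible_convex_frontier convex_tri in auto)
  ultimately show ?thesis
    using negligible_convex_frontier[OF convex_B] negligible_Un negligible_subset by blast
qed

abbreviation edges :: "nat \<Rightarrow> 'v set" where "edges k \<equiv> {v \<in> V - {root}. col v = k}"

abbreviation "grad v \<equiv> diamond.grad (ea v) (eb v) (eu v) (ew v) (lam v) (mu v)"
abbreviation "const v \<equiv> diamond.const (ea v) (eb v) (eu v) (ew v) (lam v) (mu v)"
abbreviation "tnt v \<equiv> tent (grad v) (const v)"
abbreviation "xi v \<equiv> diamond.\<xi> (ea v) (eb v) (eu v) (ew v)"
abbreviation "ctr v \<equiv> diamond.c (ea v) (eb v) (lam v)"

lemma tnt_support: "v \<in> V - {root} \<Longrightarrow> tnt v z > 0 \<Longrightarrow> z \<in> tri v \<union> tri (par v)"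
  using diamond.support[OF dia] child parent by simp

lemma open_tnt_pos: "open {z. tnt v z > 0}"
proof -
  have "{z. tnt v z > 0} = (\<Inter>i. {z. grad v i \<bullet> z + const v i > 0})"
    unfolding tent_pos_iff by auto
  also have "open \<dots>" by (intro open_INT ballI open_Collect_less continuous_intros) auto
  finally show ?thesis .
qed

text \<open>The tent is positive on an open set, and each point of a triangle is a limit of interior
  points. A third triangle touching this set would share a nonempty open set with the child or the
  parent, while distinct triangles meet in null sets.\<close>

lemma tnt_tri:
  assumes q: "q \<in> V - {root}" "tnt q z > 0" and v: "v \<in> V" "z \<in> tri v"
  shows "v = q \<or> v = par q"
proof (rule ccontr)
  assume ne: "\<not> ?thesis"
  let ?U = "{z. tnt q z > 0} \<inter> interior (tri v)"
  have "z \<in> closure (interior (tri v))"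
    using v convex_closure_interior[OF convex_tri interior_ne] closure_subset by blast
  then have "?U \<noteq> {}"
    using open_Int_closure_eq_empty[OF open_tnt_pos[of q], of "interior (tri v)"] q(2) by blast
  moreover have "open ?U" using open_tnt_pos by blast
  moreover have "?U \<subseteq> (tri v \<inter> tri q) \<union> (tri v \<inter> tri (par q))"
    using tnt_support[OF q(1)] interior_subset by blast
  moreover have "negligible ((tri v \<inter> tri q) \<union> (tri v \<inter> tri (par q)))"
    using negligible_inter v(1) q(1) par[OF q(1)] ne by (intro negligible_Un) auto
  ultimately show False using open_not_negligible negligible_subset by blast
qed

text \<open>A point common to two supports would make two edges of one colour share a
  triangle.\<close>

lemma tnt_disjoint:
  assumes "q \<in> edges k" "q' \<in> edges k" "tnt q z > 0" "tnt q' z > 0"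
  shows "q = q'"
proof -
  have "z \<in> tri q \<or> z \<in> tri (par q)" using tnt_support[of q z] assms by auto
  then show ?thesis
  proof
    assume "z \<in> tri q"
    then have "q = q' \<or> q = par q'" using tnt_tri[of q' z q] assms by auto
    then show ?thesis using not_par[of q q'] assms by auto
  next
    assume "z \<in> tri (par q)"
    then have "par q = q' \<or> par q = par q'" using tnt_tri[of q' z "par q"] assms par[of q] by auto
    then show ?thesis using not_par[of q' q] par_inj[of q q'] assms by auto
  qed
qed

lemma area_pos: "v \<in> V \<Longrightarrow> area v > 0"
proof -
  assume v: "v \<in> V"
  have "\<not> negligible (tri v)"
    using negligible_convex_interior[OF convex_tri[OF v]] interior_ne[OF v] by simp
  moreover have "tri v \<in> lmeasurable" using poly[OF v] polytope_imp_compact lmeasurable_compact by blast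
  ultimately show ?thesis
    unfolding area_def by (metis measure_nonneg less_eq_real_def negligible_iff_measure0)
qed

text \<open>Both triangles have the base from \<open>ea q\<close> to \<open>eb q\<close>, so their
  areas are proportional to the two parts of the other diagonal.\<close>

lemma area_ratio:
  assumes "q \<in> V - {root}"
  shows "area q = (1 - mu q) * (area q + area (par q))" "area (par q) = mu q * (area q + area (par q))"
proof -
  obtain X where X: "area q = (1 - mu q) * X / 2" "area (par q) = mu q * X / 2"
    unfolding area_def child[OF assms] parent[OF assms]
      diamond.area_upper[OF dia[OF assms]] diamond.area_lower[OF dia[OF assms]] by blast
  have s: "area q + area (par q) = X / 2" unfolding X by (simp add: field_simps)
  show "area q = (1 - mu q) * (area q + area (par q))" "area (par q) = mu q * (area q + area (par q))"
    unfolding s by (simp_all add: X)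
qed

text \<open>Moving the centre of each diamond makes the two densities on it equal.\<close>

lemma density_equiv_average:
  assumes "C > 0"
    and d: "\<And>v. v \<in> V \<Longrightarrow> 1 / C \<le> d v \<and> d v \<le> C"
    and e_edge: "\<And>q. q \<in> edges k \<Longrightarrow> e (par q) = e q"
      "\<And>q. q \<in> edges k \<Longrightarrow> e q * (area q + area (par q)) = d q * area q + d (par q) * area (par q)"
    and e_other: "\<And>v. v \<in> V \<Longrightarrow> v \<notin> edges k \<Longrightarrow> v \<notin> par ` edges k \<Longrightarrow> e v = d v"
  shows "density_equiv (1 + 4 * \<kappa>\<^sup>2 * C\<^sup>2) B (dens d) (dens e)"
proof -
  \<comment> \<open>Chosen so that the Jacobian on the child,
    \<open>1 - \<tau> q / (1 - mu q)\<close>, is \<open>d q / e q\<close>. Conservation of mass then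
    gives the required \<open>d (par q) / e q\<close> on the parent.\<close>
  define \<tau> where "\<tau> q = (1 - mu q) * (1 - d q / e q)" for q
  define w where "w q = \<tau> q *\<^sub>R (eu q - ew q)" for q
  have inE: "q \<in> V - {root}" if "q \<in> edges k" for q using that by simp
  have mu: "0 < mu q" "mu q < 1" "0 < 1 - mu q" if "q \<in> edges k" for q
    using diamond.mu[OF dia[OF inE[OF that]]] by auto
  \<comment> \<open>In terms of \<open>mu\<close> the area-weighted mean is a convex combination,
    hence it obeys the bounds on \<open>d\<close>.\<close>
  have e_conv: "e q = (1 - mu q) * d q + mu q * d (par q)" if q: "q \<in> edges k" for q
  proof -
    have s: "area q + area (par q) > 0" using area_pos par inE[OF q] by (simp add: add_pos_pos)
    have "e q * (area q + area (par q)) = ((1 - mu q) * d q + mu q * d (par q)) * (area q + area (par q))"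
      unfolding e_edge(2)[OF q]
      by (subst area_ratio(1)[OF inE[OF q]], subst (2) area_ratio(2)[OF inE[OF q]]) (simp add: algebra_simps)
    then show ?thesis using s by simp
  qed
  have dpos: "d v > 0" if "v \<in> V" for v
    using d[OF that] \<open>C > 0\<close> by (meson divide_pos_pos less_le_trans zero_less_one)
  have eb: "1 / C \<le> e q \<and> e q \<le> C" if q: "q \<in> edges k" for q
  proof -
    have m: "0 \<le> mu q" "0 \<le> 1 - mu q" using mu[OF q] by auto
    have dq: "1 / C \<le> d q" "d q \<le> C" "1 / C \<le> d (par q)" "d (par q) \<le> C"
      using d[of q] d[of "par q"] par inE[OF q] by auto
    have "1 / C = (1 - mu q) * (1 / C) + mu q * (1 / C)" by (simp add: algebra_simps)
    also have "\<dots> \<le> e q" unfolding e_conv[OF q] using dq m by (intro add_mono mult_left_mono)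
    finally have 1: "1 / C \<le> e q" .
    have "e q \<le> (1 - mu q) * C + mu q * C" unfolding e_conv[OF q] using dq m by (intro add_mono mult_left_mono)
    then show ?thesis using 1 by (simp add: algebra_simps)
  qed
  have epos: "e q > 0" if "q \<in> edges k" for q
    using eb[OF that] \<open>C > 0\<close> by (meson divide_pos_pos less_le_trans zero_less_one)
  have jup: "1 - \<tau> q / (1 - mu q) = d q / e q" if q: "q \<in> edges k" for q
    unfolding \<tau>_def using mu[OF q] by simp
  have jdn: "1 + \<tau> q / mu q = d (par q) / e q" if q: "q \<in> edges k" for q
  proof -
    have "(1 - mu q) * (1 - d q / e q) / mu q = (1 - mu q) * (e q - d q) / (mu q * e q)"
      using epos[OF q] mu[OF q] by (simp add: field_simps)
    also have "(1 - mu q) * (e q - d q) = mu q * (d (par q) - e q)"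
      using e_conv[OF q] by (simp add: algebra_simps)
    also have "mu q * (d (par q) - e q) / (mu q * e q) = d (par q) / e q - 1"
      using mu[OF q] epos[OF q] by (simp add: diff_divide_distrib)
    finally show ?thesis unfolding \<tau>_def by simp
  qed
  have jac: "1 + grad q i \<bullet> w q = (if snd i then d q else d (par q)) / e q" if q: "q \<in> edges k" for q i
    unfolding w_def diamond.grad_shift[OF dia[OF inE[OF q]]] using jup[OF q] jdn[OF q] by simp
  have tau: "\<bar>\<tau> q\<bar> \<le> 1" if q: "q \<in> edges k" for q
  proof -
    have "1 - \<tau> q / (1 - mu q) > 0" "1 + \<tau> q / mu q > 0"
      unfolding jup[OF q] jdn[OF q] using dpos[of q] dpos[of "par q"] epos[OF q] par inE[OF q] by auto
    then have "\<tau> q < 1 - mu q" "- \<tau> q < mu q"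
      using mu[OF q] by (simp_all add: field_simps)
    then show ?thesis using mu[OF q] by auto
  qed
  \<comment> \<open>A quotient of two numbers in \<open>[1/C, C]\<close>; it provides the lower
    bound \<open>\<eta>\<close> on the Jacobians.\<close>
  have low: "1 / C\<^sup>2 \<le> 1 + grad q i \<bullet> w q" if q: "q \<in> edges k" for q i
  proof -
    have "1 / C\<^sup>2 = (1 / C) / C" by (simp add: power2_eq_square)
    also have "\<dots> \<le> (if snd i then d q else d (par q)) / e q"
    proof (rule frac_le)
      show "1 / C \<le> (if snd i then d q else d (par q))" using d[of q] d[of "par q"] par inE[OF q] by simp
      show "0 \<le> (if snd i then d q else d (par q))" using dpos[of q] dpos[of "par q"] par inE[OF q] by simp
    qed (use eb[OF q] epos[OF q] in auto)
    finally show ?thesis unfolding jac[OF q] .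
  qed
  interpret star_moves "edges k" grad const w
  proof
    show "q = q'" if "q \<in> edges k" "q' \<in> edges k" "tnt q z > 0" "tnt q' z > 0" for q q' z
      using tnt_disjoint[OF that] .
    show "1 + grad q i \<bullet> w q > 0" if q: "q \<in> edges k" for q i
      using low[OF q, of i] \<open>C > 0\<close> by (meson divide_pos_pos less_le_trans zero_less_one zero_less_power)
  qed
  have C1: "1 / C\<^sup>2 \<le> 1"
  proof -
    have "1 / C \<le> C" using d[OF root] by linarith
    then have "1 \<le> C * C" using \<open>C > 0\<close> by (simp add: field_simps)
    then show ?thesis using \<open>C > 0\<close> by (simp add: power2_eq_square divide_le_eq)
  qed
  have Kb: "norm (grad q i) * norm (w q) \<le> 2 * \<kappa>\<^sup>2" if q: "q \<in> edges k" for q i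
    unfolding w_def
    using diamond.norm_grad_le[OF dia[OF inE[OF q]], of \<kappa> "\<tau> q" i] kappa inE[OF q] tau[OF q]
    unfolding diamond.\<Delta>_def[OF dia[OF inE[OF q]]] by blast
  have "density_equiv (1 + 2 * (2 * \<kappa>\<^sup>2) / (1 / C\<^sup>2)) B (dens d) (dens e)"
  proof (rule density_equiv_move[where \<P> = "tri ` V"])
    show "z \<in> interior B" if "q \<in> edges k" "tnt q z > 0" for q z
      using tnt_support[of q z] that par[of q] cover by blast
    show "\<exists>q. \<forall>p\<in>edges k. p \<noteq> q \<longrightarrow> (\<forall>z\<in>P. tnt p z = 0)" if P: "P \<in> tri ` V" for P
    proof -
      obtain v where v: "v \<in> V" "P = tri v" using P by blast
      have uniq: "p = q" if "p \<in> edges k" "q \<in> edges k" "z \<in> P" "z' \<in> P" "tnt p z > 0" "tnt q z' > 0" for p q z z'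
      proof -
        have "v = p \<or> v = par p" "v = q \<or> v = par q"
          using tnt_tri[of p z v] tnt_tri[of q z' v] that v by auto
        then show ?thesis using not_par[of p q] not_par[of q p] par_inj[of p q] that by auto
      qed
      show ?thesis
      proof (cases "\<exists>q\<in>edges k. \<exists>z\<in>P. tnt q z > 0")
        case True
        then obtain q z where q: "q \<in> edges k" "z \<in> P" "tnt q z > 0" by blast
        have "tnt p z' = 0" if "p \<in> edges k" "p \<noteq> q" "z' \<in> P" for p z'
          using uniq[of p q z' z] that q tent_nonneg[of "grad p" "const p" z'] by force
        then show ?thesis by blast
      next
        case False
        then have "tnt p z' = 0" if "p \<in> edges k" "z' \<in> P" for p z'
          using that tent_nonneg[of "grad p" "const p" z'] by force
        then show ?thesis by blast
      qed
    qed
    show "negligible {z \<in> B. \<not> has_jacobian_at move (dens d z / dens e (move z)) z}"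
    proof -
      interpret inv: star_moves "edges k" inv_g inv_h "\<lambda>q. - w q" by (rule star_moves_inv)
      define N where "N = B - (\<Union>v\<in>V. interior (tri v))"
      \<comment> \<open>The lines on which two affine functions of a tent tie, so that no single one
        is strictly smallest.\<close>
      define H where "H = (\<Union>q\<in>edges k. {z. xi q \<bullet> (z - ctr q) = 0})"
      have N: "negligible N" unfolding N_def by (rule negligible_skeleton)
      have negH: "negligible H"
        unfolding H_def
      proof (rule negligible_countable_Union)
        show "countable ((\<lambda>q. {z. xi q \<bullet> (z - ctr q) = 0}) ` edges k)"
          using countable_V countable_subset[of "edges k" V] by auto
        fix S assume "S \<in> (\<lambda>q. {z. xi q \<bullet> (z - ctr q) = 0}) ` edges k"
        then obtain q where q: "q \<in> edges k" "S = {z. xi q \<bullet> (z - ctr q) = 0}" by blast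
        have "xi q \<noteq> 0" using diamond.dual_basis(1)[OF dia[OF inE[OF q(1)]]] by auto
        then show "negligible S"
          using negligible_hyperplane[of "xi q" "xi q \<bullet> ctr q"] unfolding q(2) by (simp add: inner_diff_right)
      qed
      \<comment> \<open>Points that are moved onto the skeleton are excluded too, since there
        \<open>dens e\<close> does not take its value from a triangle.\<close>
      have "negligible (inv.move ` N)"
      proof (rule negligible_locally_Lipschitz_image)
        define K' where "K' = 2 * \<kappa>\<^sup>2 / (1 / C\<^sup>2)"
        have K': "norm (inv_g q i) * norm (- w q) \<le> K'" if q: "q \<in> edges k" for q i
        proof -
          have "norm (inv_g q i) * norm (- w q) = norm (grad q i) * norm (w q) / (1 + grad q i \<bullet> w q)"
            using pos[OF q, of i] by (simp add: divide_inverse mult_ac)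
          also have "\<dots> \<le> K'" unfolding K'_def
            using Kb[OF q, of i] low[OF q, of i] \<open>C > 0\<close> by (intro frac_le) auto
          finally show ?thesis .
        qed
        have "K' \<ge> 0" unfolding K'_def by simp
        fix x
        have "\<forall>y\<in>N \<inter> UNIV. norm (inv.move y - inv.move x) \<le> (1 + 2 * K') * norm (y - x)"
          using inv.move_lipschitz[OF K' \<open>K' \<ge> 0\<close>] by (auto simp: dist_norm)
        then show "\<exists>T C. open T \<and> x \<in> T \<and> (\<forall>y\<in>N \<inter> T. norm (inv.move y - inv.move x) \<le> C * norm (y - x))"
          by blast
      qed (use N in auto)
      then have "negligible (N \<union> H \<union> inv.move ` N)" using N negH by simp
      moreover have "has_jacobian_at move (dens d z / dens e (move z)) z"
        if z: "z \<in> B" "z \<notin> N \<union> H \<union> inv.move ` N" for z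
      proof -
        have mvB: "move z \<in> B"
        proof (rule move_preserves[OF _ z(1)])
          show "z \<in> B" if "q \<in> edges k" "tnt q z > 0" for q z
            using tnt_support[of q z] that par[of q] cover interior_subset[of B] by blast
        qed
        have "move z \<notin> N"
        proof
          assume "move z \<in> N"
          then have "inv.move (move z) \<in> inv.move ` N" by (rule imageI)
          then show False using z(2) inv_move_move[of z] by simp
        qed
        then obtain v' where v': "v' \<in> V" "move z \<in> interior (tri v')" using mvB unfolding N_def by blast
        obtain v where v: "v \<in> V" "z \<in> interior (tri v)" using z unfolding N_def by blast
        have dz: "dens d z = d v" using dens_eq[OF v] .
        have ez: "dens e (move z) = e v'" using dens_eq[OF v'] .
        \<comment> \<open>The moved point stays in the support of the same tent, hence in one of its
          two triangles. It may change sides, but \<open>e\<close> agrees on both.\<close>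
        have pair: "e v' = e q" if q: "q \<in> edges k" "tnt q z > 0" for q
        proof -
          have "tent (inv_g q) (inv_h q) (move z) > 0"
            using tent_scaled_moved[OF pos q(2)] q move_eq[OF q] by simp
          then have "tnt q (move z) > 0" using inv_tent_pos_iff[OF q(1)] by blast
          then have "v' = q \<or> v' = par q"
            using tnt_tri[of q "move z" v'] q v' interior_subset[of "tri v'"] by blast
          then show ?thesis using e_edge(1)[OF q(1)] by auto
        qed
        consider "v \<in> edges k" | q where "q \<in> edges k" "v = par q" | "v \<notin> edges k" "v \<notin> par ` edges k"
          by blast
        then show ?thesis
        proof cases
          case 1
          note D = dia[OF inE[OF 1]]
          have zi: "z \<in> interior (convex hull {ea v, eb v, eu v})" using v child[OF inE[OF 1]] by simp
          have x: "xi v \<bullet> (z - ctr v) \<noteq> 0" using z(2) 1 unfolding H_def by blast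
          obtain i where i: "grad v i \<bullet> z + const v i > 0" "snd i"
             "\<And>j. j \<noteq> i \<Longrightarrow> grad v i \<bullet> z + const v i < grad v j \<bullet> z + const v j"
            using diamond.upper_min[OF D zi x] by metis
          have "has_jacobian_at move (1 + grad v i \<bullet> w v) z"
            by (rule has_jacobian_at_move[OF 1 i(1,3)])
          moreover have "tnt v z > 0" by (rule diamond.interior_upper_tent_pos[OF D zi x])
          ultimately show ?thesis unfolding dz ez pair[OF 1 \<open>tnt v z > 0\<close>] using jac[OF 1, of i] i(2) by simp
        next
          case 2
          note D = dia[OF inE[OF 2(1)]]
          have zi: "z \<in> interior (convex hull {ea q, eb q, ew q})" using v parent[OF inE[OF 2(1)]] 2 by simp
          have x: "xi q \<bullet> (z - ctr q) \<noteq> 0" using z(2) 2 unfolding H_def by blast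
          obtain i where i: "grad q i \<bullet> z + const q i > 0" "\<not> snd i"
             "\<And>j. j \<noteq> i \<Longrightarrow> grad q i \<bullet> z + const q i < grad q j \<bullet> z + const q j"
            using diamond.lower_min[OF D zi x] by metis
          have "has_jacobian_at move (1 + grad q i \<bullet> w q) z"
            by (rule has_jacobian_at_move[OF 2(1) i(1,3)])
          moreover have "tnt q z > 0" by (rule diamond.interior_lower_tent_pos[OF D zi x])
          ultimately show ?thesis
            unfolding dz ez pair[OF 2(1) \<open>tnt q z > 0\<close>] using jac[OF 2(1), of i] i(2) 2 by simp
        next
          case 3
          have 0: "tnt q y = 0" if "y \<in> interior (tri v)" "q \<in> edges k" for y q
            using tnt_tri[of q y v] that v(1) 3 interior_subset[of "tri v"]
              tent_nonneg[of "grad q" "const q" y] by force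
          have "has_jacobian_at move 1 z"
            by (rule has_jacobian_at_move_id[OF open_interior v(2)]) (rule 0)
          moreover have "move z = z" using move_id 0 v(2) by blast
          then have "v' = v" using interior_disj[OF v(1) v'(1)] v v' by auto
          moreover have "e v = d v" using e_other v(1) 3 by blast
          ultimately show ?thesis unfolding dz ez using dpos[OF v(1)] by simp
        qed
      qed
      then have "{z \<in> B. \<not> has_jacobian_at move (dens d z / dens e (move z)) z} \<subseteq> N \<union> H \<union> inv.move ` N"
        by blast
      ultimately show ?thesis by (rule negligible_subset)
    qed
  qed (use Kb low C1 \<open>C > 0\<close> locfin cover poly in auto)
  then show ?thesis by simp
qed

end

context triangle_tree
begin

text \<open>Both families have the same average on each edge of colour \<open>k\<close>. The first
  is averaged and the averaging of the second is undone, which accounts for the square.\<close>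

lemma density_equiv_exchange:
  assumes "C > 0"
    and d: "\<And>v. v \<in> V \<Longrightarrow> 1 / C \<le> d v \<and> d v \<le> C"
    and d': "\<And>v. v \<in> V \<Longrightarrow> 1 / C \<le> d' v \<and> d' v \<le> C"
    and edge: "\<And>q. q \<in> edges k \<Longrightarrow>
      d q * area q + d (par q) * area (par q) = d' q * area q + d' (par q) * area (par q)"
    and other: "\<And>v. v \<in> V \<Longrightarrow> v \<notin> edges k \<Longrightarrow> v \<notin> par ` edges k \<Longrightarrow> d' v = d v"
  shows "density_equiv ((1 + 4 * \<kappa>\<^sup>2 * C\<^sup>2)\<^sup>2) B (dens d) (dens d')"
proof -
  let ?L = "1 + 4 * \<kappa>\<^sup>2 * C\<^sup>2"
  define avg where "avg q = (d q * area q + d (par q) * area (par q)) / (area q + area (par q))" for q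
  \<comment> \<open>A parent has a unique child along colour \<open>k\<close>, which the choice
    recovers, so both ends of the edge receive the same average.\<close>
  define e where "e v = (if v \<in> edges k then avg v
    else if v \<in> par ` edges k then avg (SOME q. q \<in> edges k \<and> par q = v) else d v)" for v
  have e1: "e q = avg q" if "q \<in> edges k" for q using that unfolding e_def by simp
  have e2: "e (par q) = avg q" if q: "q \<in> edges k" for q
  proof -
    have "(SOME q'. q' \<in> edges k \<and> par q' = par q) = q"
      by (rule some_equality) (use q par_inj in auto)
    moreover have "par q \<notin> edges k" using q not_par[of "par q" q] by auto
    moreover have "par q \<in> par ` edges k" using q by (rule imageI)
    ultimately show ?thesis unfolding e_def by (simp only: if_True if_False)
  qed
  have e3: "e v = d v" if "v \<notin> edges k" "v \<notin> par ` edges k" for v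
    using that unfolding e_def by (simp only: if_False)
  have s: "area q + area (par q) > 0" if "q \<in> edges k" for q
    using that area_pos par by (simp add: add_pos_pos)
  have ee: "e (par q) = e q" "e q * (area q + area (par q)) = d q * area q + d (par q) * area (par q)"
    if "q \<in> edges k" for q
    using e1[OF that] e2[OF that] s[OF that] unfolding avg_def by simp_all
  have 1: "density_equiv ?L B (dens d) (dens e)"
    using \<open>C > 0\<close> d ee e3 by (rule density_equiv_average)
  have 2: "density_equiv ?L B (dens d') (dens e)"
  proof (rule density_equiv_average[where k = k and e = e, OF \<open>C > 0\<close> d' ee(1)])
    show "e q * (area q + area (par q)) = d' q * area q + d' (par q) * area (par q)" if "q \<in> edges k" for q
      using ee(2)[OF that] edge[OF that] by simp
    show "e v = d' v" if "v \<in> V" "v \<notin> edges k" "v \<notin> par ` edges k" for v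
      using e3 other that by simp
  qed
  have pos: "d v > 0" "d' v > 0" if "v \<in> V" for v
    using d[OF that] d'[OF that] \<open>C > 0\<close> by (meson divide_pos_pos less_le_trans zero_less_one)+
  have avg_pos: "avg q > 0" if "q \<in> edges k" for q
  proof -
    have "d q * area q > 0" "d (par q) * area (par q) > 0"
      using pos area_pos par that by (auto intro!: mult_pos_pos)
    then show ?thesis unfolding avg_def using s[OF that] by simp
  qed
  have "e v > 0" if "v \<in> V" for v
    using e1[of v] e2 e3[of v] avg_pos pos(1)[OF that] by (cases "v \<in> edges k"; cases "v \<in> par ` edges k") auto
  then have pe: "dens e z > 0" for z by (rule dens_pos)
  have pd: "dens d' z > 0" for z using pos(2) by (rule dens_pos)
  have L: "?L > 0" by (simp add: add_pos_nonneg)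
  have "density_equiv ?L B (dens e) (dens d')"
    by (rule density_equiv_sym[OF 2 L convex_B pd pe])
  then have "density_equiv (?L * ?L) B (dens d) (dens d')"
    by (rule density_equiv_trans[OF 1 _ L L pe])
  then show ?thesis by (simp add: power2_eq_square)
qed

lemma density_equiv_refl:
  assumes "\<And>v. v \<in> V \<Longrightarrow> d v > 0"
  shows "density_equiv 1 B (dens d) (dens d)"
proof -
  have "has_jacobian_at (\<lambda>z. z) 1 (z :: real^2)" for z
    unfolding has_jacobian_at_def using det_rank_one_update[of 0 0] has_derivative_ident
    by (intro exI[of _ "\<lambda>v. v"]) simp
  moreover have "dens d z \<noteq> 0" for z using dens_pos[of d z] assms by fastforce
  ultimately have "negligible {z \<in> B. \<not> has_jacobian_at (\<lambda>z. z) (dens d z / dens d z) z}" by simp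
  moreover have "polytopewise_affine_on (interior B) (\<lambda>z. z)"
    unfolding polytopewise_affine_on_def
  proof (intro exI conjI)
    show "\<forall>P\<in>tri ` V. polytope P \<and> affine_map_on P (\<lambda>z. z)"
      using poly unfolding affine_map_on_def
      by (auto intro!: exI[of _ "\<lambda>z. z"] exI[of _ 0] simp: linear_ident)
  qed (use cover locfin in auto)
  ultimately show ?thesis unfolding density_equiv_def bilipschitz_on_def
    by (intro exI[of _ "\<lambda>z. z"]) auto
qed

definition children :: "'v \<Rightarrow> 'v set" where "children v = {x \<in> V - {root}. par x = v}"

text \<open>\<open>X v\<close> is the mass that \<open>v\<close> passes to its parent. Each of
  \<open>N\<close> rounds sends \<open>X v / N\<close> along every edge, colour by colour. Full
  rounds interpolate linearly between \<open>d\<close> and 1; within a round a density deviates from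
  this by at most \<open>M / N \<le> 1 / (2 * C)\<close>, which keeps it in
  \<open>[1 / (2 * C), 2 * C]\<close>.\<close>

lemma density_equiv_rounds:
  assumes "C > 0" "M \<ge> 0" and N: "real N \<ge> 2 * M * C" "N > 0"
    and d: "\<And>v. v \<in> V \<Longrightarrow> 1 / C \<le> d v \<and> d v \<le> C"
    and fin: "\<And>v. v \<in> V \<Longrightarrow> finite (children v)"
    and col: "\<And>v. v \<in> V - {root} \<Longrightarrow> col v < K"
    and balance: "\<And>v. v \<in> V \<Longrightarrow> (d v - 1) * area v + (\<Sum>x\<in>children v. X x) = (if v = root then 0 else X v)"
    and bound: "\<And>v. v \<in> V \<Longrightarrow> (\<Sum>x\<in>children v. \<bar>X x\<bar>) + (if v = root then 0 else \<bar>X v\<bar>) \<le> M * area v"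
  shows "density_equiv (((1 + 4 * \<kappa>\<^sup>2 * (2 * C)\<^sup>2)\<^sup>2) ^ (K * N)) B (dens d) (\<lambda>_. 1)"
proof -
  let ?L = "(1 + 4 * \<kappa>\<^sup>2 * (2 * C)\<^sup>2)\<^sup>2"
  have L: "?L > 0" by (rule zero_less_power) (simp add: add_pos_nonneg)
  have Lk: "?L ^ n > 0" for n using L by simp
  \<comment> \<open>\<open>N\<close> times the net gain of mass of \<open>v\<close> within a round,
    after the colours below \<open>k\<close>.\<close>
  define D where "D k v = (\<Sum>x\<in>{x \<in> children v. col x < k}. X x) - (if v \<noteq> root \<and> col v < k then X v else 0)" for k v
  \<comment> \<open>The density after \<open>s\<close> full rounds and the first \<open>k\<close>
    colours of the next one.\<close>
  define st where "st s k v = d v - (real s / real N) * (d v - 1) + D k v / (real N * area v)" for s k v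
  \<comment> \<open>The bounds on \<open>d\<close> at the root force \<open>C \<ge> 1\<close>, so
    the target density 1 lies within them.\<close>
  have "1 / C \<le> C" using d[OF root] by linarith
  then have "1 \<le> C * C" using \<open>C > 0\<close> by (simp add: field_simps)
  have C1: "C \<ge> 1"
  proof (rule ccontr)
    assume "\<not> C \<ge> 1"
    then have "C * C < 1 * 1" using \<open>C > 0\<close> by (intro mult_strict_mono) auto
    with \<open>1 \<le> C * C\<close> show False by simp
  qed
  have Dbound: "\<bar>D k v\<bar> \<le> M * area v" if v: "v \<in> V" for k v
  proof -
    have "\<bar>D k v\<bar> \<le> \<bar>\<Sum>x\<in>{x \<in> children v. col x < k}. X x\<bar> + (if v = root then 0 else \<bar>X v\<bar>)"
      unfolding D_def by auto
    also have "\<bar>\<Sum>x\<in>{x \<in> children v. col x < k}. X x\<bar> \<le> (\<Sum>x\<in>{x \<in> children v. col x < k}. \<bar>X x\<bar>)"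
      by (rule sum_abs)
    also have "\<dots> \<le> (\<Sum>x\<in>children v. \<bar>X x\<bar>)"
      by (rule sum_mono2) (use fin[OF v] in auto)
    finally show ?thesis using bound[OF v] by linarith
  qed
  have stb: "1 / (2 * C) \<le> st s k v \<and> st s k v \<le> 2 * C" if v: "v \<in> V" and s: "s \<le> N" for s k v
  proof -
    have a: "area v > 0" using area_pos[OF v] .
    have "\<bar>D k v / (real N * area v)\<bar> = \<bar>D k v\<bar> / (real N * area v)" using a by (simp add: abs_divide)
    also have "\<dots> \<le> M * area v / (real N * area v)" using Dbound[OF v, of k] a by (intro divide_right_mono) auto
    also have "\<dots> = M / real N" using a by simp
    also have "\<dots> \<le> 1 / (2 * C)" using N \<open>C > 0\<close> by (simp add: field_simps)
    finally have p: "\<bar>D k v / (real N * area v)\<bar> \<le> 1 / (2 * C)" .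
    define t where "t = real s / real N"
    have t: "0 \<le> t" "t \<le> 1" using s N unfolding t_def by auto
    have eq: "d v - t * (d v - 1) = (1 - t) * d v + t * 1" by (simp add: algebra_simps)
    have "1 / C \<le> 1" using C1 by simp
    have "1 / C = (1 - t) * (1 / C) + t * (1 / C)" by (simp only: distrib_right[symmetric]) simp
    also have "\<dots> \<le> (1 - t) * d v + t * 1"
      using t d[OF v] \<open>1 / C \<le> 1\<close> by (intro add_mono mult_left_mono) auto
    finally have lo: "1 / C \<le> d v - t * (d v - 1)" unfolding eq .
    have "(1 - t) * d v + t * 1 \<le> (1 - t) * C + t * C"
      using t d[OF v] C1 by (intro add_mono mult_left_mono) auto
    then have hi: "d v - t * (d v - 1) \<le> C" unfolding eq by (simp add: algebra_simps)
    have "1 / C = 1 / (2 * C) + 1 / (2 * C)" by simp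
    moreover have "1 / (2 * C) \<le> C" using \<open>1 \<le> C * C\<close> \<open>C > 0\<close> by (simp add: field_simps)
    ultimately show ?thesis using p lo hi unfolding st_def t_def[symmetric] by linarith
  qed
  have stpos: "dens (st s k) z > 0" if "s \<le> N" for s k z
  proof (rule dens_pos)
    fix v assume "v \<in> V"
    have "0 < 1 / (2 * C)" using \<open>C > 0\<close> by simp
    then show "st s k v > 0" using stb[OF \<open>v \<in> V\<close> that, of k] by linarith
  qed
  have split: "D (Suc k) v = D k v + (\<Sum>x\<in>{x \<in> children v. col x = k}. X x) - (if v \<noteq> root \<and> col v = k then X v else 0)"
    if v: "v \<in> V" for k v
  proof -
    have "{x \<in> children v. col x < Suc k} = {x \<in> children v. col x < k} \<union> {x \<in> children v. col x = k}" by auto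
    then have "(\<Sum>x\<in>{x \<in> children v. col x < Suc k}. X x) =
       (\<Sum>x\<in>{x \<in> children v. col x < k}. X x) + (\<Sum>x\<in>{x \<in> children v. col x = k}. X x)"
      using fin[OF v] by (simp only:) (subst sum.union_disjoint, auto)
    then show ?thesis unfolding D_def by (auto simp: less_Suc_eq)
  qed
  have step: "density_equiv ?L B (dens (st s k)) (dens (st s (Suc k)))" if s: "s \<le> N" for s k
  proof (rule density_equiv_exchange)
    show "2 * C > 0" using \<open>C > 0\<close> by simp
    show "1 / (2 * C) \<le> st s k v \<and> st s k v \<le> 2 * C"
      "1 / (2 * C) \<le> st s (Suc k) v \<and> st s (Suc k) v \<le> 2 * C" if "v \<in> V" for v
      using stb[OF that s] by auto
    show "st s k q * area q + st s k (par q) * area (par q)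
        = st s (Suc k) q * area q + st s (Suc k) (par q) * area (par q)" if q: "q \<in> edges k" for q
    proof -
      have qV: "q \<in> V" "par q \<in> V" using q par by auto
      have "{x \<in> children q. col x = k} = {}"
        using not_par[OF _ _ _, of q] q unfolding children_def by force
      then have 1: "D (Suc k) q = D k q - X q" using split[OF qV(1), of k] q by (simp only: sum.empty) simp
      have "{x \<in> children (par q). col x = k} = {q}"
        using par_inj[of _ q] q unfolding children_def by auto
      moreover have "\<not> (par q \<noteq> root \<and> col (par q) = k)" using not_par[of "par q" q] q qV by auto
      ultimately have 2: "D (Suc k) (par q) = D k (par q) + X q"
        using split[OF qV(2), of k] by (simp only: if_False) simp
      have e: "st s k v * area v = (d v - (real s / real N) * (d v - 1)) * area v + D k v / real N"
        if "v \<in> V" for k v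
        using area_pos[OF that] unfolding st_def by (simp add: distrib_right)
      show ?thesis unfolding e[OF qV(1)] e[OF qV(2)] 1 2
        by (simp add: diff_divide_distrib add_divide_distrib)
    qed
    show "st s (Suc k) v = st s k v" if "v \<in> V" "v \<notin> edges k" "v \<notin> par ` edges k" for v
    proof -
      have "{x \<in> children v. col x = k} = {}" using that unfolding children_def by auto
      then have "D (Suc k) v = D k v" using split[OF that(1), of k] that by (simp only: sum.empty) auto
      then show ?thesis unfolding st_def by simp
    qed
  qed
  have st00: "st 0 0 = d" unfolding st_def D_def by (simp add: fun_eq_iff)
  have dpos: "d v > 0" if "v \<in> V" for v
    using d[OF that] \<open>C > 0\<close> by (meson divide_pos_pos less_le_trans zero_less_one)
  have round_end: "dens (st s K) = dens (st (Suc s) 0)" for s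
  proof -
    have eq: "st s K v = st (Suc s) 0 v" if v: "v \<in> V" for v
    proof -
      have "{x \<in> children v. col x < K} = children v" using col unfolding children_def by auto
      then have "D K v = (\<Sum>x\<in>children v. X x) - (if v \<noteq> root then X v else 0)"
        unfolding D_def using col[of v] v by auto
      \<comment> \<open>By the balance, the net gain of a full round is exactly one step of the
        linear interpolation.\<close>
      also have "\<dots> = - ((d v - 1) * area v)" using balance[OF v] by (cases "v = root") auto
      finally have "D K v / (real N * area v) = - ((d v - 1) / real N)" using area_pos[OF v] by simp
      moreover have "D 0 v = 0" unfolding D_def by simp
      ultimately show ?thesis unfolding st_def by (simp add: add_divide_distrib algebra_simps)
    qed
    show ?thesis
    proof
      fix z show "dens (st s K) z = dens (st (Suc s) 0) z"
      proof (cases "\<exists>v\<in>V. z \<in> interior (tri v)")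
        case True
        then show ?thesis using eq dens_eq by metis
      next
        case False
        then show ?thesis unfolding dens_def by simp
      qed
    qed
  qed
  have inner: "density_equiv (?L ^ (K * s + k)) B (dens d) (dens (st s k))"
    if "density_equiv (?L ^ (K * s)) B (dens d) (dens (st s 0))" "s \<le> N" for s k
  proof (induction k)
    case 0 then show ?case using that by simp
  next
    case (Suc k)
    have "density_equiv (?L ^ (K * s + k) * ?L) B (dens d) (dens (st s (Suc k)))"
      by (rule density_equiv_trans[OF Suc step[OF that(2)] Lk L stpos[OF that(2)]])
    then show ?case by (simp add: mult.commute)
  qed
  have outer: "s \<le> N \<Longrightarrow> density_equiv (?L ^ (K * s)) B (dens d) (dens (st s 0))" for s
  proof (induction s)
    case 0 then show ?case using density_equiv_refl[of d] dpos st00 by simp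
  next
    case (Suc s)
    then have "density_equiv (?L ^ (K * s + K)) B (dens d) (dens (st s K))" using inner[of s K] by simp
    then show ?case unfolding round_end by (simp add: add.commute)
  qed
  have "dens (st N 0) = (\<lambda>_. 1)"
  proof
    fix z show "dens (st N 0) z = 1"
    proof (cases "\<exists>v\<in>V. z \<in> interior (tri v)")
      case True
      then obtain v where v: "v \<in> V" "z \<in> interior (tri v)" by blast
      show ?thesis unfolding dens_eq[OF v] st_def D_def using N by simp
    next
      case False
      then show ?thesis unfolding dens_def by simp
    qed
  qed
  then show ?thesis using outer[of N] by simp
qed

end

section \<open>A triangulation of the square\<close>

definition rot :: "real^2 \<Rightarrow> real^2" where "rot v = vector [- v $ 2, v $ 1]"

definition corners :: "(real^2) set" where
  "corners = {vector [1, -1], vector [1, 1], vector [-1, 1], vector [-1, -1]}"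

lemma rot_rot [simp]: "rot (rot v) = - v" and rot_minus [simp]: "rot (- v) = - rot v"
  by (simp_all add: rot_def vec_eq_iff forall_2)

lemma corners_iff: "a \<in> corners \<longleftrightarrow> \<bar>a $ 1\<bar> = 1 \<and> \<bar>a $ 2\<bar> = 1"
  by (auto simp: corners_def vec_eq_iff forall_2 abs_if split: if_splits)

lemma rot_corners [simp]: "rot a \<in> corners \<longleftrightarrow> a \<in> corners"
  and minus_corners [simp]: "- a \<in> corners \<longleftrightarrow> a \<in> corners"
  by (auto simp: corners_iff rot_def)

lemma finite_corners: "finite corners" by (simp add: corners_def)

lemma corner_cases:
  assumes "a \<in> corners" "a' \<in> corners"
  shows "a' = a \<or> a' = rot a \<or> a' = - a \<or> a' = - rot a"
proof -
  have "rot (vector [1, -1]) = vector [1, 1]" "rot (vector [1, 1]) = vector [-1, 1]"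
    "rot (vector [-1, 1]) = vector [-1, -1]" "rot (vector [-1, -1]) = vector [1, -1]"
    "- vector [1, -1] = (vector [-1, 1] :: real^2)" "- vector [1, 1] = (vector [-1, -1] :: real^2)"
    "- vector [-1, 1] = (vector [1, -1] :: real^2)" "- vector [-1, -1] = (vector [1, 1] :: real^2)"
    by (simp_all add: rot_def vec_eq_iff forall_2)
  then show ?thesis using assms unfolding corners_def by (elim insertE emptyE; simp)
qed

definition cmb :: "real^2 \<Rightarrow> real \<Rightarrow> real \<Rightarrow> real^2" where
  "cmb a x y = x *\<^sub>R a + y *\<^sub>R rot a"

text \<open>The coordinates of \<open>z\<close> in the frame \<open>a\<close>, \<open>rot a\<close>.
  Their sum \<open>cs a\<close> is the linear functional equal to 1 on the side from
  \<open>a\<close> to \<open>rot a\<close>, and one computation in these coordinates serves all four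
  sides.\<close>

definition cx :: "real^2 \<Rightarrow> real^2 \<Rightarrow> real" where "cx a z = cross2 z (rot a) / 2"
definition cy :: "real^2 \<Rightarrow> real^2 \<Rightarrow> real" where "cy a z = cross2 a z / 2"
definition cs :: "real^2 \<Rightarrow> real^2 \<Rightarrow> real" where "cs a z = cx a z + cy a z"

lemma cross2_rot: "a \<in> corners \<Longrightarrow> cross2 a (rot a) = 2"
  by (auto simp: corners_def cross2_def rot_def)

lemma cmb_add: "cmb a x y + cmb a x' y' = cmb a (x + x') (y + y')"
  and cmb_diff: "cmb a x y - cmb a x' y' = cmb a (x - x') (y - y')"
  and cmb_minus: "- cmb a x y = cmb a (- x) (- y)"
  and cmb_scale: "t *\<^sub>R cmb a x y = cmb a (t * x) (t * y)"
  by (simp_all add: cmb_def algebra_simps)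

lemmas cmb_simps = cmb_add cmb_diff cmb_scale cmb_minus

lemma cross2_cmb: "a \<in> corners \<Longrightarrow> cross2 (cmb a x y) (cmb a x' y') = 2 * (x * y' - y * x')"
proof -
  assume a: "a \<in> corners"
  have "cross2 (cmb a x y) (cmb a x' y') = (x * y' - y * x') * cross2 a (rot a)"
    unfolding cmb_def cross2_def by (simp add: algebra_simps)
  then show ?thesis using cross2_rot[OF a] by simp
qed

lemma norm_cmb: "a \<in> corners \<Longrightarrow> (norm (cmb a x y))\<^sup>2 = 2 * (x\<^sup>2 + y\<^sup>2)"
  unfolding power2_norm_eq_inner
  by (auto simp: corners_def cmb_def rot_def inner_vec_def sum_2 power2_eq_square algebra_simps)

lemma cx_cmb [simp]: "a \<in> corners \<Longrightarrow> cx a (cmb a x y) = x"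
  and cy_cmb [simp]: "a \<in> corners \<Longrightarrow> cy a (cmb a x y) = y"
  and cs_cmb [simp]: "a \<in> corners \<Longrightarrow> cs a (cmb a x y) = x + y"
  by (auto simp: corners_def cmb_def rot_def cx_def cy_def cs_def cross2_def algebra_simps)

lemma cmb_cx_cy: "a \<in> corners \<Longrightarrow> cmb a (cx a z) (cy a z) = z"
  by (auto simp: corners_def cmb_def rot_def cx_def cy_def cross2_def vec_eq_iff forall_2 field_simps)

lemma cx_linear [simp]: "cx a (x + y) = cx a x + cx a y" "cx a (t *\<^sub>R x) = t * cx a x"
  and cy_linear [simp]: "cy a (x + y) = cy a x + cy a y" "cy a (t *\<^sub>R x) = t * cy a x"
  and cs_linear [simp]: "cs a (x + y) = cs a x + cs a y" "cs a (t *\<^sub>R x) = t * cs a x"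
  by (simp_all add: cx_def cy_def cs_def cross2_bilinear add_divide_distrib algebra_simps)

lemma rot_coords:
  "cx (rot a) z = cy a z" "cy (rot a) z = - cx a z" "cx (- a) z = - cx a z" "cy (- a) z = - cy a z"
  by (simp_all add: cx_def cy_def cross2_def rot_def field_simps)

lemma corner_exists: "\<exists>a\<in>corners. cx a z \<ge> 0 \<and> cy a z \<ge> 0"
proof -
  let ?a = "vector [1, 1] :: real^2"
  have a: "?a \<in> corners" by (simp add: corners_def)
  show ?thesis
  proof (cases "cx ?a z \<ge> 0"; cases "cy ?a z \<ge> 0")
    assume "cx ?a z \<ge> 0" "cy ?a z \<ge> 0" then show ?thesis using a by blast
  next
    assume "cx ?a z \<ge> 0" "\<not> cy ?a z \<ge> 0"
    then show ?thesis using a by (intro bexI[of _ "- rot ?a"]) (auto simp: rot_coords)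
  next
    assume "\<not> cx ?a z \<ge> 0" "cy ?a z \<ge> 0"
    then show ?thesis using a by (intro bexI[of _ "rot ?a"]) (auto simp: rot_coords)
  next
    assume "\<not> cx ?a z \<ge> 0" "\<not> cy ?a z \<ge> 0"
    then show ?thesis using a by (intro bexI[of _ "- ?a"]) (auto simp: rot_coords)
  qed
qed

lemma corner_unique:
  assumes "a \<in> corners" "a' \<in> corners" "cx a z > 0" "cy a z > 0" "cx a' z > 0" "cy a' z > 0"
  shows "a' = a"
  using corner_cases[OF assms(1,2)] assms(3-6) by (auto simp: rot_coords)

lemma cs_eq: "cs a z = (z $ 1 * (a $ 1 - a $ 2) + z $ 2 * (a $ 1 + a $ 2)) / 2"
  by (simp add: cs_def cx_def cy_def cross2_def rot_def field_simps)

lemma cs_corners: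
  "(\<forall>a\<in>corners. P (cs a z)) \<longleftrightarrow> P (z $ 1) \<and> P (z $ 2) \<and> P (- z $ 1) \<and> P (- z $ 2)"
proof -
  have "cs (vector [1, -1]) z = z $ 1" "cs (vector [1, 1]) z = z $ 2"
    "cs (vector [-1, 1]) z = - z $ 1" "cs (vector [-1, -1]) z = - z $ 2"
    by (simp_all add: cs_eq)
  then show ?thesis unfolding corners_def by simp
qed

lemma csquare_eq: "csquare r = {z. \<forall>a\<in>corners. cs a z \<le> r}"
  unfolding cs_corners[of "\<lambda>x. x \<le> r"] csquare_def set_eq_iff mem_box_cart forall_2
  by (simp, linarith)

lemma interior_csquare: "interior (csquare r) = {z. \<forall>a\<in>corners. cs a z < r}"
  unfolding cs_corners[of "\<lambda>x. x < r"] csquare_def interior_cbox set_eq_iff mem_box_cart forall_2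
  by (simp, linarith)

text \<open>The three cross products are doubled signed areas; divided by their sum they are the
  barycentric coordinates of \<open>z\<close>.\<close>

lemma in_triangle_cross2:
  fixes p1 p2 p3 z :: "real^2"
  assumes "cross2 (p2 - p1) (p3 - p1) > 0"
    and "cross2 (p2 - z) (p3 - z) \<ge> 0" "cross2 (p3 - z) (p1 - z) \<ge> 0" "cross2 (p1 - z) (p2 - z) \<ge> 0"
  shows "z \<in> convex hull {p1, p2, p3}"
proof -
  let ?d = "cross2 (p2 - p1) (p3 - p1)"
  let ?x = "cross2 (p2 - z) (p3 - z)" and ?y = "cross2 (p3 - z) (p1 - z)" and ?w = "cross2 (p1 - z) (p2 - z)"
  have 1: "?x + ?y + ?w = ?d" unfolding cross2_def by (simp add: algebra_simps)
  have 2: "?x *\<^sub>R p1 + ?y *\<^sub>R p2 + ?w *\<^sub>R p3 = ?d *\<^sub>R z"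
    unfolding cross2_def by (simp add: vec_eq_iff forall_2 algebra_simps)
  show ?thesis
  proof (rule in_triangleI)
    show "?x / ?d + ?y / ?d + ?w / ?d = 1" using 1 assms(1) by (simp add: add_divide_distrib[symmetric])
    have "(?x / ?d) *\<^sub>R p1 + (?y / ?d) *\<^sub>R p2 + (?w / ?d) *\<^sub>R p3
        = (1 / ?d) *\<^sub>R (?x *\<^sub>R p1 + ?y *\<^sub>R p2 + ?w *\<^sub>R p3)" by (simp add: scaleR_add_right)
    then show "z = (?x / ?d) *\<^sub>R p1 + (?y / ?d) *\<^sub>R p2 + (?w / ?d) *\<^sub>R p3"
      unfolding 2 using assms(1) by simp
  qed (use assms in auto)
qed

lemma cmb_rot: "cmb (rot a) x y = cmb a (- y) x" and cmb_uminus: "cmb (- a) x y = cmb a (- x) (- y)"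
  by (simp_all add: cmb_def)

section \<open>Diamonds of bounded eccentricity\<close>

definition fat_diamond :: "real^2 \<Rightarrow> real^2 \<Rightarrow> real^2 \<Rightarrow> real^2 \<Rightarrow> real \<Rightarrow> real \<Rightarrow> bool" where
  "fat_diamond a b u w \<nu> \<mu> \<longleftrightarrow> diamond a b u w \<nu> \<mu> \<and>
    1/100 \<le> \<nu> \<and> 1/100 \<le> 1 - \<nu> \<and> 1/100 \<le> \<mu> \<and> 1/100 \<le> 1 - \<mu> \<and>
    (norm (b - a))\<^sup>2 + (norm (u - w))\<^sup>2 \<le> 100 * \<bar>cross2 (b - a) (u - w)\<bar>"

text \<open>The bound \<open>m\<close> on the coordinate differences gives at most
  \<open>8 * m\<^sup>2\<close> for the sum of the squared diagonals, and the frame doubles cross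
  products; the constants fit because \<open>8 * 25 = 100 * 2\<close>.\<close>

lemma fat_diamondI:
  assumes c: "c \<in> corners"
    and "1/100 \<le> \<nu>" "1/100 \<le> 1 - \<nu>" "1/100 \<le> \<mu>" "1/100 \<le> 1 - \<mu>"
    and meet: "xa + \<nu> * (xb - xa) = xw + \<mu> * (xu - xw)" "ya + \<nu> * (yb - ya) = yw + \<mu> * (yu - yw)"
    and m: "\<bar>xb - xa\<bar> \<le> m" "\<bar>yb - ya\<bar> \<le> m" "\<bar>xu - xw\<bar> \<le> m" "\<bar>yu - yw\<bar> \<le> m" "m > 0"
    and D: "m\<^sup>2 \<le> 25 * \<bar>(xb - xa) * (yu - yw) - (yb - ya) * (xu - xw)\<bar>"
  shows "fat_diamond (cmb c xa ya) (cmb c xb yb) (cmb c xu yu) (cmb c xw yw) \<nu> \<mu>"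
proof -
  let ?D = "(xb - xa) * (yu - yw) - (yb - ya) * (xu - xw)"
  have cr: "cross2 (cmb c xb yb - cmb c xa ya) (cmb c xu yu - cmb c xw yw) = 2 * ?D"
    unfolding cmb_simps cross2_cmb[OF c] by simp
  have m2: "s\<^sup>2 \<le> m\<^sup>2" if "\<bar>s\<bar> \<le> m" for s using that power2_le_iff_abs_le[of m s] \<open>m > 0\<close> by simp
  have "m\<^sup>2 > 0" using \<open>m > 0\<close> by simp
  then have D0: "?D \<noteq> 0" using D by auto
  have "diamond (cmb c xa ya) (cmb c xb yb) (cmb c xu yu) (cmb c xw yw) \<nu> \<mu>"
  proof
    show "cmb c xa ya + \<nu> *\<^sub>R (cmb c xb yb - cmb c xa ya) = cmb c xw yw + \<mu> *\<^sub>R (cmb c xu yu - cmb c xw yw)"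
      unfolding cmb_simps using meet by simp
    show "cross2 (cmb c xb yb - cmb c xa ya) (cmb c xu yu - cmb c xw yw) \<noteq> 0"
      unfolding cr using D0 by simp
  qed (use assms(2-5) in auto)
  moreover have "(norm (cmb c xb yb - cmb c xa ya))\<^sup>2 + (norm (cmb c xu yu - cmb c xw yw))\<^sup>2 \<le> 100 * \<bar>2 * ?D\<bar>"
    unfolding cmb_simps norm_cmb[OF c]
  proof -
    define E where "E = \<bar>?D\<bar>"
    have "\<bar>2 * ?D\<bar> = 2 * E" unfolding E_def by (simp only: abs_mult abs_numeral)
    then show "2 * ((xb - xa)\<^sup>2 + (yb - ya)\<^sup>2) + 2 * ((xu - xw)\<^sup>2 + (yu - yw)\<^sup>2) \<le> 100 * \<bar>2 * ?D\<bar>"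
      using m2[OF m(1)] m2[OF m(2)] m2[OF m(3)] m2[OF m(4)] D
      unfolding E_def[symmetric] by argo
  qed
  ultimately show ?thesis unfolding fat_diamond_def cr using assms(2-5) by simp
qed

text \<open>With \<open>t = 1/2^i\<close> and \<open>x = k/2^i\<close> these are the quadrilaterals
  across the two cuts of a trapezoid of level \<open>i\<close>. They are trapezoids themselves, with
  parallel sides in the ratio of \<open>1 - t\<close> to \<open>(1 - t/2) / 2\<close>, and the
  diagonals of a trapezoid divide each other in that ratio.\<close>

lemma fat_diamond_halves:
  fixes t x :: real
  assumes c: "c \<in> corners" and t: "0 < t" "t \<le> 1/2" and x: "0 \<le> x" "x + t \<le> 1"
    and \<nu>: "\<nu> = (1 - t) / ((1 - t) + (1 - t/2) / 2)"
  shows "fat_diamond (cmb c ((1-t) * (1-x)) ((1-t) * x)) (cmb c ((1-t/2) * (1-(x+t/2))) ((1-t/2) * (x+t/2)))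
      (cmb c ((1-t/2) * (1-x)) ((1-t/2) * x)) (cmb c ((1-t) * (1-(x+t))) ((1-t) * (x+t))) \<nu> \<nu>" (is ?L)
    and "fat_diamond (cmb c ((1-t) * (1-(x+t))) ((1-t) * (x+t))) (cmb c ((1-t/2) * (1-(x+t/2))) ((1-t/2) * (x+t/2)))
      (cmb c ((1-t/2) * (1-(x+t))) ((1-t/2) * (x+t))) (cmb c ((1-t) * (1-x)) ((1-t) * x)) \<nu> \<nu>" (is ?R)
proof -
  have den: "(1 - t) + (1 - t/2) / 2 > 0" using t by (simp add: field_simps)
  have h: "\<nu> * ((1 - t) + (1 - t/2) / 2) = 1 - t" unfolding \<nu> using den by simp
  \<comment> \<open>Both coordinates of the meeting condition reduce to this multiple of the
    equation for \<open>\<nu>\<close>.\<close>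
  then have ht: "t * (\<nu> * ((1 - t) + (1 - t/2) / 2)) = t * (1 - t)" by simp
  have b: "1/100 \<le> \<nu>" "1/100 \<le> 1 - \<nu>"
    unfolding \<nu> using t den by (simp_all add: field_simps)
  have p: "0 \<le> t * x" "t * x \<le> t" "t * x + t * t \<le> t"
    using t x mult_left_le[of "x + t" t] by (simp_all add: mult_left_le distrib_left)
  have tt: "0 \<le> t * t" "t * t \<le> t / 2" using t mult_left_mono[of t "1/2" t] by auto
  have D: "(2 * t)\<^sup>2 \<le> 25 * (t * t * ((1 - t) + (1 - t/2) / 2) / 2)"
  proof -
    have "t * t * 4 \<le> t * t * (25 / 2 * ((1 - t) + (1 - t/2) / 2))"
      by (rule mult_left_mono) (use t tt in \<open>simp_all add: field_simps\<close>)
    then show ?thesis by (simp add: power2_eq_square algebra_simps)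
  qed
  show ?L
  proof (rule fat_diamondI[OF c b b, where m = "2 * t"])
    show "(2 * t)\<^sup>2 \<le> 25 * \<bar>((1-t/2) * (1-(x+t/2)) - (1-t) * (1-x)) * ((1-t/2) * x - (1-t) * (x+t))
       - ((1-t/2) * (x+t/2) - (1-t) * x) * ((1-t/2) * (1-x) - (1-t) * (1-(x+t)))\<bar>"
    proof -
      have "((1-t/2) * (1-(x+t/2)) - (1-t) * (1-x)) * ((1-t/2) * x - (1-t) * (x+t))
       - ((1-t/2) * (x+t/2) - (1-t) * x) * ((1-t/2) * (1-x) - (1-t) * (1-(x+t)))
       = - (t * t * ((1 - t) + (1 - t/2) / 2) / 2)" by (simp add: field_simps)
      moreover have "0 \<le> t * t * ((1 - t) + (1 - t/2) / 2) / 2" using den tt by simp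
      ultimately show ?thesis using D by (simp only: abs_minus_cancel abs_of_nonneg)
    qed
    show "(1-t) * (1-x) + \<nu> * ((1-t/2) * (1-(x+t/2)) - (1-t) * (1-x)) = (1-t) * (1-(x+t)) + \<nu> * ((1-t/2) * (1-x) - (1-t) * (1-(x+t)))"
      using ht by argo
    show "(1-t) * x + \<nu> * ((1-t/2) * (x+t/2) - (1-t) * x) = (1-t) * (x+t) + \<nu> * ((1-t/2) * x - (1-t) * (x+t))"
      using ht by argo
  qed (insert t p tt b, unfold abs_le_iff, ((intro conjI)?, argo)+)
  show ?R
  proof (rule fat_diamondI[OF c b b, where m = "2 * t"])
    show "(2 * t)\<^sup>2 \<le> 25 * \<bar>((1-t/2) * (1-(x+t/2)) - (1-t) * (1-(x+t))) * ((1-t/2) * (x+t) - (1-t) * x)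
       - ((1-t/2) * (x+t/2) - (1-t) * (x+t)) * ((1-t/2) * (1-(x+t)) - (1-t) * (1-x))\<bar>"
    proof -
      have "((1-t/2) * (1-(x+t/2)) - (1-t) * (1-(x+t))) * ((1-t/2) * (x+t) - (1-t) * x)
       - ((1-t/2) * (x+t/2) - (1-t) * (x+t)) * ((1-t/2) * (1-(x+t)) - (1-t) * (1-x))
       = t * t * ((1 - t) + (1 - t/2) / 2) / 2" by (simp add: field_simps)
      moreover have "0 \<le> t * t * ((1 - t) + (1 - t/2) / 2) / 2" using den tt by simp
      ultimately show ?thesis using D by (simp only: abs_of_nonneg)
    qed
    show "(1-t) * (1-(x+t)) + \<nu> * ((1-t/2) * (1-(x+t/2)) - (1-t) * (1-(x+t))) = (1-t) * (1-x) + \<nu> * ((1-t/2) * (1-(x+t)) - (1-t) * (1-x))"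
      using ht by argo
    show "(1-t) * (x+t) + \<nu> * ((1-t/2) * (x+t/2) - (1-t) * (x+t)) = (1-t) * x + \<nu> * ((1-t/2) * (x+t) - (1-t) * x)"
      using ht by argo
  qed (insert t p tt b, unfold abs_le_iff, ((intro conjI)?, argo)+)
qed

text \<open>Here the common edge lies on the square of radius \<open>1 - t/2\<close>, the opposite
  vertices on those of radius \<open>1 - t\<close> and \<open>1 - t/4\<close>. The gaps
  \<open>t/2\<close> and \<open>t/4\<close> give the ratio 2/3, and \<open>\<nu>\<close> is the
  position of the crossing on the edge, measured from the end on the ray through the inner
  vertex.\<close>

lemma fat_diamond_levels:
  fixes t x :: real
  assumes c: "c \<in> corners" and t: "0 < t" "t \<le> 1/2" and x: "0 \<le> x" "x + t \<le> 1"
    and \<nu>: "\<nu> = (1 - t/4) / (3 * (1 - t/2))"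
  shows "fat_diamond (cmb c ((1-t/2) * (1-x)) ((1-t/2) * x)) (cmb c ((1-t/2) * (1-(x+t/2))) ((1-t/2) * (x+t/2)))
      (cmb c ((1-t/4) * (1-(x+t/4))) ((1-t/4) * (x+t/4))) (cmb c ((1-t) * (1-x)) ((1-t) * x)) \<nu> (2/3)" (is ?L)
    and "fat_diamond (cmb c ((1-t/2) * (1-(x+t/2))) ((1-t/2) * (x+t/2))) (cmb c ((1-t/2) * (1-(x+t))) ((1-t/2) * (x+t)))
      (cmb c ((1-t/4) * (1-(x+3*t/4))) ((1-t/4) * (x+3*t/4))) (cmb c ((1-t) * (1-(x+t))) ((1-t) * (x+t))) (1 - \<nu>) (2/3)" (is ?R)
proof -
  have den: "3 * (1 - t/2) > 0" using t by simp
  have h: "\<nu> * (3 * (1 - t/2)) = 1 - t/4" unfolding \<nu> using den by simp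
  then have ht: "t * (\<nu> * (3 * (1 - t/2))) = t * (1 - t/4)" by simp
  have b: "1/100 \<le> \<nu>" "1/100 \<le> 1 - \<nu>"
    unfolding \<nu> using t den by (simp_all add: field_simps)
  have p: "0 \<le> t * x" "t * x \<le> t" "t * x + t * t \<le> t"
    using t x mult_left_le[of "x + t" t] by (simp_all add: mult_left_le distrib_left)
  have tt: "0 \<le> t * t" "t * t \<le> t / 2" using t mult_left_mono[of t "1/2" t] by auto
  have D: "t\<^sup>2 \<le> 25 * (t * t * (3/8) * (1 - t/2))"
  proof -
    have "t * t * 1 \<le> t * t * (75/8 * (1 - t/2))"
      by (rule mult_left_mono) (use t tt in \<open>simp_all add: field_simps\<close>)
    then show ?thesis by (simp add: power2_eq_square algebra_simps)
  qed
  have D0: "0 \<le> t * t * (3/8) * (1 - t/2)" using den tt by simp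
  show ?L
  proof (rule fat_diamondI[OF c b, where m = t])
    show "t\<^sup>2 \<le> 25 * \<bar>((1-t/2) * (1-(x+t/2)) - (1-t/2) * (1-x)) * ((1-t/4) * (x+t/4) - (1-t) * x)
       - ((1-t/2) * (x+t/2) - (1-t/2) * x) * ((1-t/4) * (1-(x+t/4)) - (1-t) * (1-x))\<bar>"
    proof -
      have "((1-t/2) * (1-(x+t/2)) - (1-t/2) * (1-x)) * ((1-t/4) * (x+t/4) - (1-t) * x)
       - ((1-t/2) * (x+t/2) - (1-t/2) * x) * ((1-t/4) * (1-(x+t/4)) - (1-t) * (1-x))
       = - (t * t * (3/8) * (1 - t/2))" by (simp add: field_simps)
      then show ?thesis using D D0 by (simp only: abs_minus_cancel abs_of_nonneg)
    qed
    show "(1-t/2) * (1-x) + \<nu> * ((1-t/2) * (1-(x+t/2)) - (1-t/2) * (1-x)) = (1-t) * (1-x) + 2/3 * ((1-t/4) * (1-(x+t/4)) - (1-t) * (1-x))"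
      using ht by argo
    show "(1-t/2) * x + \<nu> * ((1-t/2) * (x+t/2) - (1-t/2) * x) = (1-t) * x + 2/3 * ((1-t/4) * (x+t/4) - (1-t) * x)"
      using ht by argo
  qed (insert t p tt b, unfold abs_le_iff, ((intro conjI)?, argo)+)
  show ?R
  proof (rule fat_diamondI[OF c, where m = t])
    show "t\<^sup>2 \<le> 25 * \<bar>((1-t/2) * (1-(x+t)) - (1-t/2) * (1-(x+t/2))) * ((1-t/4) * (x+3*t/4) - (1-t) * (x+t))
       - ((1-t/2) * (x+t) - (1-t/2) * (x+t/2)) * ((1-t/4) * (1-(x+3*t/4)) - (1-t) * (1-(x+t)))\<bar>"
    proof -
      have "((1-t/2) * (1-(x+t)) - (1-t/2) * (1-(x+t/2))) * ((1-t/4) * (x+3*t/4) - (1-t) * (x+t))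
       - ((1-t/2) * (x+t) - (1-t/2) * (x+t/2)) * ((1-t/4) * (1-(x+3*t/4)) - (1-t) * (1-(x+t)))
       = - (t * t * (3/8) * (1 - t/2))" by (simp add: field_simps)
      then show ?thesis using D D0 by (simp only: abs_minus_cancel abs_of_nonneg)
    qed
    show "(1-t/2) * (1-(x+t/2)) + (1-\<nu>) * ((1-t/2) * (1-(x+t)) - (1-t/2) * (1-(x+t/2))) = (1-t) * (1-(x+t)) + 2/3 * ((1-t/4) * (1-(x+3*t/4)) - (1-t) * (1-(x+t)))"
      using ht by argo
    show "(1-t/2) * (x+t/2) + (1-\<nu>) * ((1-t/2) * (x+t) - (1-t/2) * (x+t/2)) = (1-t) * (x+t) + 2/3 * ((1-t/4) * (x+3*t/4) - (1-t) * (x+t))"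
      using ht by argo
  qed (insert t p tt b, unfold abs_le_iff, ((intro conjI)?, argo)+)
qed

section \<open>The triangles, their tree and its edge colouring\<close>

definition dpt :: "real^2 \<Rightarrow> nat \<Rightarrow> nat \<Rightarrow> real^2" where
  "dpt a i k = cmb a ((1 - 1/2^i) * (1 - real k / 2^i)) ((1 - 1/2^i) * (real k / 2^i))"

text \<open>A distinguished corner breaks the symmetry at the centre: it fixes how the central
  diamond is halved, and thereby the root.\<close>

definition c0 :: "real^2" where "c0 = vector [1, 1]"

lemma c0_corner [simp]: "c0 \<in> corners" by (simp add: c0_def corners_def)

text \<open>\<open>Dc\<close>, \<open>Lc\<close> and \<open>Rc\<close> are the three triangles of a trapezoid of the dissection for \<open>m = 1\<close>,
  cut along the segments from the inner vertices to the midpoint of the outer side; \<open>Kc\<close> and \<open>Tc\<close>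
  are the corner triangles of the central square and the halves of the remaining diamond.\<close>

datatype cell = Dc "real^2" nat nat | Lc "real^2" nat nat | Rc "real^2" nat nat | Kc "real^2" | Tc "real^2"

text \<open>\<open>ea v\<close> and \<open>eb v\<close> bound the edge towards the parent,
  \<open>eu v\<close> completes the triangle of \<open>v\<close>, and \<open>ew v\<close> is the
  opposite vertex of the parent. The halves of an outer side are the inner sides of two trapezoids
  of the next level; hence, for \<open>i > 1\<close>, \<open>Dc a i k\<close> hangs below an
  \<open>Lc\<close> or an \<open>Rc\<close> according to the parity of \<open>k\<close>.\<close>

fun ea eb eu ew :: "cell \<Rightarrow> real^2" where
  "ea (Dc a i k) = dpt a i k"
| "ea (Lc a i k) = dpt a i k"
| "ea (Rc a i k) = dpt a i (k+1)"
| "ea (Kc c) = cmb c (1/4) (-1/4)"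
| "ea (Tc c) = cmb c (1/4) (-1/4)"
| "eb (Dc a i k) = dpt a i (k+1)"
| "eb (Lc a i k) = dpt a (i+1) (2*k+1)"
| "eb (Rc a i k) = dpt a (i+1) (2*k+1)"
| "eb (Kc c) = cmb c (1/4) (1/4)"
| "eb (Tc c) = cmb c (-1/4) (1/4)"
| "eu (Dc a i k) = dpt a (i+1) (2*k+1)"
| "eu (Lc a i k) = dpt a (i+1) (2*k)"
| "eu (Rc a i k) = dpt a (i+1) (2*k+2)"
| "eu (Kc c) = cmb c (1/2) 0"
| "eu (Tc c) = cmb c (1/4) (1/4)"
| "ew (Dc a i k) = (if i = 1 then (if k = 0 then cmb a (1/4) (-1/4) else cmb a (-1/4) (1/4))
     else dpt a (i-1) ((k+1) div 2))"
| "ew (Lc a i k) = dpt a i (k+1)"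
| "ew (Rc a i k) = dpt a i k"
| "ew (Kc c) = (if c = c0 \<or> c = - c0 then cmb c (-1/4) (1/4) else cmb c (-1/4) (-1/4))"
| "ew (Tc c) = cmb c (-1/4) (-1/4)"

fun lam mu :: "cell \<Rightarrow> real" where
  "lam (Dc a i k) = (if i = 1 then (if k = 0 then 1/6 else 5/6)
     else (let s = (1 - 1/2^(i+1)) / (3 * (1 - 1/2^i)) in if even k then s else 1 - s))"
| "lam (Lc a i k) = (1 - 1/2^i) / ((1 - 1/2^i) + (1 - 1/2^(i+1)) / 2)"
| "lam (Rc a i k) = (1 - 1/2^i) / ((1 - 1/2^i) + (1 - 1/2^(i+1)) / 2)"
| "lam (Kc c) = (if c = c0 \<or> c = - c0 then 2/3 else 1/3)"
| "lam (Tc c) = 1/2"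
| "mu (Dc a i k) = 2/3"
| "mu (Lc a i k) = (1 - 1/2^i) / ((1 - 1/2^i) + (1 - 1/2^(i+1)) / 2)"
| "mu (Rc a i k) = (1 - 1/2^i) / ((1 - 1/2^i) + (1 - 1/2^(i+1)) / 2)"
| "mu (Kc c) = 2/3"
| "mu (Tc c) = 1/2"

fun par :: "cell \<Rightarrow> cell" where
  "par (Dc a i k) = (if i = 1 then (if k = 0 then Kc a else Kc (rot a))
     else if even k then Lc a (i-1) (k div 2) else Rc a (i-1) (k div 2))"
| "par (Lc a i k) = Dc a i k"
| "par (Rc a i k) = Dc a i k"
| "par (Kc c) = (if c = c0 \<or> c = rot c0 then Tc c0 else Tc (- c0))"
| "par (Tc c) = Tc (- c0)"

text \<open>A proper edge colouring: the edges inside a trapezoid have the colours 2 and 3, those on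
  an inner side of a trapezoid 0 and 1, and the few central edges are fitted in so that every
  triangle still meets each colour once at most.\<close>

fun col :: "cell \<Rightarrow> nat" where
  "col (Dc a i k) = (if even k then 0 else 1)"
| "col (Lc a i k) = 2"
| "col (Rc a i k) = 3"
| "col (Kc c) = (if c = c0 \<or> c = - c0 then 2 else 3)"
| "col (Tc c) = 0"

definition cells :: "cell set" where
  "cells = {Dc a i k | a i k. a \<in> corners \<and> 1 \<le> i \<and> k < 2^i} \<union> {Lc a i k | a i k. a \<in> corners \<and> 1 \<le> i \<and> k < 2^i}
    \<union> {Rc a i k | a i k. a \<in> corners \<and> 1 \<le> i \<and> k < 2^i} \<union> {Kc c | c. c \<in> corners} \<union> {Tc c0, Tc (- c0)}"

abbreviation root :: cell where "root \<equiv> Tc (- c0)"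

definition tri :: "cell \<Rightarrow> (real^2) set" where "tri v = convex hull {ea v, eb v, eu v}"

lemma cells_iff [simp]:
  "Dc a i k \<in> cells \<longleftrightarrow> a \<in> corners \<and> 1 \<le> i \<and> k < 2^i"
  "Lc a i k \<in> cells \<longleftrightarrow> a \<in> corners \<and> 1 \<le> i \<and> k < 2^i"
  "Rc a i k \<in> cells \<longleftrightarrow> a \<in> corners \<and> 1 \<le> i \<and> k < 2^i"
  "Kc c \<in> cells \<longleftrightarrow> c \<in> corners"
  "Tc c \<in> cells \<longleftrightarrow> c = c0 \<or> c = - c0"
  by (auto simp: cells_def)

lemma c0_distinct: "c0 \<noteq> - c0" "rot c0 \<noteq> c0" "rot c0 \<noteq> - c0" "- rot c0 \<noteq> c0"
  by (simp_all add: c0_def rot_def vec_eq_iff forall_2)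

lemma corner_cases_c0: "c \<in> corners \<Longrightarrow> c = c0 \<or> c = - c0 \<or> c = rot c0 \<or> c = - rot c0"
  using corner_cases[OF c0_corner, of c] by auto

lemma dpt_level:
  assumes "1 \<le> i" "k < 2^i"
  obtains t x :: real where "0 < t" "t \<le> 1/2" "0 \<le> x" "x + t \<le> 1" "t = 1/2^i" "x = real k / 2^i"
proof -
  have "(2::real)^1 \<le> 2^i" using assms(1) by (intro power_increasing) auto
  then have "1/2^i \<le> (1/2::real)" by (simp add: field_simps)
  moreover have "real (k + 1) \<le> 2^i" using assms(2) by (metis Suc_eq_plus1 Suc_leI of_nat_le_iff of_nat_numeral of_nat_power)
  then have "real k / 2^i + 1/2^i \<le> (1::real)" by (simp add: field_simps)
  ultimately show thesis using that[of "1/2^i" "real k / 2^i"] by simp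
qed

lemma dpt_refine:
  assumes "t = 1/2^i" "x = real k / 2^i"
  shows "dpt a i (k + j) = cmb a ((1-t) * (1-(x + j*t))) ((1-t) * (x + j*t))"
    and "dpt a (i+1) (2*k + j) = cmb a ((1-t/2) * (1-(x + j*t/2))) ((1-t/2) * (x + j*t/2))"
    and "dpt a (i+2) (4*k + j) = cmb a ((1-t/4) * (1-(x + j*t/4))) ((1-t/4) * (x + j*t/4))"
proof -
  have "real (k + j) / 2^i = x + j*t" "real (2*k + j) / 2^(i+1) = x + j*t/2" "real (4*k + j) / 2^(i+2) = x + j*t/4"
    "1/2^(i+1) = t/2" "1/2^(i+2) = t/4"
    unfolding assms by (simp_all add: add_divide_distrib)
  then show "dpt a i (k + j) = cmb a ((1-t) * (1-(x + j*t))) ((1-t) * (x + j*t))"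
    "dpt a (i+1) (2*k + j) = cmb a ((1-t/2) * (1-(x + j*t/2))) ((1-t/2) * (x + j*t/2))"
    "dpt a (i+2) (4*k + j) = cmb a ((1-t/4) * (1-(x + j*t/4))) ((1-t/4) * (x + j*t/4))"
    unfolding dpt_def assms(1)[symmetric] by metis+
qed

lemma fat_diamond_cell:
  assumes v: "v \<in> cells - {root}"
  shows "fat_diamond (ea v) (eb v) (eu v) (ew v) (lam v) (mu v)"
proof (cases v)
  case (Lc a i k)
  then have a: "a \<in> corners" "1 \<le> i" "k < 2^i" using v by auto
  obtain t x where t: "0 < t" "t \<le> 1/2" "0 \<le> x" "x + t \<le> 1" "t = 1/2^i" "x = real k / 2^i"
    using dpt_level[OF a(2,3)] .
  have e: "1/2^(i+1) = t/2" unfolding t(5) by simp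
  show ?thesis unfolding Lc ea.simps eb.simps eu.simps ew.simps lam.simps mu.simps e t(5)[symmetric]
    using fat_diamond_halves(1)[OF a(1) t(1-4) refl] dpt_refine[OF t(5,6), of a 0] dpt_refine[OF t(5,6), of a 1] by simp
next
  case (Rc a i k)
  then have a: "a \<in> corners" "1 \<le> i" "k < 2^i" using v by auto
  obtain t x where t: "0 < t" "t \<le> 1/2" "0 \<le> x" "x + t \<le> 1" "t = 1/2^i" "x = real k / 2^i"
    using dpt_level[OF a(2,3)] .
  have e: "1/2^(i+1) = t/2" unfolding t(5) by simp
  show ?thesis unfolding Rc ea.simps eb.simps eu.simps ew.simps lam.simps mu.simps e t(5)[symmetric]
    using fat_diamond_halves(2)[OF a(1) t(1-4) refl] dpt_refine[OF t(5,6), of a 0] dpt_refine[OF t(5,6), of a 1]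
      dpt_refine[OF t(5,6), of a 2] by simp
next
  case (Kc c)
  then have c: "c \<in> corners" using v by simp
  show ?thesis
    unfolding Kc ea.simps eb.simps eu.simps ew.simps lam.simps mu.simps
    by (cases "c = c0 \<or> c = - c0")
       (simp_all only: if_True if_False, (rule fat_diamondI[OF c, where m = 1]; simp add: power2_eq_square)+)
next
  case (Tc c)
  then have c: "c \<in> corners" using v by auto
  show ?thesis
    unfolding Tc ea.simps eb.simps eu.simps ew.simps lam.simps mu.simps
    by (rule fat_diamondI[OF c, where m = 1]; simp add: power2_eq_square)
next
  case (Dc a i k)
  then have a: "a \<in> corners" "1 \<le> i" "k < 2^i" using v by auto
  show ?thesis
  proof (cases "i = 1")
    case True
    then have "k = 0 \<or> k = 1" using a by auto
    then show ?thesis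
    proof
      assume "k = 0"
      then show ?thesis unfolding Dc True
        by (simp add: dpt_def) (rule fat_diamondI[OF a(1), where m = 1]; simp add: power2_eq_square)
    next
      assume "k = 1"
      then show ?thesis unfolding Dc True
        by (simp add: dpt_def) (rule fat_diamondI[OF a(1), where m = 1]; simp add: power2_eq_square)
    qed
  next
    case False
    then obtain j where j: "i = j + 1" "1 \<le> j" using a(2) by (metis Suc_eq_plus1 Suc_le_mono le_SucE le_add_diff_inverse2 nat_le_linear One_nat_def add_leD2)
    \<comment> \<open>The parent has level \<open>j\<close> and index \<open>l\<close>. The vertex
      index \<open>(k + 1) div 2\<close> is \<open>l\<close> for even and \<open>l + 1\<close> for
      odd \<open>k\<close>, the inner vertex of the parent in either case.\<close>
    define l where "l = k div 2"
    have l: "l < 2^j" using a(3) unfolding l_def j by auto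
    obtain t x where t: "0 < t" "t \<le> 1/2" "0 \<le> x" "x + t \<le> 1" "t = 1/2^j" "x = real l / 2^j"
      using dpt_level[OF j(2) l] .
    have e: "1/2^(j+1) = t/2" "1/2^(j+1+1) = t/4" unfolding t(5) by simp_all
    note fl = fat_diamond_levels[OF a(1) t(1-4) refl]
    show ?thesis
    proof (cases "even k")
      case True
      then have k: "k = 2 * l" unfolding l_def by simp
      show ?thesis
        unfolding Dc ea.simps eb.simps eu.simps ew.simps lam.simps mu.simps if_not_P[OF False] if_P[OF True] Let_def
        unfolding j e using fl(1) dpt_refine[OF t(5,6), of a 0] dpt_refine[OF t(5,6), of a 1]
        by (simp add: k)
    next
      case odd: False
      then have k: "k = 2 * l + 1" unfolding l_def by (metis odd_two_times_div_two_succ)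
      show ?thesis
        unfolding Dc ea.simps eb.simps eu.simps ew.simps lam.simps mu.simps if_not_P[OF False] if_not_P[OF odd] Let_def
        unfolding j e using fl(2) dpt_refine[OF t(5,6), of a 0] dpt_refine[OF t(5,6), of a 1]
          dpt_refine[OF t(5,6), of a 2] dpt_refine[OF t(5,6), of a 3]
        by (simp add: k numeral_3_eq_3)
    qed
  qed
qed

lemma div2_less_power: "1 \<le> i \<Longrightarrow> k < 2^i \<Longrightarrow> k div 2 < (2::nat)^(i-1)"
  by (cases i) auto

lemma par_cells: "v \<in> cells - {root} \<Longrightarrow> par v \<in> cells"
  using div2_less_power by (cases v) auto

lemma tri_par:
  assumes v: "v \<in> cells - {root}"
  shows "tri (par v) = convex hull {ea v, eb v, ew v}"
proof (cases v)
  case (Dc a i k)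
  then have a: "a \<in> corners" "1 \<le> i" "k < 2^i" using v by auto
  show ?thesis
  proof (cases "i = 1")
    case True
    then have "k = 0 \<or> k = 1" using a by auto
    then show ?thesis unfolding Dc True tri_def by (auto simp: dpt_def cmb_rot insert_commute)
  next
    case False
    then show ?thesis unfolding Dc tri_def using a
      by (cases "even k") (auto simp: insert_commute elim!: evenE oddE)
  qed
next
  case (Kc c)
  then have "c \<in> corners" using v by simp
  then have "c = c0 \<or> c = - c0 \<or> c = rot c0 \<or> c = - rot c0" by (rule corner_cases_c0)
  then show ?thesis unfolding Kc tri_def
    using c0_distinct by (auto simp: cmb_rot cmb_uminus insert_commute)
next
  case (Tc c)
  then show ?thesis using v unfolding tri_def by (auto simp: cmb_uminus insert_commute)
qed (auto simp: tri_def insert_commute)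

lemma col_bound: "col v < 4"
  by (cases v) auto

lemma not_par_same_col:
  assumes "v \<in> cells - {root}" "v' \<in> cells - {root}" "col v = col v'"
  shows "v \<noteq> par v'"
  using assms by (cases v'; cases v) (auto split: if_splits)

lemma par_inj_same_col:
  assumes v: "v \<in> cells - {root}" and v': "v' \<in> cells - {root}"
    and eq: "col v = col v'" "par v = par v'"
  shows "v = v'"
proof (cases v)
  case (Dc a i k)
  have "\<exists>a' i' k'. v' = Dc a' i' k'"
    using eq(2) Dc by (cases v') (auto split: if_splits)
  then obtain a' i' k' where D': "v' = Dc a' i' k'" by blast
  have ev: "even k \<longleftrightarrow> even k'" using eq(1) unfolding Dc D' by (auto split: if_splits)
  have ik: "i \<ge> 1" "i' \<ge> 1" "k < 2^i" "k' < 2^i'" using v v' Dc D' by auto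
  have k1: "i = 1 \<Longrightarrow> k = 0 \<or> k = 1" "i' = 1 \<Longrightarrow> k' = 0 \<or> k' = 1" using ik by auto
  have kk: "k div 2 = k' div 2 \<Longrightarrow> k = k'"
    using ev by (metis even_two_times_div_two odd_two_times_div_two_succ)
  have rot: "rot a = rot a' \<Longrightarrow> a = a'" by (metis rot_rot neg_equal_iff_equal)
  have ii: "i - 1 = i' - 1 \<Longrightarrow> i = i'" using ik by auto
  have par: "par (Dc a i k) = par (Dc a' i' k')" using eq(2) unfolding Dc D' .
  consider "i = 1" "i' = 1" | "i = 1" "i' \<noteq> 1" | "i \<noteq> 1" "i' = 1" | "i \<noteq> 1" "i' \<noteq> 1" by blast
  then have "a = a' \<and> i = i' \<and> k = k'"
  proof cases
    case 1
    have "k = k'" using k1(1)[OF 1(1)] k1(2)[OF 1(2)] ev by auto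
    moreover have "a = a'" using par 1 \<open>k = k'\<close> rot by (cases "k = 0") simp_all
    ultimately show ?thesis using 1 by simp
  next
    case 2
    then show ?thesis using par by (simp split: if_splits)
  next
    case 3
    then show ?thesis using par by (simp split: if_splits)
  next
    case 4
    then have "a = a' \<and> i - 1 = i' - 1 \<and> k div 2 = k' div 2"
      using par ev by (cases "even k") simp_all
    then show ?thesis using kk ii by blast
  qed
  then show ?thesis unfolding Dc D' by simp
next
  case (Kc c)
  have "\<exists>c'. v' = Kc c'" using eq v' Kc by (cases v') (auto split: if_splits)
  then obtain c' where K': "v' = Kc c'" by blast
  have "c \<in> corners" "c' \<in> corners" using v v' Kc K' by auto
  then have "c = c0 \<or> c = - c0 \<or> c = rot c0 \<or> c = - rot c0"
    "c' = c0 \<or> c' = - c0 \<or> c' = rot c0 \<or> c' = - rot c0" using corner_cases_c0 by auto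
  moreover have "(c = c0 \<or> c = - c0) \<longleftrightarrow> (c' = c0 \<or> c' = - c0)"
    using eq(1) unfolding Kc K' by (simp split: if_splits)
  moreover have "(c = c0 \<or> c = rot c0) \<longleftrightarrow> (c' = c0 \<or> c' = rot c0)"
    using eq(2) c0_distinct(1) unfolding Kc K' by (simp split: if_splits)
  ultimately have "c = c'" using c0_distinct by metis
  then show ?thesis unfolding Kc K' by simp
next
  case (Tc c)
  have "\<exists>c'. v' = Tc c'" using eq Tc by (cases v') (auto split: if_splits)
  then show ?thesis using v v' unfolding Tc by auto
next
  case (Lc a i k)
  then show ?thesis using eq by (cases v') (auto split: if_splits)
next
  case (Rc a i k)
  then show ?thesis using eq by (cases v') (auto split: if_splits)
qed

section \<open>Separating the triangles by linear functionals\<close>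

lemma interior_triangle_less:
  fixes f :: "real^2 \<Rightarrow> real"
  assumes "z \<in> interior (convex hull {p, q, r})" "linear f"
    and "f p \<le> c" "f q \<le> c" "f r \<le> c" "f p < c \<or> f q < c \<or> f r < c"
  shows "f z < c"
proof -
  obtain x y w where xyw: "0 < x" "0 < y" "0 < w" "x + y + w = 1" "z = x *\<^sub>R p + y *\<^sub>R q + w *\<^sub>R r"
    using interior_triangleE[OF assms(1)] by metis
  have fz: "f z = x * f p + y * f q + w * f r"
    unfolding xyw(5) by (simp add: linear_add[OF assms(2)] linear_scale[OF assms(2)])
  have "x * (c - f p) \<ge> 0" "y * (c - f q) \<ge> 0" "w * (c - f r) \<ge> 0"
    using xyw assms(3-5) by (intro mult_nonneg_nonneg; simp)+
  moreover have "x * (c - f p) > 0 \<or> y * (c - f q) > 0 \<or> w * (c - f r) > 0"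
    using xyw assms(6) by auto
  ultimately have "x * (c - f p) + y * (c - f q) + w * (c - f r) > 0" by argo
  moreover have "x * (c - f p) + y * (c - f q) + w * (c - f r) = (x + y + w) * c - f z"
    unfolding fz by (simp add: algebra_simps)
  ultimately show ?thesis using xyw(4) by simp
qed

lemma triangle_le:
  fixes f :: "real^2 \<Rightarrow> real"
  assumes "z \<in> convex hull {p, q, r}" "linear f" "f p \<le> c" "f q \<le> c" "f r \<le> c"
  shows "f z \<le> c"
proof -
  obtain x y w where xyw: "0 \<le> x" "0 \<le> y" "0 \<le> w" "x + y + w = 1" "z = x *\<^sub>R p + y *\<^sub>R q + w *\<^sub>R r"
    using assms(1) unfolding convex_hull_3 by blast
  have fz: "f z = x * f p + y * f q + w * f r"
    unfolding xyw(5) by (simp add: linear_add[OF assms(2)] linear_scale[OF assms(2)])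
  have "x * (c - f p) \<ge> 0" "y * (c - f q) \<ge> 0" "w * (c - f r) \<ge> 0"
    using xyw assms(3-5) by (intro mult_nonneg_nonneg; simp)+
  moreover have "x * (c - f p) + y * (c - f q) + w * (c - f r) = (x + y + w) * c - f z"
    unfolding fz by (simp add: algebra_simps)
  ultimately show ?thesis using xyw(4) by simp
qed

text \<open>The functional \<open>\<upsilon>\<close> is constant on the edge \<open>a b\<close> and
  separates its two sides.\<close>

lemma (in diamond) interiors_disjoint:
  "interior (convex hull {a, b, u}) \<inter> interior (convex hull {a, b, w}) = {}"
proof -
  have lin: "linear (\<lambda>z. \<upsilon> \<bullet> z)" by (intro linearI) (auto simp: inner_add_right)
  have lin': "linear (\<lambda>z. - (\<upsilon> \<bullet> z))" by (intro linearI) (auto simp: inner_add_right)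
  have v: "\<upsilon> \<bullet> a = \<upsilon> \<bullet> c" "\<upsilon> \<bullet> b = \<upsilon> \<bullet> c" "\<upsilon> \<bullet> u = \<upsilon> \<bullet> c + (1 - \<mu>)" "\<upsilon> \<bullet> w = \<upsilon> \<bullet> c - \<mu>"
  proof -
    have "\<upsilon> \<bullet> a = \<upsilon> \<bullet> (c - \<nu> *\<^sub>R (b - a))" "\<upsilon> \<bullet> b = \<upsilon> \<bullet> (c + (1 - \<nu>) *\<^sub>R (b - a))"
      "\<upsilon> \<bullet> u = \<upsilon> \<bullet> (c + (1 - \<mu>) *\<^sub>R (u - w))" "\<upsilon> \<bullet> w = \<upsilon> \<bullet> (c - \<mu> *\<^sub>R (u - w))"
      by (rule arg_cong[OF vertices(1)] arg_cong[OF vertices(2)] arg_cong[OF vertices(3)] arg_cong[OF vertices(4)])+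
    then show "\<upsilon> \<bullet> a = \<upsilon> \<bullet> c" "\<upsilon> \<bullet> b = \<upsilon> \<bullet> c" "\<upsilon> \<bullet> u = \<upsilon> \<bullet> c + (1 - \<mu>)" "\<upsilon> \<bullet> w = \<upsilon> \<bullet> c - \<mu>"
      unfolding inner_diff_right[of \<upsilon> c] inner_add_right[of \<upsilon> c] inner_scaleR_right dual_basis by simp_all
  qed
  have "\<upsilon> \<bullet> z > \<upsilon> \<bullet> c" if "z \<in> interior (convex hull {a, b, u})" for z
    using interior_triangle_less[OF that lin', of "- (\<upsilon> \<bullet> c)"] v mu by simp
  moreover have "\<upsilon> \<bullet> z < \<upsilon> \<bullet> c" if "z \<in> interior (convex hull {a, b, w})" for z
    using interior_triangle_less[OF that lin, of "\<upsilon> \<bullet> c"] v mu by simp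
  ultimately show ?thesis by fastforce
qed

lemma linear_coords:
  "linear (\<lambda>z. cx a z)" "linear (\<lambda>z. cy a z)" "linear (\<lambda>z. cs a z)"
  "linear (\<lambda>z. - cx a z)" "linear (\<lambda>z. - cs a z)"
  "linear (\<lambda>z. s * cs a z - cy a z)" "linear (\<lambda>z. cy a z - s * cs a z)"
  by (intro linearI; simp add: algebra_simps)+

text \<open>A closed trapezoid of the dissection for \<open>m = 1\<close>, described by a range of
  levels \<open>cs\<close> and of slopes \<open>cy / cs\<close>.\<close>

definition zone :: "real^2 \<Rightarrow> nat \<Rightarrow> nat \<Rightarrow> (real^2) set" where
  "zone a i k = {z. 1 - 1/2^i \<le> cs a z \<and> cs a z \<le> 1 - 1/2^(i+1) \<and>
     (real k/2^i) * cs a z \<le> cy a z \<and> cy a z \<le> (real (k+1)/2^i) * cs a z}"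

definition open_zone :: "real^2 \<Rightarrow> nat \<Rightarrow> nat \<Rightarrow> (real^2) set" where
  "open_zone a i k = {z. 1 - 1/2^i < cs a z \<and> cs a z < 1 - 1/2^(i+1) \<and>
     (real k/2^i) * cs a z < cy a z \<and> cy a z < (real (k+1)/2^i) * cs a z}"

lemma dpt_coords:
  assumes "a \<in> corners" "t = 1/2^i" "x = real k / 2^i"
  shows "cs a (dpt a i k) = 1 - t" "cy a (dpt a i k) = (1 - t) * x"
    "cs a (dpt a i (Suc k)) = 1 - t" "cy a (dpt a i (Suc k)) = (1 - t) * (x + t)"
    "cs a (dpt a (Suc i) (2*k)) = 1 - t/2" "cy a (dpt a (Suc i) (2*k)) = (1 - t/2) * x"
    "cs a (dpt a (Suc i) (Suc (2*k))) = 1 - t/2" "cy a (dpt a (Suc i) (Suc (2*k))) = (1 - t/2) * (x + t/2)"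
    "cs a (dpt a (Suc i) (Suc (Suc (2*k)))) = 1 - t/2" "cy a (dpt a (Suc i) (Suc (Suc (2*k)))) = (1 - t/2) * (x + t)"
proof -
  have co: "cs a (cmb a (r * (1 - q)) (r * q)) = r" "cy a (cmb a (r * (1 - q)) (r * q)) = r * q" for r q
    using assms(1) by (simp_all add: algebra_simps)
  show "cs a (dpt a i k) = 1 - t" "cy a (dpt a i k) = (1 - t) * x"
    "cs a (dpt a i (Suc k)) = 1 - t" "cy a (dpt a i (Suc k)) = (1 - t) * (x + t)"
    "cs a (dpt a (Suc i) (2*k)) = 1 - t/2" "cy a (dpt a (Suc i) (2*k)) = (1 - t/2) * x"
    "cs a (dpt a (Suc i) (Suc (2*k))) = 1 - t/2" "cy a (dpt a (Suc i) (Suc (2*k))) = (1 - t/2) * (x + t/2)"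
    "cs a (dpt a (Suc i) (Suc (Suc (2*k)))) = 1 - t/2" "cy a (dpt a (Suc i) (Suc (Suc (2*k)))) = (1 - t/2) * (x + t)"
    using dpt_refine[OF assms(2,3), of a 0] dpt_refine[OF assms(2,3), of a 1] dpt_refine[OF assms(2,3), of a 2]
    by (simp_all add: co del: cs_cmb)
qed

lemma zone_params:
  assumes "t = 1/2^i" "x = real k / 2^i"
  shows "zone a i k = {z. 1 - t \<le> cs a z \<and> cs a z \<le> 1 - t/2 \<and> x * cs a z \<le> cy a z \<and> cy a z \<le> (x + t) * cs a z}"
    and "open_zone a i k = {z. 1 - t < cs a z \<and> cs a z < 1 - t/2 \<and> x * cs a z < cy a z \<and> cy a z < (x + t) * cs a z}"
proof -
  have "1/2^(i+1) = t/2" "real (k+1)/2^i = x + t" unfolding assms by (simp_all add: add_divide_distrib)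
  then show "zone a i k = {z. 1 - t \<le> cs a z \<and> cs a z \<le> 1 - t/2 \<and> x * cs a z \<le> cy a z \<and> cy a z \<le> (x + t) * cs a z}"
    "open_zone a i k = {z. 1 - t < cs a z \<and> cs a z < 1 - t/2 \<and> x * cs a z < cy a z \<and> cy a z < (x + t) * cs a z}"
    unfolding zone_def open_zone_def by (simp_all only: assms[symmetric])
qed

lemma zone_tri:
  assumes a: "a \<in> corners" "1 \<le> i" "k < 2^i" and v: "v = Dc a i k \<or> v = Lc a i k \<or> v = Rc a i k"
  shows "tri v \<subseteq> zone a i k" "interior (tri v) \<subseteq> open_zone a i k"
proof -
  obtain t x where t: "0 < t" "t \<le> 1/2" "0 \<le> x" "x + t \<le> 1" "t = 1/2^i" "x = real k / 2^i"
    using dpt_level[OF a(2,3)] .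
  note co = dpt_coords[OF a(1) t(5,6)]
  have tr: "tri v = convex hull {ea v, eb v, eu v}" unfolding tri_def ..
  have tt: "t * t > 0" "t * t < t" using t(1,2) mult_strict_left_mono[of t 1 t] by simp_all
  show "tri v \<subseteq> zone a i k"
  proof
    fix z assume "z \<in> tri v"
    then have z: "z \<in> convex hull {ea v, eb v, eu v}" unfolding tr .
    have "- cs a z \<le> - (1 - t)" by (rule triangle_le[OF z linear_coords(5)]; ((use v in \<open>elim disjE\<close>); (simp add: co)?; (insert t(1-4) tt; argo)?))
    moreover have "cs a z \<le> 1 - t/2" by (rule triangle_le[OF z linear_coords(3)]; ((use v in \<open>elim disjE\<close>); (simp add: co)?; (insert t(1-4) tt; argo)?))
    moreover have "x * cs a z - cy a z \<le> 0"
      by (rule triangle_le[OF z linear_coords(6)]; ((use v in \<open>elim disjE\<close>); (simp add: co)?; (insert t(1-4) tt; argo)?))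
    moreover have "cy a z - (x + t) * cs a z \<le> 0"
      by (rule triangle_le[OF z linear_coords(7)]; ((use v in \<open>elim disjE\<close>); (simp add: co)?; (insert t(1-4) tt; argo)?))
    ultimately show "z \<in> zone a i k" unfolding zone_params[OF t(5,6)] by simp
  qed
  show "interior (tri v) \<subseteq> open_zone a i k"
  proof
    fix z assume "z \<in> interior (tri v)"
    then have z: "z \<in> interior (convex hull {ea v, eb v, eu v})" unfolding tr .
    have "- cs a z < - (1 - t)"
      by (rule interior_triangle_less[OF z linear_coords(5)]; ((use v in \<open>elim disjE\<close>); (simp add: co)?; (insert t(1-4) tt; argo)?))
    moreover have "cs a z < 1 - t/2"
      by (rule interior_triangle_less[OF z linear_coords(3)]; ((use v in \<open>elim disjE\<close>); (simp add: co)?; (insert t(1-4) tt; argo)?))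
    moreover have "x * cs a z - cy a z < 0"
      by (rule interior_triangle_less[OF z linear_coords(6)]; ((use v in \<open>elim disjE\<close>); (simp add: co)?; (insert t(1-4) tt; argo)?))
    moreover have "cy a z - (x + t) * cs a z < 0"
      by (rule interior_triangle_less[OF z linear_coords(7)]; ((use v in \<open>elim disjE\<close>); (simp add: co)?; (insert t(1-4) tt; argo)?))
    ultimately show "z \<in> open_zone a i k" unfolding zone_params[OF t(5,6)] by simp
  qed
qed

text \<open>The ray of slope \<open>x + t/2\<close>, which passes through the midpoint of the outer
  side, separates them.\<close>

lemma LR_disjoint:
  assumes a: "a \<in> corners" "1 \<le> i" "k < 2^i"
  shows "interior (tri (Lc a i k)) \<inter> interior (tri (Rc a i k)) = {}"
proof -
  obtain t x where t: "0 < t" "t \<le> 1/2" "0 \<le> x" "x + t \<le> 1" "t = 1/2^i" "x = real k / 2^i"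
    using dpt_level[OF a(2,3)] .
  note co = dpt_coords[OF a(1) t(5,6)]
  have tt: "t * t > 0" "t * t < t" using t(1,2) mult_strict_left_mono[of t 1 t] by simp_all
  have "cy a z - (x + t/2) * cs a z < 0" if z: "z \<in> interior (convex hull {ea (Lc a i k), eb (Lc a i k), eu (Lc a i k)})" for z
    by (rule interior_triangle_less[OF z linear_coords(7)]; ((simp add: co)?; (insert t(1-4) tt; argo)?))
  moreover have "(x + t/2) * cs a z - cy a z < 0" if z: "z \<in> interior (convex hull {ea (Rc a i k), eb (Rc a i k), eu (Rc a i k)})" for z
    by (rule interior_triangle_less[OF z linear_coords(6)]; ((simp add: co)?; (insert t(1-4) tt; argo)?))
  ultimately show ?thesis unfolding tri_def by fastforce
qed

lemma zone_coords:
  assumes "z \<in> zone a i k" "1 \<le> i" "k < 2^i"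
  shows "cx a z \<ge> 0" "cy a z \<ge> 0" "cs a z \<ge> 1/2"
proof -
  obtain t x where t: "0 < t" "t \<le> 1/2" "0 \<le> x" "x + t \<le> 1" "t = 1/2^i" "x = real k / 2^i"
    using dpt_level[OF assms(2,3)] .
  have z: "1 - t \<le> cs a z" "x * cs a z \<le> cy a z" "cy a z \<le> (x + t) * cs a z"
    using assms(1) unfolding zone_params[OF t(5,6)] by auto
  show s: "cs a z \<ge> 1/2" using z t by linarith
  show "cy a z \<ge> 0" using z(2) mult_nonneg_nonneg[OF t(3), of "cs a z"] s by linarith
  have "(x + t) * cs a z \<le> 1 * cs a z" using t s by (intro mult_right_mono) auto
  then show "cx a z \<ge> 0" using z cs_def[of a z] by linarith
qed

lemma open_zone_coords:
  assumes "z \<in> open_zone a i k" "1 \<le> i" "k < 2^i"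
  shows "cx a z > 0" "cy a z > 0" "cs a z > 1/2"
proof -
  obtain t x where t: "0 < t" "t \<le> 1/2" "0 \<le> x" "x + t \<le> 1" "t = 1/2^i" "x = real k / 2^i"
    using dpt_level[OF assms(2,3)] .
  have z: "1 - t < cs a z" "x * cs a z < cy a z" "cy a z < (x + t) * cs a z"
    using assms(1) unfolding zone_params[OF t(5,6)] by auto
  show s: "cs a z > 1/2" using z t by linarith
  show "cy a z > 0" using z(2) mult_nonneg_nonneg[OF t(3), of "cs a z"] s by linarith
  have "(x + t) * cs a z \<le> 1 * cs a z" using t s by (intro mult_right_mono) auto
  then show "cx a z > 0" using z cs_def[of a z] by linarith
qed

lemma open_zone_unique:
  assumes "z \<in> open_zone a i k" "1 \<le> i" "k < 2^i" "a \<in> corners"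
    and "z \<in> open_zone a' i' k'" "1 \<le> i'" "k' < 2^i'" "a' \<in> corners"
  shows "a' = a \<and> i' = i \<and> k' = k"
proof -
  note c = open_zone_coords[OF assms(1-3)] and c' = open_zone_coords[OF assms(5-7)]
  have a: "a' = a" using corner_unique[OF assms(4,8) c(1,2) c'(1,2)] .
  have lvl: "i' \<le> i" if "1 - 1/2^i' < cs a z" "cs a z < 1 - 1/2^(i+1)" for i i'
  proof (rule ccontr)
    assume "\<not> i' \<le> i"
    then have "(2::real)^(i+1) \<le> 2^i'" by (intro power_increasing) auto
    then have "1/2^i' \<le> (1::real)/2^(i+1)" by (intro divide_left_mono) auto
    then show False using that by linarith
  qed
  have i: "i' = i" using lvl[of i' i] lvl[of i i'] assms(1,5) unfolding open_zone_def a by auto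
  have col: "k' \<le> k" if "(real k'/2^i) * cs a z < cy a z" "cy a z < (real (k+1)/2^i) * cs a z" for k k'
  proof (rule ccontr)
    assume "\<not> k' \<le> k"
    then have "real (k+1)/2^i \<le> real k'/2^i" by (intro divide_right_mono) auto
    then have "(real (k+1)/2^i) * cs a z \<le> (real k'/2^i) * cs a z" using c(3) by (intro mult_right_mono) auto
    then show False using that by linarith
  qed
  have "k' = k" using col[of k' k] col[of k k'] assms(1,5) unfolding open_zone_def a i by auto
  then show ?thesis using a i by simp
qed

text \<open>In its own quarter \<open>cs a\<close> is the largest of the four functionals, so it
  equals the maximum norm there.\<close>

lemma cs_corner_le:
  assumes "a \<in> corners" "a' \<in> corners" "cx a z \<ge> 0" "cy a z \<ge> 0"
  shows "cs a' z \<le> cs a z"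
  using corner_cases[OF assms(1,2)] assms(3,4) by (auto simp: cs_def rot_coords)

lemma cs_cmb_corners:
  assumes "c \<in> corners" "a \<in> corners" "\<bar>x\<bar> + \<bar>y\<bar> \<le> s"
  shows "cs a (cmb c x y) \<le> s"
  using corner_cases[OF assms(1,2)] assms(1,3) by (auto simp: cs_def rot_coords)

lemma center_tri_cs:
  assumes "v = Kc c \<or> v = Tc c" "c \<in> corners" "z \<in> tri v" "a \<in> corners"
  shows "cs a z \<le> 1/2"
proof -
  have z: "z \<in> convex hull {ea v, eb v, eu v}" using assms(3) unfolding tri_def .
  show ?thesis
    by (rule triangle_le[OF z linear_coords(3)];
        (use assms(1) in \<open>elim disjE\<close>); simp only: ea.simps eb.simps eu.simps;
        rule cs_cmb_corners[OF assms(2,4)]; simp)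
qed

lemma Kc_interior: "c \<in> corners \<Longrightarrow> z \<in> interior (tri (Kc c)) \<Longrightarrow> cx c z > 1/4"
  unfolding tri_def by (drule interior_triangle_less[OF _ linear_coords(4), where c = "- 1/4"]) auto

text \<open>For every corner \<open>a\<close>, the line where \<open>cx a\<close> is 1/4 supports
  the central diamond, while the corner triangle \<open>Kc a\<close> lies beyond it.\<close>

lemma Tc_interior:
  assumes "c \<in> corners" "a \<in> corners" "z \<in> interior (tri (Tc c))"
  shows "cx a z < 1/4"
proof -
  have z: "z \<in> interior (convex hull {ea (Tc c), eb (Tc c), eu (Tc c)})" using assms(3) unfolding tri_def .
  show ?thesis
    by (rule interior_triangle_less[OF z linear_coords(1)])
       (use corner_cases[OF assms(1,2)] assms(1) in \<open>auto simp: rot_coords\<close>)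
qed

lemma Kc_disjoint:
  assumes c: "c \<in> corners" "c' \<in> corners" and z: "z \<in> interior (tri (Kc c))" "z \<in> interior (tri (Kc c'))"
  shows "c' = c"
proof -
  have 1: "cx c z > 1/4" "cx c' z > 1/4" using Kc_interior c z by auto
  have "z \<in> tri (Kc c)" using z interior_subset by blast
  then have 2: "cs a z \<le> 1/2" if "a \<in> corners" for a
    using center_tri_cs[of "Kc c" c z a] c that by simp
  show ?thesis using corner_cases[OF c] 1 2[of c] 2[of c'] c by (auto simp: cs_def rot_coords)
qed

lemma child_disjoint:
  assumes "v \<in> cells - {root}"
  shows "interior (tri v) \<inter> interior (tri (par v)) = {}"
proof -
  have "diamond (ea v) (eb v) (eu v) (ew v) (lam v) (mu v)"
    using fat_diamond_cell[OF assms] unfolding fat_diamond_def by blast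
  then show ?thesis unfolding tri_par[OF assms] unfolding tri_def by (rule diamond.interiors_disjoint)
qed

fun zone_index :: "cell \<Rightarrow> ((real^2) \<times> nat \<times> nat) option" where
  "zone_index (Dc a i k) = Some (a, i, k)"
| "zone_index (Lc a i k) = Some (a, i, k)"
| "zone_index (Rc a i k) = Some (a, i, k)"
| "zone_index (Kc c) = None"
| "zone_index (Tc c) = None"

lemma zone_index_Some:
  assumes "v \<in> cells" "zone_index v = Some (a, i, k)"
  shows "a \<in> corners" "1 \<le> i" "k < 2^i" "v = Dc a i k \<or> v = Lc a i k \<or> v = Rc a i k"
  using assms by (cases v; auto)+

lemma zone_index_None:
  assumes "v \<in> cells" "zone_index v = None"
  obtains c where "c \<in> corners" "v = Kc c \<or> v = Tc c"
proof -
  have "\<exists>c. c \<in> corners \<and> (v = Kc c \<or> v = Tc c)" using assms by (cases v) auto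
  then show thesis using that by blast
qed

text \<open>Different trapezoids have disjoint interiors, and so have a trapezoid and the central
  square. Inside one trapezoid, every pair other than the two outer triangles consists of a child
  and its parent.\<close>

lemma tri_disjoint:
  assumes v: "v \<in> cells" and v': "v' \<in> cells" and ne: "v \<noteq> v'"
  shows "interior (tri v) \<inter> interior (tri v') = {}"
proof (rule ccontr)
  assume "\<not> ?thesis"
  then obtain z where z: "z \<in> interior (tri v)" "z \<in> interior (tri v')" by blast
  have half: "zone_index u = None \<Longrightarrow> u \<in> cells \<Longrightarrow> z \<in> interior (tri u) \<Longrightarrow> a \<in> corners \<Longrightarrow> cs a z \<le> 1/2" for u a
    using zone_index_None center_tri_cs interior_subset by (metis subsetD)
  have some: "z \<in> open_zone a i k" if "u \<in> cells" "zone_index u = Some (a, i, k)" "z \<in> interior (tri u)" for u a i k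
    using zone_tri(2)[OF zone_index_Some[OF that(1,2)]] that(3) by blast
  have mixed: False if u: "u \<in> cells" "zone_index u = Some (a, i, k)" "z \<in> interior (tri u)"
    and u': "zone_index u' = None" "u' \<in> cells" "z \<in> interior (tri u')" for u u' a i k
    using open_zone_coords(3)[OF some[OF u]] zone_index_Some[OF u(1,2)] half[OF u', of a] by auto
  show False
  proof (cases "zone_index v")
    case None
    show False
    proof (cases "zone_index v'")
      case None': None
      obtain c where c: "c \<in> corners" "v = Kc c \<or> v = Tc c" using zone_index_None[OF v None] .
      obtain c' where c': "c' \<in> corners" "v' = Kc c' \<or> v' = Tc c'" using zone_index_None[OF v' None'] .
      from c(2) c'(2) show False
      proof (elim disjE)
        assume "v = Kc c" "v' = Kc c'"
        then show False using Kc_disjoint[OF c(1) c'(1)] z ne by auto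
      next
        assume vv: "v = Kc c" "v' = Tc c'"
        then show False using Kc_interior[OF c(1)] Tc_interior[OF c'(1) c(1)] z by force
      next
        assume "v = Tc c" "v' = Kc c'"
        then show False using Kc_interior[OF c'(1)] Tc_interior[OF c(1) c'(1)] z by force
      next
        assume vv: "v = Tc c" "v' = Tc c'"
        then have "(v = Tc c0 \<and> v' = root) \<or> (v = root \<and> v' = Tc c0)" using v v' ne by auto
        then show False using child_disjoint[of "Tc c0"] z c0_distinct(1) by auto
      qed
    next
      case (Some p)
      then show False using mixed[OF v' _ z(2) None v z(1)] by (cases p) auto
    qed
  next
    case (Some p)
    obtain a i k where p: "p = (a, i, k)" by (cases p)
    show False
    proof (cases "zone_index v'")
      case None
      then show False using mixed[OF v _ z(1) None v' z(2)] Some p by auto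
    next
      case Some': (Some p')
      obtain a' i' k' where p': "p' = (a', i', k')" by (cases p')
      note V = zone_index_Some[OF v Some[unfolded p]] and V' = zone_index_Some[OF v' Some'[unfolded p']]
      have "a' = a \<and> i' = i \<and> k' = k"
        by (rule open_zone_unique[OF some[OF v Some[unfolded p] z(1)] V(2,3,1) some[OF v' Some'[unfolded p'] z(2)] V'(2,3,1)])
      then have eq: "v' = Dc a i k \<or> v' = Lc a i k \<or> v' = Rc a i k" using V'(4) by simp
      have "Lc a i k \<in> cells - {root}" "Rc a i k \<in> cells - {root}" using V by auto
      then have "interior (tri (Lc a i k)) \<inter> interior (tri (Dc a i k)) = {}"
        "interior (tri (Rc a i k)) \<inter> interior (tri (Dc a i k)) = {}"
        using child_disjoint by (metis par.simps)+
      moreover have "interior (tri (Lc a i k)) \<inter> interior (tri (Rc a i k)) = {}" by (rule LR_disjoint[OF V(1-3)])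
      ultimately show False using eq V(4) z ne by blast
    qed
  qed
qed

section \<open>Covering the open square\<close>

lemma zone_subset_tri:
  assumes a: "a \<in> corners" "1 \<le> i" "k < 2^i"
  shows "zone a i k \<subseteq> tri (Dc a i k) \<union> tri (Lc a i k) \<union> tri (Rc a i k)"
proof
  fix z assume zone: "z \<in> zone a i k"
  obtain t x where t: "0 < t" "t \<le> 1/2" "0 \<le> x" "x + t \<le> 1" "t = 1/2^i" "x = real k / 2^i"
    using dpt_level[OF a(2,3)] .
  define X Y where "X = cx a z" and "Y = cy a z"
  have z: "z = cmb a X Y" unfolding X_def Y_def using cmb_cx_cy[OF a(1)] by simp
  have zz: "1 - t \<le> X + Y" "X + Y \<le> 1 - t/2" "x * (X + Y) \<le> Y" "Y \<le> (x + t) * (X + Y)"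
    using zone unfolding zone_params[OF t(5,6)] X_def Y_def cs_def by auto
  define P0 P1 R0 R1 R2 where
    "P0 = cmb a ((1-t) * (1-x)) ((1-t) * x)" and "P1 = cmb a ((1-t) * (1-(x+t))) ((1-t) * (x+t))" and
    "R0 = cmb a ((1-t/2) * (1-x)) ((1-t/2) * x)" and "R1 = cmb a ((1-t/2) * (1-(x+t/2))) ((1-t/2) * (x+t/2))" and
    "R2 = cmb a ((1-t/2) * (1-(x+t))) ((1-t/2) * (x+t))"
  note defs = P0_def P1_def R0_def R1_def R2_def
  have pts: "dpt a i k = P0" "dpt a i (Suc k) = P1" "dpt a (Suc i) (2*k) = R0"
    "dpt a (Suc i) (Suc (2*k)) = R1" "dpt a (Suc i) (Suc (Suc (2*k))) = R2"
    using dpt_refine[OF t(5,6), of a 0] dpt_refine[OF t(5,6), of a 1] dpt_refine[OF t(5,6), of a 2]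
    unfolding defs by simp_all
  have D: "tri (Dc a i k) = convex hull {P0, R1, P1}" and L: "tri (Lc a i k) = convex hull {P0, R0, R1}"
    and R: "tri (Rc a i k) = convex hull {P1, R1, R2}"
    unfolding tri_def by (simp_all add: pts insert_commute)
  \<comment> \<open>Each product is a nonnegative factor times the slack in one of the four
    inequalities of the zone.\<close>
  have c: "cross2 (R0 - z) (R1 - z) = (1-t/2) * t * ((1-t/2) - (X + Y))"
    "cross2 (R1 - z) (R2 - z) = (1-t/2) * t * ((1-t/2) - (X + Y))"
    "cross2 (P0 - z) (R0 - z) = t * (Y - x * (X + Y))"
    "cross2 (R2 - z) (P1 - z) = t * ((x + t) * (X + Y) - Y)"
    "cross2 (P1 - z) (P0 - z) = 2 * ((1-t) * t) * ((X + Y) - (1-t))"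
    unfolding z defs cmb_simps cross2_cmb[OF a(1)] by (simp_all add: field_simps)
  have d: "cross2 (R0 - P0) (R1 - P0) = (1-t/2) * t * (t/2)"
    "cross2 (R1 - P0) (P1 - P0) = (1-t) * t * t" "cross2 (R1 - P1) (R2 - P1) = (1-t/2) * t * (t/2)"
    unfolding defs cmb_simps cross2_cmb[OF a(1)] by (simp_all add: field_simps)
  have nn: "cross2 (R0 - z) (R1 - z) \<ge> 0" "cross2 (R1 - z) (R2 - z) \<ge> 0" "cross2 (P0 - z) (R0 - z) \<ge> 0"
    "cross2 (R2 - z) (P1 - z) \<ge> 0" "cross2 (P1 - z) (P0 - z) \<ge> 0"
    unfolding c by (intro mult_nonneg_nonneg; use t(1-4) zz in linarith)+
  have pos: "cross2 (R0 - P0) (R1 - P0) > 0" "cross2 (R1 - P0) (P1 - P0) > 0" "cross2 (R1 - P1) (R2 - P1) > 0"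
    unfolding d by (intro mult_pos_pos; use t(1-4) in linarith)+
  have cm: "cross2 (R1 - z) (P0 - z) = - cross2 (P0 - z) (R1 - z)" "cross2 (R1 - z) (P1 - z) = - cross2 (P1 - z) (R1 - z)"
    by (rule cross2_commute)+
  \<comment> \<open>The position of \<open>z\<close> relative to the two cuts \<open>P0 R1\<close>
    and \<open>P1 R1\<close> decides which triangle contains it.\<close>
  consider "cross2 (P0 - z) (R1 - z) \<le> 0" | "cross2 (P1 - z) (R1 - z) \<ge> 0"
    | "cross2 (P0 - z) (R1 - z) \<ge> 0" "cross2 (P1 - z) (R1 - z) \<le> 0" by linarith
  then show "z \<in> tri (Dc a i k) \<union> tri (Lc a i k) \<union> tri (Rc a i k)"
  proof cases
    case 1
    then have "z \<in> tri (Lc a i k)" unfolding L using in_triangle_cross2[OF pos(1), of z] nn cm by simp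
    then show ?thesis by blast
  next
    case 2
    then have "z \<in> tri (Rc a i k)" unfolding R using in_triangle_cross2[OF pos(3), of z] nn by simp
    then show ?thesis by blast
  next
    case 3
    then have "z \<in> tri (Dc a i k)" unfolding D using in_triangle_cross2[OF pos(2), of z] nn cm by simp
    then show ?thesis by blast
  qed
qed

lemma in_Kc:
  assumes c: "c \<in> corners" and z: "cx c z \<ge> 1/4" "cx c z + cy c z \<le> 1/2" "cx c z - cy c z \<le> 1/2"
  shows "z \<in> tri (Kc c)"
proof -
  define X Y where "X = cx c z" and "Y = cy c z"
  have zz: "z = cmb c X Y" unfolding X_def Y_def using cmb_cx_cy[OF c] by simp
  have "z \<in> convex hull {cmb c (1/4) (-1/4), cmb c (1/2) 0, cmb c (1/4) (1/4)}"
    by (rule in_triangle_cross2; unfold zz cmb_simps cross2_cmb[OF c])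
       (use z in \<open>simp_all add: X_def[symmetric] Y_def[symmetric] field_simps\<close>)
  then show ?thesis unfolding tri_def by (simp add: insert_commute)
qed

lemma in_Tc:
  assumes c: "c \<in> corners" and z: "cx c z \<le> 1/4" "cy c z \<le> 1/4" "cx c z + cy c z \<ge> 0"
  shows "z \<in> tri (Tc c)"
proof -
  define X Y where "X = cx c z" and "Y = cy c z"
  have zz: "z = cmb c X Y" unfolding X_def Y_def using cmb_cx_cy[OF c] by simp
  have "z \<in> convex hull {cmb c (1/4) (-1/4), cmb c (1/4) (1/4), cmb c (-1/4) (1/4)}"
    by (rule in_triangle_cross2; unfold zz cmb_simps cross2_cmb[OF c])
       (use z in \<open>simp_all add: X_def[symmetric] Y_def[symmetric] field_simps\<close>)
  then show ?thesis unfolding tri_def by (simp add: insert_commute)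
qed

text \<open>In the quarter containing \<open>z\<close>, a coordinate of at least 1/4 leads to a
  corner triangle. Otherwise \<open>z\<close> lies in the central diamond, which the sign of
  \<open>cs c0\<close> halves.\<close>

lemma center_cover:
  assumes "\<And>a. a \<in> corners \<Longrightarrow> cs a z \<le> 1/2"
  shows "\<exists>v\<in>{Kc c | c. c \<in> corners} \<union> {Tc c0, Tc (- c0)}. z \<in> tri v"
proof -
  obtain a where a: "a \<in> corners" "cx a z \<ge> 0" "cy a z \<ge> 0" using corner_exists by blast
  have s: "cx a z + cy a z \<le> 1/2" using assms[OF a(1)] unfolding cs_def .
  consider "cx a z \<ge> 1/4" | "cy a z \<ge> 1/4" | "cx a z \<le> 1/4" "cy a z \<le> 1/4" by linarith
  then show ?thesis
  proof cases
    case 1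
    then have "z \<in> tri (Kc a)" using in_Kc[OF a(1)] s a(3) by simp
    then show ?thesis using a(1) by blast
  next
    case 2
    then have "z \<in> tri (Kc (rot a))" using in_Kc[of "rot a"] s a by (simp add: rot_coords)
    then show ?thesis using a(1) rot_corners by blast
  next
    case 3
    then have "\<bar>cx c z\<bar> \<le> 1/4 \<and> \<bar>cy c z\<bar> \<le> 1/4" if "c \<in> corners" for c
      using corner_cases[OF a(1) that] a(2,3) by (auto simp: rot_coords)
    from this[OF c0_corner] have b: "cx c0 z \<le> 1/4" "cy c0 z \<le> 1/4" "- cx c0 z \<le> 1/4" "- cy c0 z \<le> 1/4"
      by linarith+
    have "z \<in> tri (Tc c0) \<or> z \<in> tri (Tc (- c0))"
    proof (cases "cx c0 z + cy c0 z \<ge> 0")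
      case True
      then show ?thesis using in_Tc[OF c0_corner b(1,2)] by blast
    next
      case False
      have "z \<in> tri (Tc (- c0))"
      proof (rule in_Tc)
        show "cx (- c0) z \<le> 1/4" unfolding rot_coords using b(3) .
        show "cy (- c0) z \<le> 1/4" unfolding rot_coords using b(4) .
        show "0 \<le> cx (- c0) z + cy (- c0) z" unfolding rot_coords using False by linarith
      qed simp
      then show ?thesis by blast
    qed
    then show ?thesis by blast
  qed
qed

lemma level_exists:
  fixes s :: real
  assumes "1/2 < s" "s < 1"
  obtains i :: nat where "1 \<le> i" "1 - 1/2^i \<le> s" "s \<le> 1 - 1/2^(i+1)"
proof -
  let ?P = "\<lambda>n. s \<le> 1 - 1/2^(n+1)"
  obtain n where "(1/2)^n < 1 - s" using real_arch_pow_inv[of "1 - s" "1/2"] assms by auto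
  moreover have "(1/2)^(n+1) \<le> (1/2::real)^n" by (intro power_decreasing) auto
  ultimately have ex: "?P n" by (simp add: power_one_over field_simps)
  define i where "i = (LEAST n. ?P n)"
  have i: "?P i" unfolding i_def by (rule LeastI[of ?P, OF ex])
  have "i \<noteq> 0" using i assms by (cases i) auto
  then obtain j where j: "i = Suc j" by (cases i) auto
  have "\<not> ?P j" using not_less_Least[of j ?P] j unfolding i_def by auto
  then have "1 - 1/2^i \<le> s" using j by simp
  then show thesis using that[of i] i \<open>i \<noteq> 0\<close> by simp
qed

lemma zone_exists:
  assumes a: "a \<in> corners" "cx a z \<ge> 0" "cy a z \<ge> 0" and s: "1/2 < cs a z" "cs a z < 1"
  obtains i k where "1 \<le> i" "k < 2^i" "z \<in> zone a i k"
proof -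
  obtain i where i: "1 \<le> i" "1 - 1/2^i \<le> cs a z" "cs a z \<le> 1 - 1/2^(i+1)"
    using level_exists[OF s] .
  define p where "p = 2^i * cy a z / cs a z"
  have p0: "0 \<le> p" unfolding p_def using a s by simp
  have p1: "p \<le> 2^i" unfolding p_def using a s by (simp add: cs_def field_simps)
  have "\<exists>k<2^i. real k \<le> p \<and> p \<le> real (k + 1)"
  proof (cases "p < 2^i")
    case True
    define k where "k = nat \<lfloor>p\<rfloor>"
    have k: "real k \<le> p" "p \<le> real (k + 1)" unfolding k_def using p0 by linarith+
    have "real k < 2^i" using k True by linarith
    then have "k < 2^i" by (metis of_nat_less_iff of_nat_numeral of_nat_power)
    then show ?thesis using k by blast
  next
    case False
    \<comment> \<open>This is the ray through \<open>rot a\<close>: the floor of \<open>p\<close> is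
      not an admissible index, and the last trapezoid is taken.\<close>
    then have "p = 2^i" using p1 by simp
    moreover have "real (2^i - 1) + 1 = 2^i" by (simp add: of_nat_diff)
    ultimately show ?thesis by (intro exI[of _ "2^i - 1"]) auto
  qed
  then obtain k where k: "k < 2^i" "real k \<le> p" "p \<le> real (k + 1)" by blast
  have e: "cy a z = p / 2^i * cs a z" unfolding p_def using s by simp
  have "z \<in> zone a i k"
    unfolding zone_def mem_Collect_eq e using i k s
    by (intro conjI mult_right_mono divide_right_mono) (auto simp: e)
  then show thesis using that i(1) k(1) by blast
qed

lemma interior_B: "interior (csquare 1) = {z. \<forall>a\<in>corners. cs a z < 1}"
  by (rule interior_csquare)

lemma tri_cs_less:
  assumes "v \<in> cells" "z \<in> tri v" "a' \<in> corners"
  shows "case zone_index v of None \<Rightarrow> cs a' z \<le> 1/2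
    | Some (a, i, k) \<Rightarrow> cs a' z \<le> 1 - 1/2^(i+1) \<and> 1 - 1/2^i \<le> cs a z"
proof (cases "zone_index v")
  case None
  then obtain c where "c \<in> corners" "v = Kc c \<or> v = Tc c" using zone_index_None[OF assms(1)] by blast
  then show ?thesis using None center_tri_cs[of v c z a'] assms by simp
next
  case (Some p)
  obtain a i k where p: "p = (a, i, k)" by (cases p)
  note V = zone_index_Some[OF assms(1) Some[unfolded p]]
  have z: "z \<in> zone a i k" using zone_tri(1)[OF V] assms(2) by blast
  have "cs a' z \<le> cs a z" using cs_corner_le[OF V(1) assms(3)] zone_coords[OF z V(2,3)] by blast
  then show ?thesis using z unfolding Some p zone_def by auto
qed

lemma cover_cells: "(\<Union>v\<in>cells. tri v) = interior (csquare 1)"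
proof
  show "(\<Union>v\<in>cells. tri v) \<subseteq> interior (csquare 1)"
  proof
    fix z assume "z \<in> (\<Union>v\<in>cells. tri v)"
    then obtain v where v: "v \<in> cells" "z \<in> tri v" by blast
    have "cs a z < 1" if "a \<in> corners" for a
    proof (cases "zone_index v")
      case None
      then show ?thesis using tri_cs_less[OF v that] by simp
    next
      case (Some p)
      obtain a' i k where p: "p = (a', i, k)" by (cases p)
      have "(0::real) < 1/2^(i+1)" by simp
      moreover have "cs a z \<le> 1 - 1/2^(i+1)" using tri_cs_less[OF v that] unfolding Some p by simp
      ultimately show ?thesis by linarith
    qed
    then show "z \<in> interior (csquare 1)" unfolding interior_B by blast
  qed
  show "interior (csquare 1) \<subseteq> (\<Union>v\<in>cells. tri v)"
  proof
    fix z assume z: "z \<in> interior (csquare 1)"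
    obtain a where a: "a \<in> corners" "cx a z \<ge> 0" "cy a z \<ge> 0" using corner_exists by blast
    have s: "cs a z < 1" using z a(1) unfolding interior_B by blast
    show "z \<in> (\<Union>v\<in>cells. tri v)"
    proof (cases "1/2 < cs a z")
      case True
      then obtain i k where ik: "1 \<le> i" "k < 2^i" "z \<in> zone a i k" using zone_exists[OF a _ s] by blast
      have "Dc a i k \<in> cells" "Lc a i k \<in> cells" "Rc a i k \<in> cells" using a ik by auto
      then show ?thesis using zone_subset_tri[OF a(1) ik(1,2)] ik(3) by blast
    next
      case False
      then have "cs a' z \<le> 1/2" if "a' \<in> corners" for a' using cs_corner_le[OF a(1) that a(2,3)] by linarith
      then obtain v where "v \<in> {Kc c | c. c \<in> corners} \<union> {Tc c0, Tc (- c0)}" "z \<in> tri v"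
        using center_cover by blast
      moreover from this have "v \<in> cells" by auto
      ultimately show ?thesis by blast
    qed
  qed
qed

section \<open>Countability and local finiteness\<close>

lemma finite_low_cells:
  "finite {v \<in> cells. case zone_index v of None \<Rightarrow> True | Some (a, i, k) \<Rightarrow> i < n}" (is "finite ?S")
proof -
  let ?I = "corners \<times> {..n} \<times> {..2^n}"
  have "?S \<subseteq> (\<lambda>(a, i, k). Dc a i k) ` ?I \<union> (\<lambda>(a, i, k). Lc a i k) ` ?I \<union> (\<lambda>(a, i, k). Rc a i k) ` ?I
     \<union> Kc ` corners \<union> {Tc c0, Tc (- c0)}" (is "_ \<subseteq> ?T")
  proof
    fix v assume v: "v \<in> ?S"
    have pw: "k \<le> 2^n" if "k < 2^i" "i < n" for k i :: nat
      using that power_increasing[of i n "2::nat"] by linarith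
    show "v \<in> ?T"
      using v pw by (cases v) (force simp: image_iff)+
  qed
  moreover have "finite ?T" using finite_corners by simp
  ultimately show ?thesis using finite_subset by blast
qed

lemma countable_cells: "countable cells"
proof -
  have "cells \<subseteq> (\<Union>n. {v \<in> cells. case zone_index v of None \<Rightarrow> True | Some (a, i, k) \<Rightarrow> i < n})"
  proof
    fix v assume v: "v \<in> cells"
    show "v \<in> (\<Union>n. {v \<in> cells. case zone_index v of None \<Rightarrow> True | Some (a, i, k) \<Rightarrow> i < n})"
    proof (cases "zone_index v")
      case None then show ?thesis using v by simp
    next
      case (Some p)
      obtain a i k where "p = (a, i, k)" by (cases p)
      then show ?thesis using v Some by (intro UN_I[of "i + 1"]) auto
    qed
  qed
  moreover have "countable (\<Union>n. {v \<in> cells. case zone_index v of None \<Rightarrow> True | Some (a, i, k) \<Rightarrow> i < n})"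
    using finite_low_cells by (intro countable_UN) (auto intro: countable_finite)
  ultimately show ?thesis using countable_subset by blast
qed

lemma open_cs_less: "open {z. \<forall>a\<in>corners. cs a z < r}"
proof -
  have "continuous_on UNIV (\<lambda>z. cs a z)" for a
    using linear_coords(3)[of a] linear_continuous_on linear_conv_bounded_linear by blast
  then have "open {z. cs a z < r}" for a
    by (intro open_Collect_less) (auto intro: continuous_on_subset)
  then have "open (\<Inter>a\<in>corners. {z. cs a z < r})" using finite_corners by (intro open_INT) auto
  moreover have "{z. \<forall>a\<in>corners. cs a z < r} = (\<Inter>a\<in>corners. {z. cs a z < r})" by auto
  ultimately show ?thesis by simp
qed

text \<open>A point of the open square lies in an open square of radius \<open>1 - 1/2^n\<close> for
  some \<open>n\<close>, and this meets only central triangles and those of level below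
  \<open>n\<close>.\<close>

lemma locally_finite_cells: "locally_finite_in (top_of_set (interior (csquare 1))) (tri ` cells)"
  unfolding locally_finite_in_def
proof (intro conjI ballI)
  show "\<Union>(tri ` cells) \<subseteq> topspace (top_of_set (interior (csquare 1)))" using cover_cells by simp
  fix z assume "z \<in> topspace (top_of_set (interior (csquare 1)))"
  then have z: "cs a z < 1" if "a \<in> corners" for a using that unfolding interior_B by simp
  define m where "m = Max ((\<lambda>a. cs a z) ` corners)"
  have "corners \<noteq> {}" by (auto simp: corners_def)
  then have "m < 1" unfolding m_def using z finite_corners by (subst Max_less_iff) auto
  then obtain n where n: "(1/2)^n < 1 - m" using real_arch_pow_inv[of "1 - m" "1/2"] by auto
  have mz: "cs a z \<le> m" if "a \<in> corners" for a
    unfolding m_def using that finite_corners by (intro Max_ge) auto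
  let ?W = "{z. \<forall>a\<in>corners. cs a z < 1 - 1/2^n}"
  have sub: "?W \<subseteq> interior (csquare 1)" unfolding interior_B by (auto simp: less_le_trans)
  have "openin (top_of_set (interior (csquare 1))) ?W"
    using open_cs_less[of "1 - 1/2^n"] sub by (intro openin_open_eq[THEN iffD2]) auto
  moreover have "z \<in> ?W" using mz n by (force simp: power_one_over)
  moreover have "{U \<in> tri ` cells. U \<inter> ?W \<noteq> {}} \<subseteq>
      tri ` {v \<in> cells. case zone_index v of None \<Rightarrow> True | Some (a, i, k) \<Rightarrow> i < n}"
  proof
    fix U assume "U \<in> {U \<in> tri ` cells. U \<inter> ?W \<noteq> {}}"
    then obtain v y where v: "v \<in> cells" "U = tri v" "y \<in> tri v" "y \<in> ?W" by blast
    have "case zone_index v of None \<Rightarrow> True | Some (a, i, k) \<Rightarrow> i < n"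
    proof (cases "zone_index v")
      case None then show ?thesis by simp
    next
      case (Some p)
      obtain a i k where p: "p = (a, i, k)" by (cases p)
      have a: "a \<in> corners" using zone_index_Some(1)[OF v(1) Some[unfolded p]] .
      have "1 - 1/2^i \<le> cs a y" using tri_cs_less[OF v(1,3) a] Some p by simp
      moreover have "cs a y < 1 - 1/2^n" using v(4) a by blast
      ultimately have "(1::real)/2^n < 1/2^i" by linarith
      then have "(2::real)^i < 2^n" by (simp add: field_simps)
      then show ?thesis using Some p by simp
    qed
    then show "U \<in> tri ` {v \<in> cells. case zone_index v of None \<Rightarrow> True | Some (a, i, k) \<Rightarrow> i < n}"
      using v by blast
  qed
  then have "finite {U \<in> tri ` cells. U \<inter> ?W \<noteq> {}}"
    using finite_low_cells finite_subset by (metis (no_types, lifting) finite_imageI)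
  ultimately show "\<exists>V. openin (top_of_set (interior (csquare 1))) V \<and> z \<in> V \<and> finite {U \<in> tri ` cells. U \<inter> V \<noteq> {}}"
    by (intro exI[of _ ?W] conjI)
qed

lemma interior_tri_ne:
  assumes "v \<in> cells"
  shows "interior (tri v) \<noteq> {}"
proof -
  have conv: "convex (tri v)" unfolding tri_def by simp
  have "measure lebesgue (tri v) > 0"
  proof (cases "v = root")
    case False
    then have v: "v \<in> cells - {root}" using assms by simp
    have D: "diamond (ea v) (eb v) (eu v) (ew v) (lam v) (mu v)"
      using fat_diamond_cell[OF v] unfolding fat_diamond_def by blast
    show ?thesis unfolding tri_def diamond.area_upper[OF D]
      using diamond.mu[OF D] diamond.nondeg[OF D] diamond.\<Delta>_def[OF D] by simp
  next
    case True
    \<comment> \<open>The root is not a child; its area is read off as that of the parent in the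
      diamond of \<open>Tc c0\<close>.\<close>
    have v: "Tc c0 \<in> cells - {root}" using c0_distinct by simp
    have D: "diamond (ea (Tc c0)) (eb (Tc c0)) (eu (Tc c0)) (ew (Tc c0)) (lam (Tc c0)) (mu (Tc c0))"
      using fat_diamond_cell[OF v] unfolding fat_diamond_def by blast
    have "tri v = convex hull {ea (Tc c0), eb (Tc c0), ew (Tc c0)}"
      using tri_par[OF v] True by simp
    then show ?thesis using diamond.area_lower[OF D] diamond.mu[OF D] diamond.nondeg[OF D] diamond.\<Delta>_def[OF D] by simp
  qed
  then have "\<not> negligible (tri v)" using negligible_imp_measure0 by force
  then show ?thesis using negligible_convex_interior[OF conv] by blast
qed

interpretation sq: triangle_tree "csquare 1" cells tri root par col ea eb eu ew lam mu 100
proof (rule triangle_tree.intro)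
  show "convex (csquare 1)" unfolding csquare_def by (rule convex_box)
  show "countable cells" by (rule countable_cells)
  show "root \<in> cells" by simp
  show "polytope (tri v)" for v unfolding tri_def by (rule polytope_convex_hull) simp
  show "interior (tri v) \<noteq> {}" if "v \<in> cells" for v using interior_tri_ne[OF that] .
  show "interior (tri v) \<inter> interior (tri v') = {}" if "v \<in> cells" "v' \<in> cells" "v \<noteq> v'" for v v'
    using tri_disjoint[OF that] .
  show "(\<Union>v\<in>cells. tri v) = interior (csquare 1)" by (rule cover_cells)
  show "locally_finite_in (top_of_set (interior (csquare 1))) (tri ` cells)" by (rule locally_finite_cells)
  fix v assume v: "v \<in> cells - {root}"
  show "par v \<in> cells" using par_cells[OF v] .
  show "tri v = convex hull {ea v, eb v, eu v}" unfolding tri_def ..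
  show "tri (par v) = convex hull {ea v, eb v, ew v}" using tri_par[OF v] .
  note fat = fat_diamond_cell[OF v, unfolded fat_diamond_def]
  show "diamond (ea v) (eb v) (eu v) (ew v) (lam v) (mu v)" using fat by blast
  show "1 / 100 \<le> lam v" using fat by blast
  show "1 / 100 \<le> 1 - lam v" using fat by blast
  show "1 / 100 \<le> mu v" using fat by blast
  show "1 / 100 \<le> 1 - mu v" using fat by blast
  show "(norm (eb v - ea v))\<^sup>2 + (norm (eu v - ew v))\<^sup>2 \<le> 100 * \<bar>cross2 (eb v - ea v) (eu v - ew v)\<bar>"
    using fat by blast
  fix v' assume v': "v' \<in> cells - {root}" and col: "col v = col v'"
  show "v \<noteq> par v'" using not_par_same_col[OF v v' col] .
  show "par v = par v' \<Longrightarrow> v = v'" using par_inj_same_col[OF v v' col] .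
qed simp

section \<open>The flux through the tree\<close>

text \<open>Up to a null set this is filled by \<open>Dc a i k\<close> and all its descendants.
  Using the closed sector in place of their union avoids infinite sums of masses.\<close>

definition sector :: "real^2 \<Rightarrow> nat \<Rightarrow> nat \<Rightarrow> (real^2) set" where
  "sector a i k = {z. 1 - 1/2^i \<le> cs a z \<and> cs a z \<le> 1 \<and>
     (real k/2^i) * cs a z \<le> cy a z \<and> cy a z \<le> (real (k+1)/2^i) * cs a z}"

lemma sector_params:
  assumes "t = 1/2^i" "x = real k / 2^i"
  shows "sector a i k = {z. 1 - t \<le> cs a z \<and> cs a z \<le> 1 \<and> x * cs a z \<le> cy a z \<and> cy a z \<le> (x + t) * cs a z}"
proof -
  have "real (k+1)/2^i = x + t" unfolding assms by (simp add: add_divide_distrib)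
  then show ?thesis unfolding sector_def by (simp_all only: assms[symmetric])
qed

lemma negligible_linear_eq:
  fixes f :: "real^2 \<Rightarrow> real"
  assumes "linear f" "f p \<noteq> 0"
  shows "negligible {z. f z = r}"
proof -
  have f: "f z = adjoint f 1 \<bullet> z" for z
    using adjoint_works[OF assms(1), of z 1] by (simp add: inner_commute)
  then have "adjoint f 1 \<noteq> 0" using assms(2) by auto
  then show ?thesis using negligible_hyperplane[of "adjoint f 1" r] by (simp add: f)
qed

lemma negligible_cs_eq: "a \<in> corners \<Longrightarrow> negligible {z. cs a z = r}"
  by (rule negligible_linear_eq[OF linear_coords(3), of _ "cmb a 1 0"]) simp

lemma negligible_cy_eq: "a \<in> corners \<Longrightarrow> negligible {z. cy a z = s * cs a z}"
proof -
  assume a: "a \<in> corners"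
  have "negligible {z. cy a z - s * cs a z = 0}"
  proof (cases "s = 0")
    case True
    then show ?thesis by (intro negligible_linear_eq[OF linear_coords(7), where p = "cmb a 0 1"]) (use a in simp)
  next
    case False
    then show ?thesis by (intro negligible_linear_eq[OF linear_coords(7), where p = "cmb a 1 0"]) (use a False in simp)
  qed
  then show ?thesis by simp
qed

lemma convex_sector: "convex (sector a i k)"
proof -
  have hs: "convex {z. f z \<le> r}" if "linear f" for f :: "real^2 \<Rightarrow> real" and r
    unfolding convex_def using that
    by (auto simp: linear_add linear_scale intro!: convex_bound_le)
  have "sector a i k = {z. - cs a z \<le> - (1 - 1/2^i)} \<inter> {z. cs a z \<le> 1} \<inter>
      {z. (real k/2^i) * cs a z - cy a z \<le> 0} \<inter> {z. cy a z - (real (k+1)/2^i) * cs a z \<le> 0}"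
    unfolding sector_def by auto
  then show ?thesis by (simp only:) (intro convex_Int hs linear_coords)
qed

lemma sector_coords:
  assumes "1 \<le> i" "k < 2^i" "z \<in> sector a i k"
  shows "cx a z \<ge> 0" "cy a z \<ge> 0" "cs a z \<le> 1"
proof -
  obtain t x where t: "0 < t" "t \<le> 1/2" "0 \<le> x" "x + t \<le> 1" "t = 1/2^i" "x = real k / 2^i"
    using dpt_level[OF assms(1,2)] .
  have zz: "1 - t \<le> cs a z" "cs a z \<le> 1" "x * cs a z \<le> cy a z" "cy a z \<le> (x + t) * cs a z"
    using assms(3) unfolding sector_params[OF t(5,6)] by auto
  have s: "0 \<le> cs a z" using t(2) zz(1) by linarith
  have "0 \<le> x * cs a z" using t(3) s by (rule mult_nonneg_nonneg)
  moreover have "(x + t) * cs a z \<le> 1 * cs a z" using t(4) s by (rule mult_right_mono)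
  ultimately show "cx a z \<ge> 0" "cy a z \<ge> 0" "cs a z \<le> 1" using zz cs_def[of a z] by linarith+
qed

lemma sector_subset_square:
  assumes "a \<in> corners" "1 \<le> i" "k < 2^i"
  shows "sector a i k \<subseteq> csquare 1"
proof
  fix z assume z: "z \<in> sector a i k"
  have "cs a' z \<le> 1" if "a' \<in> corners" for a'
    using cs_corner_le[OF assms(1) that] sector_coords[OF assms(2,3) z] by force
  then show "z \<in> csquare 1" unfolding csquare_eq by blast
qed

lemma bounded_square: "bounded (csquare r)" and convex_square: "convex (csquare r)"
  unfolding csquare_def by (auto simp: bounded_cbox convex_box)

lemma lmeasurable_sector:
  assumes "a \<in> corners" "1 \<le> i" "k < 2^i"
  shows "sector a i k \<in> lmeasurable"
  by (rule measurable_convex[OF convex_sector bounded_subset[OF bounded_square sector_subset_square[OF assms]]])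

text \<open>Depth and width of the sector are of the order of \<open>t = 1/2^i\<close>, so it fits
  into a disc of radius \<open>4 * t\<close>; with \<open>pi < 4\<close> this gives the factor
  64.\<close>

lemma measure_sector:
  assumes a: "a \<in> corners" "1 \<le> i" "k < 2^i"
  shows "measure lebesgue (sector a i k) \<le> 64 * (1/2^i)\<^sup>2"
proof -
  obtain t x where t: "0 < t" "t \<le> 1/2" "0 \<le> x" "x + t \<le> 1" "t = 1/2^i" "x = real k / 2^i"
    using dpt_level[OF a(2,3)] .
  let ?p = "cmb a (1 - x) x"
  have "sector a i k \<subseteq> cball ?p (4 * t)"
  proof
    fix z assume z: "z \<in> sector a i k"
    define X Y where "X = cx a z" and "Y = cy a z"
    have zc: "z = cmb a X Y" unfolding X_def Y_def using cmb_cx_cy[OF a(1)] by simp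
    have zz: "1 - t \<le> X + Y" "X + Y \<le> 1" "x * (X + Y) \<le> Y" "Y \<le> (x + t) * (X + Y)"
      using z unfolding sector_params[OF t(5,6)] X_def Y_def cs_def by auto
    have "x * (1 - (X + Y)) \<le> 1 * (1 - (X + Y))" by (rule mult_right_mono; use t(1-4) zz in linarith)
    moreover have "(x + t) * (X + Y) \<le> (x + t) * 1" by (rule mult_left_mono; use t(1-4) zz in linarith)
    ultimately have Y: "\<bar>Y - x\<bar> \<le> t" using zz by (simp add: algebra_simps)
    then have X: "\<bar>X - (1 - x)\<bar> \<le> 2 * t" using zz by linarith
    have "(norm (z - ?p))\<^sup>2 = 2 * ((X - (1 - x))\<^sup>2 + (Y - x)\<^sup>2)"
      unfolding zc cmb_simps norm_cmb[OF a(1)] ..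
    also have "\<dots> \<le> 2 * ((2 * t)\<^sup>2 + t\<^sup>2)"
    proof (intro mult_left_mono add_mono)
      show "(X - (1 - x))\<^sup>2 \<le> (2 * t)\<^sup>2" using X t by (simp only: power2_le_iff_abs_le)
      show "(Y - x)\<^sup>2 \<le> t\<^sup>2" using Y t by (simp only: power2_le_iff_abs_le less_imp_le)
    qed simp
    also have "\<dots> \<le> (4 * t)\<^sup>2" by (simp add: power2_eq_square)
    finally have "norm (z - ?p) \<le> 4 * t" by (rule power2_le_imp_le) (use t(1) in simp)
    then show "z \<in> cball ?p (4 * t)" by (simp add: dist_norm norm_minus_commute)
  qed
  then have "measure lebesgue (sector a i k) \<le> measure lebesgue (cball ?p (4 * t))"
    using lmeasurable_sector[OF a] by (intro measure_mono_fmeasurable) (auto simp: fmeasurableD)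
  also have "\<dots> = pi * (4 * t)\<^sup>2"
    using content_cball[of "4 * t" ?p] t by (simp add: unit_ball_vol_2)
  also have "\<dots> \<le> 4 * (4 * t)\<^sup>2" using pi_less_4 by (intro mult_right_mono) auto
  finally show ?thesis unfolding t(5)[symmetric] by (simp add: power2_eq_square)
qed

text \<open>Beyond the trapezoid, the ray of slope \<open>x + t/2\<close> halves the rest of the
  sector. This self-similarity mirrors the tree.\<close>

lemma sector_split:
  assumes "1 \<le> i"
  shows "sector a i k = zone a i k \<union> (sector a (i+1) (2*k) \<union> sector a (i+1) (2*k+1))"
proof -
  define t x where "t = 1/(2::real)^i" and "x = real k / 2^i"
  have t0: "t > 0" unfolding t_def by simp
  have e: "t/2 = 1/2^(i+1)" "x = real (2*k) / 2^(i+1)" "x + t/2 = real (2*k+1) / 2^(i+1)"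
    unfolding t_def x_def by (simp_all add: add_divide_distrib)
  have t1: "t \<le> 1/2"
  proof -
    have "(2::real)^1 \<le> 2^i" using assms by (intro power_increasing) auto
    then show ?thesis unfolding t_def by (simp add: field_simps)
  qed
  have ineq: "1 - t \<le> s \<longrightarrow> x * s \<le> (x + t/2) * s \<and> (x + t/2) * s \<le> (x + t) * s" for s
    using t1 t0 by (auto intro!: mult_right_mono)
  have h: "x + t/2 + t/2 = x + t" by simp
  show ?thesis
  proof (rule set_eqI)
    fix z
    show "z \<in> sector a i k \<longleftrightarrow> z \<in> zone a i k \<union> (sector a (i+1) (2*k) \<union> sector a (i+1) (2*k+1))"
      unfolding zone_params[OF t_def x_def] sector_params[OF t_def x_def]
        sector_params[OF e(1,2)] sector_params[OF e(1,3)] h Un_iff mem_Collect_eq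
      using ineq[of "cs a z"] t0 by argo
  qed
qed

lemma zone_eq_tri:
  assumes "a \<in> corners" "1 \<le> i" "k < 2^i"
  shows "zone a i k = tri (Dc a i k) \<union> (tri (Lc a i k) \<union> tri (Rc a i k))"
  using zone_subset_tri[OF assms] zone_tri(1)[OF assms] by blast

lemma square_cover:
  "csquare 1 = (\<Union>v\<in>{Kc c | c. c \<in> corners} \<union> {Tc c0, Tc (- c0)}. tri v) \<union> (\<Union>a\<in>corners. sector a 1 0 \<union> sector a 1 1)"
    (is "_ = ?C \<union> ?S")
proof
  show "?C \<union> ?S \<subseteq> csquare 1"
  proof -
    have "tri v \<subseteq> csquare 1" if "v \<in> cells" for v
      using cover_cells that interior_subset[of "csquare 1"] by blast
    moreover have "{Kc c | c. c \<in> corners} \<union> {Tc c0, Tc (- c0)} \<subseteq> cells" by auto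
    ultimately have "?C \<subseteq> csquare 1" by blast
    moreover have "sector a 1 0 \<subseteq> csquare 1" "sector a 1 1 \<subseteq> csquare 1" if "a \<in> corners" for a
      using sector_subset_square[OF that, of 1 0] sector_subset_square[OF that, of 1 1] by simp_all
    then have "?S \<subseteq> csquare 1" by blast
    ultimately show ?thesis by blast
  qed
  show "csquare 1 \<subseteq> ?C \<union> ?S"
  proof
    fix z assume z: "z \<in> csquare 1"
    obtain a where a: "a \<in> corners" "cx a z \<ge> 0" "cy a z \<ge> 0" using corner_exists by blast
    have s: "cs a z \<le> 1" using z a(1) unfolding csquare_eq by blast
    show "z \<in> ?C \<union> ?S"
    proof (cases "1/2 \<le> cs a z")
      case True
      then have "z \<in> sector a 1 0 \<or> z \<in> sector a 1 1"
        using a s cs_def[of a z] by (cases "cy a z \<le> cs a z / 2") (auto simp: sector_def)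
      then show ?thesis using a(1) by blast
    next
      case False
      then have "cs a' z \<le> 1/2" if "a' \<in> corners" for a' using cs_corner_le[OF a(1) that a(2,3)] by linarith
      then have "z \<in> ?C" using center_cover by blast
      then show ?thesis by blast
    qed
  qed
qed

text \<open>The factor 20000 collects 100 from the fatness of the diamond, 100 from the share of
  either triangle in it, and 2 from the area formula.\<close>

lemma area_ge_edge:
  assumes v: "v \<in> cells - {root}"
  shows "(norm (eb v - ea v))\<^sup>2 / 20000 \<le> sq.area v" "(norm (eb v - ea v))\<^sup>2 / 20000 \<le> sq.area (par v)"
proof -
  note fat = fat_diamond_cell[OF v, unfolded fat_diamond_def]
  let ?D = "diamond.\<Delta> (ea v) (eb v) (eu v) (ew v)"
  have D: "diamond (ea v) (eb v) (eu v) (ew v) (lam v) (mu v)" using fat by blast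
  have "(norm (eb v - ea v))\<^sup>2 + (norm (eu v - ew v))\<^sup>2 \<le> 100 * \<bar>?D\<bar>"
    unfolding diamond.\<Delta>_def[OF D] using fat by blast
  then have n: "(norm (eb v - ea v))\<^sup>2 \<le> 100 * \<bar>?D\<bar>" using zero_le_power2[of "norm (eu v - ew v)"] by linarith
  have "(1/100) * \<bar>?D\<bar> \<le> (1 - mu v) * \<bar>?D\<bar>" "(1/100) * \<bar>?D\<bar> \<le> mu v * \<bar>?D\<bar>"
    using fat by (intro mult_right_mono; simp)+
  moreover have "sq.area v = (1 - mu v) * \<bar>?D\<bar> / 2" "sq.area (par v) = mu v * \<bar>?D\<bar> / 2"
    unfolding sq.area_def sq.child[OF v] sq.parent[OF v] diamond.area_upper[OF D] diamond.area_lower[OF D] by simp_all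
  ultimately show "(norm (eb v - ea v))\<^sup>2 / 20000 \<le> sq.area v" "(norm (eb v - ea v))\<^sup>2 / 20000 \<le> sq.area (par v)"
    using n by argo+
qed

lemma cs_le_norm: "a \<in> corners \<Longrightarrow> (cs a z)\<^sup>2 \<le> (norm z)\<^sup>2" and cy_le_norm: "a \<in> corners \<Longrightarrow> (cy a z)\<^sup>2 \<le> (norm z)\<^sup>2"
proof -
  assume a: "a \<in> corners"
  have n: "(norm z)\<^sup>2 = 2 * ((cx a z)\<^sup>2 + (cy a z)\<^sup>2)" using norm_cmb[OF a, of "cx a z" "cy a z"] cmb_cx_cy[OF a] by simp
  have "0 \<le> (cx a z - cy a z)\<^sup>2" by simp
  then show "(cs a z)\<^sup>2 \<le> (norm z)\<^sup>2" unfolding n cs_def by (simp add: power2_eq_square algebra_simps)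
  show "(cy a z)\<^sup>2 \<le> (norm z)\<^sup>2" unfolding n by simp
qed

text \<open>The edge towards the parent has length at least \<open>1/2^i / 2\<close> for a triangle
  of level \<open>i\<close>, which turns the factor 20000 into 80000.\<close>

lemma area_zone_ge:
  assumes v: "v \<in> cells" "zone_index v = Some (a, i, k)"
  shows "(1/2^i)\<^sup>2 / 80000 \<le> sq.area v"
proof -
  note V = zone_index_Some[OF v]
  obtain t x where t: "0 < t" "t \<le> 1/2" "0 \<le> x" "x + t \<le> 1" "t = 1/2^i" "x = real k / 2^i"
    using dpt_level[OF V(2,3)] .
  note co = dpt_coords[OF V(1) t(5,6)]
  have lin: "cs a (z - y) = cs a z - cs a y" "cy a (z - y) = cy a z - cy a y" for z y
    using linear_diff[OF linear_coords(3)] linear_diff[OF linear_coords(2)] by auto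
  have r: "v \<in> cells - {root}" using v by auto
  have "(t/2)\<^sup>2 \<le> (norm (eb v - ea v))\<^sup>2"
    using V(4)
  proof (elim disjE)
    assume v: "v = Dc a i k"
    have "cy a (eb v - ea v) = (1 - t) * t" unfolding v lin by (simp add: co algebra_simps)
    moreover have "t/2 \<le> (1 - t) * t" using t mult_right_mono[of "1/2" "1 - t" t] by simp
    ultimately have "(t/2)\<^sup>2 \<le> (cy a (eb v - ea v))\<^sup>2" using t by (intro power_mono) auto
    then show ?thesis using cy_le_norm[OF V(1)] order_trans by blast
  next
    assume v: "v = Lc a i k"
    have "cs a (eb v - ea v) = t/2" unfolding v lin by (simp add: co)
    then show ?thesis using cs_le_norm[OF V(1), of "eb v - ea v"] by metis
  next
    assume v: "v = Rc a i k"
    have "cs a (eb v - ea v) = t/2" unfolding v lin by (simp add: co)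
    then show ?thesis using cs_le_norm[OF V(1), of "eb v - ea v"] by metis
  qed
  then show ?thesis using area_ge_edge(1)[OF r] unfolding t(5)[symmetric] by (simp add: power2_eq_square)
qed

lemma area_center_ge:
  assumes v: "v \<in> cells" "zone_index v = None"
  shows "1 / 40000 \<le> sq.area v"
proof (cases "v = root")
  case True
  have r: "Tc c0 \<in> cells - {root}" using c0_distinct by simp
  have "(norm (eb (Tc c0) - ea (Tc c0)))\<^sup>2 = 1"
    unfolding ea.simps eb.simps cmb_simps norm_cmb[OF c0_corner] by (simp add: power2_eq_square)
  then show ?thesis using area_ge_edge(2)[OF r] True by simp
next
  case False
  then have r: "v \<in> cells - {root}" using v by simp
  obtain c where c: "c \<in> corners" "v = Kc c \<or> v = Tc c" using zone_index_None[OF v] .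
  have "(norm (eb v - ea v))\<^sup>2 \<ge> 1/2" 
    using c(2) by (elim disjE; simp only: ea.simps eb.simps cmb_simps norm_cmb[OF c(1)]; simp add: power2_eq_square)
  then show ?thesis using area_ge_edge(1)[OF r] by simp
qed

section \<open>Excess masses\<close>

locale cell_density =
  fixes f :: "real^2 \<Rightarrow> real" and d :: "cell \<Rightarrow> real" and C :: real
  assumes C: "C > 0"
    and f_int: "f integrable_on csquare 1"
    and f_bounds: "\<And>z. z \<in> csquare 1 \<Longrightarrow> 1 / C \<le> f z \<and> f z \<le> C"
    and f_const: "\<And>v z. v \<in> cells \<Longrightarrow> z \<in> interior (tri v) \<Longrightarrow> f z = d v"
    and total: "integral (csquare 1) f = measure lebesgue (csquare 1)"
begin

definition excess :: "(real^2) set \<Rightarrow> real" where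
  "excess S = integral S (\<lambda>z. f z - 1)"

definition good :: "(real^2) set \<Rightarrow> bool" where
  "good S \<longleftrightarrow> S \<subseteq> csquare 1 \<and> S \<in> lmeasurable"

lemma good_Un: "good S \<Longrightarrow> good T \<Longrightarrow> good (S \<union> T)"
  unfolding good_def by (auto intro: fmeasurable.Un)

lemma good_UN: "finite W \<Longrightarrow> (\<And>i. i \<in> W \<Longrightarrow> good (T i)) \<Longrightarrow> good (\<Union>i\<in>W. T i)"
proof (induction rule: finite_induct)
  case empty
  then show ?case by (simp add: good_def)
next
  case (insert i W)
  then show ?case using good_Un[of "T i" "\<Union>i\<in>W. T i"] by simp
qed

lemma good_square: "good (csquare 1)"
  unfolding good_def by (simp add: measurable_convex convex_square bounded_square)

lemma good_tri: "v \<in> cells \<Longrightarrow> good (tri v)"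
  unfolding good_def
  using cover_cells interior_subset[of "csquare 1"] sq.poly polytope_imp_compact lmeasurable_compact by blast

lemma good_sector: "a \<in> corners \<Longrightarrow> 1 \<le> i \<Longrightarrow> k < 2^i \<Longrightarrow> good (sector a i k)"
  unfolding good_def using lmeasurable_sector sector_subset_square by blast

text \<open>A gauge integrable function need not be integrable on measurable subsets. Nonnegativity
  makes \<open>f\<close> absolutely integrable, and this property is inherited.\<close>

lemma integrable_excess:
  assumes "good S"
  shows "(\<lambda>z. f z - 1) integrable_on S"
proof -
  have S: "S \<subseteq> csquare 1" "S \<in> lmeasurable" using assms unfolding good_def by auto
  have "f z \<ge> 0" if "z \<in> csquare 1" for z
    using f_bounds[OF that] C by (meson divide_nonneg_pos less_imp_le order_trans zero_le_one)
  then have "f absolutely_integrable_on csquare 1"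
    by (intro nonnegative_absolutely_integrable_1 f_int)
  then have "f absolutely_integrable_on S"
    by (rule set_integrable_subset) (use S fmeasurableD in auto)
  then have "f integrable_on S" using set_lebesgue_integral_eq_integral(1) by blast
  moreover have "(\<lambda>z. 1) integrable_on S" using S(2) integrable_on_const by blast
  ultimately show ?thesis by (rule integrable_diff)
qed

lemma excess_Un:
  assumes "good S" "good T" "negligible (S \<inter> T)"
  shows "excess (S \<union> T) = excess S + excess T"
proof -
  have "((\<lambda>z. f z - 1) has_integral excess S) S" "((\<lambda>z. f z - 1) has_integral excess T) T"
    unfolding excess_def using integrable_excess assms by (auto intro: integrable_integral)
  then have "((\<lambda>z. f z - 1) has_integral excess S + excess T) (S \<union> T)"
    by (rule has_integral_Un) (rule assms(3))
  then show ?thesis unfolding excess_def[of "S \<union> T"] by (rule integral_unique)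
qed

lemma excess_UN:
  assumes "finite W" "\<And>i. i \<in> W \<Longrightarrow> good (T i)"
    and "\<And>i j. i \<in> W \<Longrightarrow> j \<in> W \<Longrightarrow> i \<noteq> j \<Longrightarrow> negligible (T i \<inter> T j)"
  shows "excess (\<Union>i\<in>W. T i) = (\<Sum>i\<in>W. excess (T i))"
proof -
  have "((\<lambda>z. f z - 1) has_integral (\<Sum>i\<in>W. excess (T i))) (\<Union>i\<in>W. T i)"
  proof (rule has_integral_UN[OF assms(1)])
    show "((\<lambda>z. f z - 1) has_integral excess (T i)) (T i)" if "i \<in> W" for i
      unfolding excess_def using integrable_excess assms(2)[OF that] by (auto intro: integrable_integral)
    show "pairwise (\<lambda>i i'. negligible (T i \<inter> T i')) W"
      using assms(3) unfolding pairwise_def by blast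
  qed
  then show ?thesis unfolding excess_def[of "\<Union>i\<in>W. T i"] by (rule integral_unique)
qed

lemma integral_const_measure: "S \<in> lmeasurable \<Longrightarrow> integral S (\<lambda>_. r) = r * measure lebesgue S"
  using lmeasure_integral[of S] integral_mult_right[of S r "\<lambda>_. 1"] by simp

lemma excess_bound:
  assumes "good S"
  shows "\<bar>excess S\<bar> \<le> (C + 1) * measure lebesgue S"
proof -
  have S: "S \<subseteq> csquare 1" "S \<in> lmeasurable" using assms unfolding good_def by auto
  have "norm (excess S) \<le> integral S (\<lambda>_. C + 1)"
    unfolding excess_def
  proof (rule integral_norm_bound_integral[OF integrable_excess[OF assms]])
    show "(\<lambda>_. C + 1) integrable_on S" using S(2) integrable_on_const by blast
    fix z assume "z \<in> S"
    then have "1 / C \<le> f z" "f z \<le> C" using f_bounds S(1) by auto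
    moreover have "0 < 1 / C" using C by simp
    ultimately show "norm (f z - 1) \<le> C + 1" unfolding real_norm_def by linarith
  qed
  then show ?thesis using integral_const_measure[OF S(2)] by simp
qed

lemma excess_tri:
  assumes "v \<in> cells"
  shows "excess (tri v) = (d v - 1) * sq.area v"
proof -
  have "excess (tri v) = integral (tri v) (\<lambda>_. d v - 1)"
    unfolding excess_def
  proof (rule integral_spike)
    show "negligible (frontier (tri v))" using negligible_convex_frontier sq.convex_tri[OF assms] by blast
    fix z assume "z \<in> tri v - frontier (tri v)"
    then have "z \<in> interior (tri v)" using closure_subset unfolding frontier_def by blast
    then show "d v - 1 = f z - 1" using f_const[OF assms] by simp
  qed
  then show ?thesis unfolding sq.area_def
    using integral_const_measure[of "tri v" "d v - 1"] good_tri[OF assms] unfolding good_def by simp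
qed

lemma excess_square: "excess (csquare 1) = 0"
proof -
  have "(\<lambda>_. 1 :: real) integrable_on csquare 1" using good_square integrable_on_const unfolding good_def by blast
  then have "excess (csquare 1) = integral (csquare 1) f - integral (csquare 1) (\<lambda>_. 1)"
    unfolding excess_def using f_int by (intro integral_diff)
  then show ?thesis using total integral_const_measure[of "csquare 1" 1] good_square unfolding good_def by simp
qed

lemma excess_sector:
  assumes a: "a \<in> corners" "1 \<le> i" "k < 2^i"
  shows "excess (sector a i k) = excess (tri (Dc a i k)) + excess (tri (Lc a i k)) + excess (tri (Rc a i k))
    + excess (sector a (i+1) (2*k)) + excess (sector a (i+1) (2*k+1))"
proof -
  have k: "2 * k < 2^(i+1)" "2 * k + 1 < 2^(i+1)" using a(3) by auto
  have c: "Dc a i k \<in> cells" "Lc a i k \<in> cells" "Rc a i k \<in> cells" using a by auto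
  note g = good_tri[OF c(1)] good_tri[OF c(2)] good_tri[OF c(3)]
    good_sector[OF a(1) _ k(1), simplified] good_sector[OF a(1) _ k(2), simplified]
  have n1: "negligible (sector a (i+1) (2*k) \<inter> sector a (i+1) (2*k+1))"
    by (rule negligible_subset[OF negligible_cy_eq[OF a(1), of "real (2*k+1) / 2^(i+1)"]])
       (auto simp: sector_def)
  have n2: "negligible (zone a i k \<inter> (sector a (i+1) (2*k) \<union> sector a (i+1) (2*k+1)))"
    by (rule negligible_subset[OF negligible_cs_eq[OF a(1), of "1 - 1/2^(i+1)"]])
       (auto simp: sector_def zone_def)
  have n3: "negligible (tri (Lc a i k) \<inter> tri (Rc a i k))" "negligible (tri (Dc a i k) \<inter> tri (Lc a i k))"
    "negligible (tri (Dc a i k) \<inter> tri (Rc a i k))"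
    using c by (intro sq.negligible_inter; simp)+
  have n4: "negligible (tri (Dc a i k) \<inter> (tri (Lc a i k) \<union> tri (Rc a i k)))"
    unfolding Int_Un_distrib using n3(2,3) by (rule negligible_Un)
  have z: "excess (zone a i k) = excess (tri (Dc a i k)) + (excess (tri (Lc a i k)) + excess (tri (Rc a i k)))"
    unfolding zone_eq_tri[OF a]
    by (simp only: excess_Un[OF g(1) good_Un[OF g(2,3)] n4] excess_Un[OF g(2,3) n3(1)])
  have gz: "good (zone a i k)" unfolding zone_eq_tri[OF a] by (intro good_Un g)
  have gs: "good (sector a (i+1) (2*k))" "good (sector a (i+1) (2*k+1))"
    using good_sector[OF a(1) _ k(1)] good_sector[OF a(1) _ k(2)] by simp_all
  show ?thesis unfolding sector_split[OF a(2), of a k]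
    by (simp only: excess_Un[OF gz good_Un[OF gs] n2] excess_Un[OF gs n1] z)
qed

text \<open>The triangle \<open>Kc c\<close> borders the first half of the inner side parallel to
  that from \<open>c\<close> to \<open>rot c\<close>, and the second half of the one parallel to
  that from \<open>- rot c\<close> to \<open>c\<close>; hence the two sectors.\<close>

definition XK :: "real^2 \<Rightarrow> real" where
  "XK c = excess (tri (Kc c)) + (excess (sector c 1 0) + excess (sector (- rot c) 1 1))"

text \<open>The mass that has to leave the triangles below \<open>v\<close> in the tree through the edge to the
  parent of \<open>v\<close>.\<close>

fun X :: "cell \<Rightarrow> real" where
  "X (Dc a i k) = excess (sector a i k)"
| "X (Lc a i k) = excess (tri (Lc a i k)) + excess (sector a (i+1) (2*k))"
| "X (Rc a i k) = excess (tri (Rc a i k)) + excess (sector a (i+1) (2*k+1))"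
| "X (Kc c) = XK c"
| "X (Tc c) = excess (tri (Tc c)) + (XK c0 + XK (rot c0))"

lemma corners_eq: "corners = {c0, rot c0, - c0, - rot c0}"
  using corner_cases_c0 by auto

lemma sum_corners: "sum g corners = g c0 + (g (rot c0) + (g (- c0) + g (- rot c0)))" for g :: "real^2 \<Rightarrow> real"
proof -
  have "c0 \<noteq> rot c0" "c0 \<noteq> - c0" "c0 \<noteq> - rot c0" "rot c0 \<noteq> - c0" "rot c0 \<noteq> - rot c0" "- c0 \<noteq> - rot c0"
    by (simp_all add: c0_def rot_def vec_eq_iff forall_2)
  then show ?thesis unfolding corners_eq by simp
qed

lemma negligible_center_sector:
  assumes "v \<in> {Kc c | c. c \<in> corners} \<union> {Tc c0, Tc (- c0)}" "a \<in> corners"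
  shows "negligible (tri v \<inter> (sector a 1 0 \<union> sector a 1 1))"
proof (rule negligible_subset[OF negligible_cs_eq[OF assms(2), of "1/2"]])
  obtain c where "v = Kc c \<or> v = Tc c" "c \<in> corners" using assms(1) by auto
  then show "tri v \<inter> (sector a 1 0 \<union> sector a 1 1) \<subseteq> {z. cs a z = 1/2}"
    using center_tri_cs[of v c _ a] assms(2) by (force simp: sector_def)
qed

lemma negligible_sectors:
  assumes a: "a \<in> corners" "a' \<in> corners" "a \<noteq> a'"
  shows "negligible ((sector a 1 0 \<union> sector a 1 1) \<inter> (sector a' 1 0 \<union> sector a' 1 1))"
proof (rule negligible_subset)
  show "negligible ({z. cx a z = 0} \<union> {z. cy a z = 0 * cs a z})"
    using negligible_linear_eq[OF linear_coords(1), of a "cmb a 1 0"] negligible_cy_eq[OF a(1), of 0] a(1)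
    by (intro negligible_Un) simp_all
  have co: "cx b z \<ge> 0 \<and> cy b z \<ge> 0" if "z \<in> sector b 1 0 \<union> sector b 1 1" for b z
    using sector_coords[of 1 0 z b] sector_coords[of 1 1 z b] that by auto
  show "(sector a 1 0 \<union> sector a 1 1) \<inter> (sector a' 1 0 \<union> sector a' 1 1)
     \<subseteq> {z. cx a z = 0} \<union> {z. cy a z = 0 * cs a z}"
  proof
    fix z assume z: "z \<in> (sector a 1 0 \<union> sector a 1 1) \<inter> (sector a' 1 0 \<union> sector a' 1 1)"
    then have "cx a z \<ge> 0" "cy a z \<ge> 0" "cx a' z \<ge> 0" "cy a' z \<ge> 0" using co by blast+
    then show "z \<in> {z. cx a z = 0} \<union> {z. cy a z = 0 * cs a z}"
      using corner_cases[OF a(1,2)] a(3) by (auto simp: rot_coords)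
  qed
qed

text \<open>This is the balance at the root. The central triangles and the eight sectors tile the
  square, whose excess vanishes because the integral of \<open>f\<close> equals the area.\<close>

lemma total_flux:
  "excess (tri root) + (XK (- c0) + XK (- rot c0) + X (Tc c0)) = 0"
proof -
  let ?Z = "{Kc c | c. c \<in> corners} \<union> {Tc c0, Tc (- c0)}"
  let ?S = "\<lambda>a. sector a 1 0 \<union> sector a 1 1"
  have Z: "?Z = Kc ` corners \<union> {Tc c0, Tc (- c0)}" by auto
  have finZ: "finite ?Z" unfolding Z using finite_corners by simp
  have gs: "good (sector a 1 0)" "good (sector a 1 1)" "good (?S a)" if "a \<in> corners" for a
    using good_sector[OF that, of 1 0] good_sector[OF that, of 1 1] good_Un by simp_all
  have gZ: "good (tri v)" if "v \<in> ?Z" for v using good_tri that by auto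
  have eZ: "excess (\<Union>v\<in>?Z. tri v) = (\<Sum>v\<in>?Z. excess (tri v))"
    using finZ gZ by (rule excess_UN) (auto intro!: sq.negligible_inter)
  have eS: "excess (\<Union>a\<in>corners. ?S a) = (\<Sum>a\<in>corners. excess (?S a))"
    using finite_corners gs(3) negligible_sectors by (rule excess_UN)
  have gUZ: "good (\<Union>v\<in>?Z. tri v)" and gUS: "good (\<Union>a\<in>corners. ?S a)"
    using good_UN[OF finZ gZ] good_UN[OF finite_corners gs(3)] by simp_all
  have "negligible (\<Union>v\<in>?Z. \<Union>a\<in>corners. tri v \<inter> ?S a)"
  proof (rule negligible_Union)
    show "finite ((\<lambda>v. \<Union>a\<in>corners. tri v \<inter> ?S a) ` ?Z)" using finZ by (rule finite_imageI)
    fix Y assume "Y \<in> (\<lambda>v. \<Union>a\<in>corners. tri v \<inter> ?S a) ` ?Z"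
    then obtain v where v: "v \<in> ?Z" "Y = (\<Union>a\<in>corners. tri v \<inter> ?S a)" by (elim imageE)
    show "negligible Y" unfolding v(2)
    proof (rule negligible_Union)
      show "finite ((\<lambda>a. tri v \<inter> ?S a) ` corners)" using finite_corners by (rule finite_imageI)
    qed (use negligible_center_sector[OF v(1)] in auto)
  qed
  moreover have "(\<Union>v\<in>?Z. tri v) \<inter> (\<Union>a\<in>corners. ?S a) = (\<Union>v\<in>?Z. \<Union>a\<in>corners. tri v \<inter> ?S a)"
    by blast
  ultimately have "excess (csquare 1) = (\<Sum>v\<in>?Z. excess (tri v)) + (\<Sum>a\<in>corners. excess (?S a))"
    unfolding square_cover using excess_Un[OF gUZ gUS] eZ eS by simp
  moreover have "excess (?S a) = excess (sector a 1 0) + excess (sector a 1 1)" if "a \<in> corners" for a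
  proof (rule excess_Un[OF gs(1,2)[OF that]])
    show "negligible (sector a 1 0 \<inter> sector a 1 1)"
      by (rule negligible_subset[OF negligible_cy_eq[OF that, of "1/2"]]) (auto simp: sector_def)
  qed
  then have "(\<Sum>a\<in>corners. excess (?S a)) = (\<Sum>a\<in>corners. excess (sector a 1 0) + excess (sector a 1 1))"
    by (intro sum.cong) auto
  moreover have "(\<Sum>v\<in>?Z. excess (tri v)) = (\<Sum>c\<in>corners. excess (tri (Kc c))) + (excess (tri (Tc c0)) + excess (tri root))"
  proof -
    have "(\<Sum>v\<in>?Z. excess (tri v)) = (\<Sum>v\<in>Kc ` corners. excess (tri v)) + (\<Sum>v\<in>{Tc c0, root}. excess (tri v))"
      unfolding Z using finite_corners by (intro sum.union_disjoint) auto
    also have "(\<Sum>v\<in>Kc ` corners. excess (tri v)) = (\<Sum>c\<in>corners. excess (tri (Kc c)))"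
      by (subst sum.reindex) (auto simp: inj_on_def)
    also have "(\<Sum>v\<in>{Tc c0, root}. excess (tri v)) = excess (tri (Tc c0)) + excess (tri root)"
      using c0_distinct(1) by simp
    finally show ?thesis .
  qed
  ultimately have "(\<Sum>c\<in>corners. excess (tri (Kc c))) + (excess (tri (Tc c0)) + excess (tri root))
     + (\<Sum>a\<in>corners. excess (sector a 1 0) + excess (sector a 1 1)) = 0"
    using excess_square by simp
  then show ?thesis unfolding sum_corners X.simps XK_def by simp
qed

end

section \<open>Balance and size of the fluxes\<close>

lemma children_cells:
  "Dc a i k \<in> cells \<Longrightarrow> sq.children (Dc a i k) = {Lc a i k, Rc a i k}"
  "Lc a i k \<in> cells \<Longrightarrow> sq.children (Lc a i k) = {Dc a (i+1) (2*k)}"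
  "Rc a i k \<in> cells \<Longrightarrow> sq.children (Rc a i k) = {Dc a (i+1) (2*k+1)}"
  "Kc c \<in> cells \<Longrightarrow> sq.children (Kc c) = {Dc c 1 0, Dc (- rot c) 1 1}"
  "sq.children (Tc c0) = {Kc c0, Kc (rot c0)}"
  "sq.children (Tc (- c0)) = {Kc (- c0), Kc (- rot c0), Tc c0}"
proof -
  have mem: "x \<in> sq.children v \<longleftrightarrow> x \<in> cells \<and> x \<noteq> root \<and> par x = v" for x v
    unfolding sq.children_def by auto
  show "Dc a i k \<in> cells \<Longrightarrow> sq.children (Dc a i k) = {Lc a i k, Rc a i k}"
  proof (intro set_eqI)
    fix x assume "Dc a i k \<in> cells"
    then show "x \<in> sq.children (Dc a i k) \<longleftrightarrow> x \<in> {Lc a i k, Rc a i k}"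
      unfolding mem by (cases x) auto
  qed
  show "Lc a i k \<in> cells \<Longrightarrow> sq.children (Lc a i k) = {Dc a (i+1) (2*k)}"
  proof (intro set_eqI)
    fix x assume "Lc a i k \<in> cells"
    then show "x \<in> sq.children (Lc a i k) \<longleftrightarrow> x \<in> {Dc a (i+1) (2*k)}"
      unfolding mem by (cases x) (auto split: if_splits)
  qed
  show "Rc a i k \<in> cells \<Longrightarrow> sq.children (Rc a i k) = {Dc a (i+1) (2*k+1)}"
  proof (intro set_eqI)
    fix x assume "Rc a i k \<in> cells"
    then show "x \<in> sq.children (Rc a i k) \<longleftrightarrow> x \<in> {Dc a (i+1) (2*k+1)}"
      unfolding mem by (cases x) (auto split: if_splits)
  qed
  have r: "rot a = c \<longleftrightarrow> a = - rot c" for a c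
    by (metis rot_rot rot_minus minus_minus)
  show "Kc c \<in> cells \<Longrightarrow> sq.children (Kc c) = {Dc c 1 0, Dc (- rot c) 1 1}"
  proof (intro set_eqI)
    fix x assume c: "Kc c \<in> cells"
    show "x \<in> sq.children (Kc c) \<longleftrightarrow> x \<in> {Dc c 1 0, Dc (- rot c) 1 1}"
    proof (cases x)
      case (Dc a i k)
      have "k < 2 \<longleftrightarrow> k = 0 \<or> k = 1" by auto
      then show ?thesis using c r[of a c] unfolding mem Dc by (cases "i = 1") auto
    qed (use c in \<open>auto simp: mem\<close>)
  qed
  show "sq.children (Tc c0) = {Kc c0, Kc (rot c0)}"
  proof (intro set_eqI)
    fix x show "x \<in> sq.children (Tc c0) \<longleftrightarrow> x \<in> {Kc c0, Kc (rot c0)}"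
      unfolding mem using c0_distinct(1) by (cases x) auto
  qed
  show "sq.children (Tc (- c0)) = {Kc (- c0), Kc (- rot c0), Tc c0}"
  proof (intro set_eqI)
    fix x show "x \<in> sq.children (Tc (- c0)) \<longleftrightarrow> x \<in> {Kc (- c0), Kc (- rot c0), Tc c0}"
    proof (cases x)
      case (Kc c)
      have "- rot c0 \<noteq> rot c0"
        by (simp add: c0_def rot_def vec_eq_iff forall_2)
      then have "c \<in> corners \<and> \<not> (c = c0 \<or> c = rot c0) \<longleftrightarrow> c = - c0 \<or> c = - rot c0"
        using corner_cases_c0[of c] c0_distinct by auto
      then show ?thesis unfolding mem Kc using c0_distinct(1) by auto
    qed (use c0_distinct(1) in \<open>auto simp: mem\<close>)
  qed
qed

lemma root_children_distinct: "c0 \<noteq> rot c0" "- c0 \<noteq> - rot c0"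
  using c0_distinct by auto

context cell_density
begin

text \<open>The excess is additive over a triangle and the regions below its children. Only the root
  needs the normalisation of \<open>f\<close>.\<close>

lemma flux_balance:
  assumes v: "v \<in> cells"
  shows "(d v - 1) * sq.area v + (\<Sum>x\<in>sq.children v. X x) = (if v = root then 0 else X v)"
proof -
  note e = excess_tri[OF v, symmetric]
  show ?thesis
  proof (cases v)
    case (Dc a i k)
    then have a: "a \<in> corners" "1 \<le> i" "k < 2^i" using v by auto
    have "(\<Sum>x\<in>sq.children v. X x) = X (Lc a i k) + X (Rc a i k)"
      using children_cells(1)[of a i k] v unfolding Dc by simp
    then show ?thesis unfolding e using excess_sector[OF a] unfolding Dc by simp
  next
    case (Lc a i k)
    have "(\<Sum>x\<in>sq.children v. X x) = X (Dc a (i+1) (2*k))"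
      using children_cells(2)[of a i k] v unfolding Lc by simp
    then show ?thesis unfolding e unfolding Lc by simp
  next
    case (Rc a i k)
    have "(\<Sum>x\<in>sq.children v. X x) = X (Dc a (i+1) (2*k+1))"
      using children_cells(3)[of a i k] v unfolding Rc by simp
    then show ?thesis unfolding e unfolding Rc by simp
  next
    case (Kc c)
    have "(\<Sum>x\<in>sq.children v. X x) = X (Dc c 1 0) + X (Dc (- rot c) 1 1)"
      using children_cells(4)[of c] v unfolding Kc by simp
    then show ?thesis unfolding e unfolding Kc by (simp add: XK_def)
  next
    case (Tc c)
    then have "c = c0 \<or> c = - c0" using v by simp
    then consider "v = Tc c0" "v \<noteq> root" | "v = root" unfolding Tc using c0_distinct(1) by blast
    then show ?thesis
    proof cases
      case 1
      have "(\<Sum>x\<in>sq.children v. X x) = XK c0 + XK (rot c0)"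
        using children_cells(5) c0_distinct unfolding 1(1) by simp
      then show ?thesis using 1(2) unfolding e unfolding 1(1) by simp
    next
      case 2
      have "(\<Sum>x\<in>sq.children v. X x) = XK (- c0) + (XK (- rot c0) + X (Tc c0))"
        unfolding 2 children_cells(6) using c0_distinct root_children_distinct by (simp del: X.simps(5))
      then show ?thesis using total_flux unfolding e unfolding 2 by simp
    qed
  qed
qed

text \<open>The sector contains the whole trapezoid, its area is at most
  \<open>64 * (1/2^i)\<^sup>2\<close>, and \<open>f\<close> differs from 1 by at most
  \<open>C + 1\<close>.\<close>

lemma excess_level:
  assumes a: "a \<in> corners" "1 \<le> i" "k < 2^i"
  shows "\<bar>excess (sector a i k)\<bar> \<le> 64 * (C + 1) * (1/2^i)\<^sup>2"
    and "v = Dc a i k \<or> v = Lc a i k \<or> v = Rc a i k \<Longrightarrow> \<bar>excess (tri v)\<bar> \<le> 64 * (C + 1) * (1/2^i)\<^sup>2"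
proof -
  have c: "C + 1 \<ge> 0" using C by simp
  have m: "(C + 1) * measure lebesgue (sector a i k) \<le> (C + 1) * (64 * (1/2^i)\<^sup>2)"
    using measure_sector[OF a] c by (rule mult_left_mono)
  then show "\<bar>excess (sector a i k)\<bar> \<le> 64 * (C + 1) * (1/2^i)\<^sup>2"
    using excess_bound[OF good_sector[OF a]] by (simp only: mult_ac)
  assume v: "v = Dc a i k \<or> v = Lc a i k \<or> v = Rc a i k"
  then have vc: "v \<in> cells" using a by auto
  have "tri v \<subseteq> sector a i k" using zone_tri(1)[OF a v] sector_split[OF a(2), of a k] by blast
  then have "measure lebesgue (tri v) \<le> measure lebesgue (sector a i k)"
    using good_tri[OF vc] good_sector[OF a] unfolding good_def
    by (intro measure_mono_fmeasurable) (auto simp: fmeasurableD)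
  then have "(C + 1) * measure lebesgue (tri v) \<le> (C + 1) * measure lebesgue (sector a i k)"
    using c by (rule mult_left_mono)
  then show "\<bar>excess (tri v)\<bar> \<le> 64 * (C + 1) * (1/2^i)\<^sup>2"
    using m excess_bound[OF good_tri[OF vc]] by (simp only: mult_ac)
qed

text \<open>In units of \<open>C + 1\<close>, the fluxes at a triangle of level \<open>i\<close> add
  up to at most \<open>320 * (1/2^i)\<^sup>2\<close>, those at a central triangle to at most five
  times the area of the square plus 128. The factors 80000 and 40000 come from the lower bounds for
  areas, and \<open>25600000 = 320 * 80000\<close>.\<close>

definition flux_const :: real where
  "flux_const = (C + 1) * (25600000 + 40000 * (5 * measure lebesgue (csquare 1) + 128))"

lemma flux_bound:
  assumes v: "v \<in> cells"
  shows "(\<Sum>x\<in>sq.children v. \<bar>X x\<bar>) + (if v = root then 0 else \<bar>X v\<bar>) \<le> flux_const * sq.area v"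
proof (cases "zone_index v")
  case (Some p)
  obtain a i k where p: "p = (a, i, k)" by (cases p)
  note V = zone_index_Some[OF v Some[unfolded p]]
  define T where "T = (C + 1) * (1/2^i)\<^sup>2"
  have T0: "T \<ge> 0" unfolding T_def using C by simp
  have next_level: "64 * (C + 1) * (1/2^(i+1))\<^sup>2 = 16 * T" unfolding T_def by (simp add: power2_eq_square field_simps)
  have k: "2 * k < 2^(i+1)" "2 * k + 1 < 2^(i+1)" using V(3) by auto
  have s: "\<bar>excess (sector a i k)\<bar> \<le> 64 * T" "\<bar>excess (sector a (i+1) (2*k))\<bar> \<le> 16 * T"
    "\<bar>excess (sector a (i+1) (2*k+1))\<bar> \<le> 16 * T"
    using excess_level(1)[OF V(1-3)] excess_level(1)[OF V(1) _ k(1)] excess_level(1)[OF V(1) _ k(2)]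
    unfolding next_level by (simp_all only: T_def mult_ac le_add2 numeral_One One_nat_def)
  have t: "\<bar>excess (tri (Lc a i k))\<bar> \<le> 64 * T" "\<bar>excess (tri (Rc a i k))\<bar> \<le> 64 * T"
    using excess_level(2)[OF V(1-3)] unfolding T_def by (simp_all only: mult_ac simp_thms)
  have Xb: "\<bar>X (Dc a i k)\<bar> \<le> 64 * T" "\<bar>X (Lc a i k)\<bar> \<le> 80 * T" "\<bar>X (Rc a i k)\<bar> \<le> 80 * T"
    "\<bar>X (Dc a (i+1) (2*k))\<bar> \<le> 16 * T" "\<bar>X (Dc a (i+1) (2*k+1))\<bar> \<le> 16 * T"
    unfolding X.simps using s t by linarith+
  have "(\<Sum>x\<in>sq.children v. \<bar>X x\<bar>) + \<bar>X v\<bar> \<le> 320 * T"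
    using V(4)
  proof (elim disjE)
    assume eq: "v = Dc a i k"
    have "(\<Sum>x\<in>sq.children v. \<bar>X x\<bar>) = \<bar>X (Lc a i k)\<bar> + \<bar>X (Rc a i k)\<bar>"
      using children_cells(1)[of a i k] v unfolding eq by simp
    then show ?thesis using Xb T0 unfolding eq by linarith
  next
    assume eq: "v = Lc a i k"
    have "(\<Sum>x\<in>sq.children v. \<bar>X x\<bar>) = \<bar>X (Dc a (i+1) (2*k))\<bar>"
      using children_cells(2)[of a i k] v unfolding eq by simp
    then show ?thesis using Xb T0 unfolding eq by linarith
  next
    assume eq: "v = Rc a i k"
    have "(\<Sum>x\<in>sq.children v. \<bar>X x\<bar>) = \<bar>X (Dc a (i+1) (2*k+1))\<bar>"
      using children_cells(3)[of a i k] v unfolding eq by simp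
    then show ?thesis using Xb T0 unfolding eq by linarith
  qed
  also have "320 * T = (C + 1) * 25600000 * ((1/2^i)\<^sup>2 / 80000)" unfolding T_def by simp
  also have "\<dots> \<le> flux_const * sq.area v"
    unfolding flux_const_def using area_zone_ge[OF v Some[unfolded p]] C by (intro mult_mono) auto
  finally show ?thesis using abs_ge_zero[of "X v"] by (cases "v = root") auto
next
  case None
  define T where "T = C + 1"
  define m where "m = measure lebesgue (csquare 1)"
  have T0: "T \<ge> 0" "0 \<le> m * T" unfolding T_def m_def using C by simp_all
  have t: "\<bar>excess (tri v)\<bar> \<le> m * T" if "v \<in> cells" for v
  proof -
    have "measure lebesgue (tri v) \<le> m" unfolding m_def
      using good_tri[OF that] good_square unfolding good_def
      by (intro measure_mono_fmeasurable) (auto simp: fmeasurableD)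
    then have "(C + 1) * measure lebesgue (tri v) \<le> (C + 1) * m" using C by (intro mult_left_mono) auto
    then show ?thesis using excess_bound[OF good_tri[OF that]] unfolding T_def by (simp add: mult_ac)
  qed
  have s: "\<bar>excess (sector a 1 0)\<bar> \<le> 16 * T" "\<bar>excess (sector a 1 1)\<bar> \<le> 16 * T" if "a \<in> corners" for a
    using excess_level(1)[OF that, of 1 0] excess_level(1)[OF that, of 1 1]
    unfolding T_def by (simp_all add: power2_eq_square)
  have K: "\<bar>XK c\<bar> \<le> m * T + 32 * T" if "c \<in> corners" for c
  proof -
    have "- rot c \<in> corners" "Kc c \<in> cells" using that by simp_all
    then show ?thesis unfolding XK_def using t[of "Kc c"] s(1)[OF that] s(2)[of "- rot c"] by linarith
  qed
  have T: "\<bar>X (Tc c0)\<bar> \<le> 3 * (m * T) + 64 * T"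
  proof -
    have "c0 \<in> corners" "rot c0 \<in> corners" "Tc c0 \<in> cells" by simp_all
    then show ?thesis unfolding X.simps using t[of "Tc c0"] K[of c0] K[of "rot c0"] by linarith
  qed
  obtain c where c: "c \<in> corners" "v = Kc c \<or> v = Tc c" using zone_index_None[OF v None] .
  consider "v = Kc c" | "v = Tc c0" | "v = root" using c(2) v by auto
  then have "(\<Sum>x\<in>sq.children v. \<bar>X x\<bar>) + (if v = root then 0 else \<bar>X v\<bar>) \<le> 5 * (m * T) + 128 * T"
  proof cases
    case 1
    have "(\<Sum>x\<in>sq.children v. \<bar>X x\<bar>) = \<bar>excess (sector c 1 0)\<bar> + \<bar>excess (sector (- rot c) 1 1)\<bar>"
      using children_cells(4)[of c] v unfolding 1 by simp
    then show ?thesis using s(1)[OF c(1)] s(2)[of "- rot c"] K[OF c(1)] c(1) T0 unfolding 1 by simp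
  next
    case 2
    have "(\<Sum>x\<in>sq.children v. \<bar>X x\<bar>) = \<bar>XK c0\<bar> + \<bar>XK (rot c0)\<bar>"
      using children_cells(5) c0_distinct unfolding 2 by simp
    moreover have "(if v = root then 0 else \<bar>X v\<bar>) \<le> 3 * (m * T) + 64 * T" using T T0 unfolding 2 by simp
    moreover have "\<bar>XK c0\<bar> \<le> m * T + 32 * T" "\<bar>XK (rot c0)\<bar> \<le> m * T + 32 * T" using K by simp_all
    ultimately show ?thesis using T0 by linarith
  next
    case 3
    have "(\<Sum>x\<in>sq.children v. \<bar>X x\<bar>) = \<bar>XK (- c0)\<bar> + (\<bar>XK (- rot c0)\<bar> + \<bar>X (Tc c0)\<bar>)"
      unfolding 3 children_cells(6) using c0_distinct root_children_distinct by (simp del: X.simps(5))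
    moreover have "\<bar>XK (- c0)\<bar> \<le> m * T + 32 * T" "\<bar>XK (- rot c0)\<bar> \<le> m * T + 32 * T" using K by simp_all
    ultimately show ?thesis using T T0 unfolding 3 by simp
  qed
  also have "5 * (m * T) + 128 * T = (C + 1) * (40000 * (5 * m + 128)) * (1 / 40000)"
    unfolding T_def by (simp add: algebra_simps)
  also have "\<dots> \<le> flux_const * sq.area v"
    unfolding flux_const_def m_def[symmetric] using area_center_ge[OF v None] C m_def
    by (intro mult_mono) auto
  finally show ?thesis .
qed

text \<open>The exponent counts four colours in each of \<open>N\<close> rounds; \<open>f\<close>
  and the density built from its values on the triangles differ at most on the null
  skeleton.\<close>

lemma density_equiv_one:
  assumes N: "real N \<ge> 2 * flux_const * C" "N > 0"
  shows "density_equiv (((1 + 4 * 100\<^sup>2 * (2 * C)\<^sup>2)\<^sup>2) ^ (4 * N)) (csquare 1) f (\<lambda>_. 1)"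
proof -
  have d: "1 / C \<le> d v \<and> d v \<le> C" if v: "v \<in> cells" for v
  proof -
    obtain z where z: "z \<in> interior (tri v)" using sq.interior_ne[OF v] by blast
    then have "z \<in> csquare 1" using good_tri[OF v] interior_subset unfolding good_def by blast
    then show ?thesis using f_bounds[of z] f_const[OF v z] by simp
  qed
  have fin: "finite (sq.children v)" if v: "v \<in> cells" for v
    using v children_cells by (cases v) auto
  have M: "flux_const \<ge> 0" unfolding flux_const_def using C by simp
  have "density_equiv (((1 + 4 * 100\<^sup>2 * (2 * C)\<^sup>2)\<^sup>2) ^ (4 * N)) (csquare 1) (sq.dens d) (\<lambda>_. 1)"
    by (rule sq.density_equiv_rounds[OF C M N d fin col_bound flux_balance flux_bound])
  moreover have "negligible {z \<in> csquare 1. sq.dens d z \<noteq> f z}"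
  proof (rule negligible_subset[OF sq.negligible_skeleton])
    show "{z \<in> csquare 1. sq.dens d z \<noteq> f z} \<subseteq> csquare 1 - (\<Union>v\<in>cells. interior (tri v))"
      using sq.dens_eq f_const by force
  qed
  ultimately show ?thesis by (rule density_equiv_AE)
qed

end

section \<open>Refining the dissection\<close>

lemma side_of_corner: "a \<in> corners \<Longrightarrow> (a, rot a) \<in> unit_sides"
  by (auto simp: corners_def unit_sides_def rot_def vec_eq_iff forall_2)

lemma div_point_cmb: "div_point N r a (rot a) k = cmb a (r * (1 - real k / N)) (r * (real k / N))"
  unfolding div_point_def cmb_def by (simp add: algebra_simps)

text \<open>The point \<open>p s q\<close> is affine in \<open>s\<close> and in \<open>q\<close>
  separately, so two successive convex combinations reach it from the four vertices.\<close>

lemma cmb_in_trapezoid: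
  fixes x y r r' s q :: real and a :: "real^2"
  assumes "r \<le> s" "s \<le> r'" "x \<le> q" "q \<le> y"
  defines "p \<equiv> \<lambda>s q. cmb a (s * (1 - q)) (s * q)"
  shows "p s q \<in> convex hull {p r x, p r y, p r' y, p r' x}"
proof -
  let ?H = "convex hull {p r x, p r y, p r' y, p r' x}"
  obtain u where u: "0 \<le> u" "u \<le> 1" "q = (1 - u) *\<^sub>R x + u *\<^sub>R y"
    using assms(3,4) closed_segment_eq_real_ivl[of x y] in_segment(1)[of q x y] by auto
  obtain w where w: "0 \<le> w" "w \<le> 1" "s = (1 - w) *\<^sub>R r + w *\<^sub>R r'"
    using assms(1,2) closed_segment_eq_real_ivl[of r r'] in_segment(1)[of s r r'] by auto
  have pu: "p s' q = (1 - u) *\<^sub>R p s' x + u *\<^sub>R p s' y" for s'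
    unfolding p_def u(3) by (simp add: cmb_simps) (simp add: algebra_simps)
  have pw: "p s q = (1 - w) *\<^sub>R p r q + w *\<^sub>R p r' q"
    unfolding p_def w(3) by (simp add: cmb_simps) (simp add: algebra_simps)
  have "p r x \<in> ?H" "p r y \<in> ?H" "p r' x \<in> ?H" "p r' y \<in> ?H" by (intro hull_inc; simp)+
  then have "p r q \<in> ?H" "p r' q \<in> ?H"
    unfolding pu using u convexD_alt[OF convex_convex_hull] by blast+
  then show ?thesis unfolding pw using w convexD_alt[OF convex_convex_hull] by blast
qed

text \<open>Level \<open>i\<close> falls into the annulus \<open>i div m\<close>. Over one segment
  of the coarser division lie \<open>2^(i mod m)\<close> consecutive trapezoids of level
  \<open>i\<close>, so the segment has number \<open>k div 2^(i mod m)\<close>.\<close>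

lemma zone_subset_quad:
  assumes a: "a \<in> corners" "1 \<le> m" "m \<le> i" "k < 2^i"
  shows "\<exists>l\<ge>1. \<exists>T\<in>annulus_quads m l. zone a i k \<subseteq> T"
proof -
  define l where "l = i div m"
  define e where "e = i mod m"
  define N :: nat where "N = 2^(l*m)"
  define k' where "k' = k div 2^e"
  have l: "l \<ge> 1" unfolding l_def using a(2,3) by (simp add: div_greater_zero_iff Suc_le_eq)
  have i: "i = l * m + e" unfolding l_def e_def by simp
  have i1: "i + 1 \<le> (l + 1) * m" 
  proof -
    have "e < m" unfolding e_def using a(2) by simp
    then show ?thesis unfolding i by simp
  qed
  have N: "2^i = N * 2^e" "N > 0" unfolding N_def i power_add by simp_all
  have k'N: "k' < N" unfolding k'_def using a(4) N by (simp add: less_mult_imp_div_less)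
  have "k' * 2^e \<le> k" "k + 1 \<le> (k' + 1) * 2^e"
    unfolding k'_def using dividend_less_div_times[of "2^e" k] by simp_all
  then have k: "real (k' * 2^e) \<le> real k" "real (k + 1) \<le> real ((k' + 1) * 2^e)" by (simp_all only: of_nat_le_iff)
  have "real (k' * 2^e) / (real N * 2^e) \<le> real k / (real N * 2^e)"
    "real (k + 1) / (real N * 2^e) \<le> real ((k' + 1) * 2^e) / (real N * 2^e)"
    by (rule divide_right_mono[OF k(1)] divide_right_mono[OF k(2)], simp)+
  moreover have N': "(2::real)^i = real N * 2^e" using N(1) by (metis of_nat_mult of_nat_numeral of_nat_power)
  moreover have "real (j * 2^e) / (real N * 2^e) = real j / real N" for j by simp
  ultimately have kk: "real k' / N \<le> real k / 2^i" "real (k+1) / 2^i \<le> real (k'+1) / N"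
    by (simp_all only: N')
  have "(2::real)^(l*m) \<le> 2^i" "(2::real)^(i+1) \<le> 2^((l+1)*m)"
    using i1 i by (intro power_increasing; simp)+
  then have "1/(2::real)^i \<le> 1/2^(l*m)" "1/(2::real)^((l+1)*m) \<le> 1/2^(i+1)"
    by (intro divide_left_mono; simp)+
  then have r: "radius m l \<le> 1 - 1/2^i" "1 - 1/2^(i+1) \<le> radius m (l+1)"
    unfolding radius_def by linarith+
  define T where "T = convex hull {div_point N (radius m l) a (rot a) k', div_point N (radius m l) a (rot a) (k'+1),
    div_point N (radius m (l+1)) a (rot a) (k'+1), div_point N (radius m (l+1)) a (rot a) k'}"
  have "T \<in> annulus_quads m l"
    unfolding annulus_quads_def Let_def T_def using side_of_corner[OF a(1)] k'N unfolding N_def by blast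
  moreover have "zone a i k \<subseteq> T"
  proof
    fix z assume z: "z \<in> zone a i k"
    define s where "s = cs a z"
    define q where "q = cy a z / s"
    have "(1/2::real)^i \<le> (1/2)^1" using a by (intro power_decreasing) auto
    then have half: "1/(2::real)^i \<le> 1/2" by (simp add: power_one_over)
    have zs: "1 - 1/2^i \<le> s" "s \<le> 1 - 1/2^(i+1)" "real k/2^i * s \<le> cy a z" "cy a z \<le> real (k+1)/2^i * s"
      using z unfolding zone_def s_def by blast+
    have s: "radius m l \<le> s" "s \<le> radius m (l+1)" "s > 0"
      using zs(1,2) r half by linarith+
    have "real k/2^i \<le> q" "q \<le> real (k+1)/2^i"
      unfolding q_def using zs(3,4) s(3) by (simp_all only: pos_le_divide_eq pos_divide_le_eq)
    then have q: "real k' / N \<le> q" "q \<le> real (k'+1) / N" using kk by linarith+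
    have "z = cmb a (cx a z) (cy a z)" using cmb_cx_cy[OF a(1)] by simp
    also have "\<dots> = cmb a (s * (1 - q)) (s * q)"
      using s(3) unfolding q_def by (simp add: right_diff_distrib) (simp add: s_def cs_def)
    finally show "z \<in> T"
      unfolding T_def div_point_cmb using cmb_in_trapezoid[OF s(1,2) q] by simp
  qed
  ultimately show ?thesis using l by blast
qed

text \<open>Triangles of level at least \<open>m\<close> lie in the annuli; those of lower level and
  the central ones lie in \<open>Q 0\<close>.\<close>

lemma tri_in_dissection:
  assumes m: "1 \<le> m" and Q: "dissection m Q" and v: "v \<in> cells"
  shows "\<exists>j. interior (tri v) \<subseteq> interior (Q j)"
proof -
  have bij: "bij_betw Q {1..} (\<Union>i\<in>{1..}. annulus_quads m i)" and Q0: "Q 0 = csquare (radius m 1)"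
    using Q unfolding dissection_def by blast+
  have "\<exists>j. tri v \<subseteq> Q j"
  proof (cases "\<exists>a i k. zone_index v = Some (a, i, k) \<and> m \<le> i")
    case True
    then obtain a i k where z: "zone_index v = Some (a, i, k)" and i: "m \<le> i" by blast
    note V = zone_index_Some[OF v z]
    obtain l T where T: "l \<ge> 1" "T \<in> annulus_quads m l" "zone a i k \<subseteq> T"
      using zone_subset_quad[OF V(1) m i V(3)] by blast
    then have "T \<in> Q ` {1..}" using bij unfolding bij_betw_def by auto
    then show ?thesis using zone_tri(1)[OF V] T(3) by blast
  next
    case False
    have rad: "radius m 1 = 1 - (1/2)^m" unfolding radius_def by (simp add: power_one_over)
    have "cs a' z \<le> radius m 1" if z: "z \<in> tri v" "a' \<in> corners" for z a'
    proof (cases "zone_index v")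
      case None
      have "(1/2::real)^m \<le> (1/2)^1" using m by (intro power_decreasing) auto
      then show ?thesis using tri_cs_less[OF v z] None unfolding rad by simp
    next
      case (Some p)
      obtain a i k where p: "p = (a, i, k)" by (cases p)
      have "(1/2::real)^m \<le> (1/2)^(i+1)" using False Some p by (intro power_decreasing) auto
      moreover have "cs a' z \<le> 1 - (1/2)^(i+1)" using tri_cs_less[OF v z] Some p by (simp add: power_one_over)
      ultimately show ?thesis unfolding rad by linarith
    qed
    then have "tri v \<subseteq> Q 0" unfolding Q0 csquare_eq by blast
    then show ?thesis ..
  qed
  then show ?thesis using interior_mono by blast
qed

theorem proposition1p3:
  fixes m :: nat and Q :: "nat \<Rightarrow> (real^2) set" and B :: "(real^2) set"
  assumes "m \<ge> 1"
    and "B = csquare 1"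
    and "dissection m Q"
  shows "\<forall>C>0. \<exists>L>0. \<forall>f :: real^2 \<Rightarrow> real.
    (\<forall>j. f constant_on interior (Q j)) \<longrightarrow>
    (\<forall>z\<in>B. 1 / C \<le> f z \<and> f z \<le> C) \<longrightarrow>
    integral B f = measure lebesgue B \<longrightarrow>
    (\<exists>F :: real^2 \<Rightarrow> real^2.
      F ` B = B \<and>
      bilipschitz_on L B F \<and>
      locally_piecewise_affine_on (interior B) F \<and>
      (AE z in lebesgue_on B. has_jacobian_at F (f z) z))"
proof (intro allI impI)
  fix C :: real assume C: "C > 0"
  \<comment> \<open>The value of \<open>flux_const\<close>, written out because \<open>L\<close> has
    to be fixed before \<open>f\<close> is given.\<close>
  define M where "M = (C + 1) * (25600000 + 40000 * (5 * measure lebesgue (csquare 1) + 128))"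
  define N where "N = nat \<lceil>2 * M * C\<rceil> + 1"
  define L where "L = ((1 + 4 * 100\<^sup>2 * (2 * C)\<^sup>2)\<^sup>2) ^ (4 * N)"
  have N: "real N \<ge> 2 * M * C" "N > 0" unfolding N_def by linarith+
  have "1 + 4 * 100\<^sup>2 * (2 * C)\<^sup>2 > (0::real)" by (intro add_pos_nonneg) auto
  then have "L > 0" unfolding L_def by simp
  moreover have "\<exists>F. F ` B = B \<and> bilipschitz_on L B F \<and> locally_piecewise_affine_on (interior B) F \<and>
      (AE z in lebesgue_on B. has_jacobian_at F (f z) z)"
    if const: "\<forall>j. f constant_on interior (Q j)" and bounds: "\<forall>z\<in>B. 1 / C \<le> f z \<and> f z \<le> C"
      and total: "integral B f = measure lebesgue B" for f :: "real^2 \<Rightarrow> real"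
  proof -
    define d where "d v = f (SOME z. z \<in> interior (tri v))" for v
    have f_const: "f z = d v" if v: "v \<in> cells" and z: "z \<in> interior (tri v)" for v z
    proof -
      obtain j where j: "interior (tri v) \<subseteq> interior (Q j)" using tri_in_dissection[OF assms(1,3) v] ..
      obtain y where "\<And>w. w \<in> interior (Q j) \<Longrightarrow> f w = y" using const unfolding constant_on_def by blast
      moreover have "(SOME z. z \<in> interior (tri v)) \<in> interior (tri v)" using z by (rule someI)
      ultimately show ?thesis unfolding d_def using z j by auto
    qed
    obtain v where v: "v \<in> cells" using cells_iff(5) by blast
    \<comment> \<open>The integral of a nonintegrable function is 0 by convention, so equality with
      the positive area of the square will force \<open>f\<close> to be integrable.\<close>
    have "interior (csquare 1) \<noteq> {}"
    proof
      assume "interior (csquare 1) = {}"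
      then show False using sq.interior_ne[OF v] cover_cells v interior_subset[of "tri v"] by blast
    qed
    then have "\<not> negligible (csquare 1)" 
      using open_not_negligible[OF open_interior] negligible_subset[OF _ interior_subset] by blast
    moreover have "csquare 1 \<in> lmeasurable" by (simp add: measurable_convex convex_square bounded_square)
    ultimately have "integral (csquare 1) f \<noteq> 0"
      using total negligible_iff_measure unfolding assms(2) by auto
    then have "f integrable_on csquare 1" using not_integrable_integral by blast
    then interpret cell_density f d C
      using C bounds f_const total unfolding assms(2) by unfold_locales auto
    have "density_equiv L (csquare 1) f (\<lambda>_. 1)"
      unfolding L_def using N density_equiv_one unfolding flux_const_def M_def by blast
    then obtain F G where F: "\<And>z. z \<in> B \<Longrightarrow> F z \<in> B" "\<And>z. z \<in> B \<Longrightarrow> G z \<in> B \<and> F (G z) = z"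
        "bilipschitz_on L B F" "polytopewise_affine_on (interior B) F"
        "negligible {z \<in> B. \<not> has_jacobian_at F (f z / 1) z}"
      unfolding density_equiv_def assms(2) by blast
    have "F ` B = B"
    proof
      show "B \<subseteq> F ` B" using F(2) by (metis image_eqI subsetI)
    qed (use F(1) in blast)
    moreover have "AE z in lebesgue_on B. has_jacobian_at F (f z) z"
    proof -
      have "AE z in lebesgue. z \<in> B \<longrightarrow> has_jacobian_at F (f z) z"
        by (rule AE_I'[of "{z \<in> B. \<not> has_jacobian_at F (f z / 1) z}"])
           (use F(5) negligible_iff_null_sets in auto)
      then show ?thesis
        using \<open>csquare 1 \<in> lmeasurable\<close> unfolding assms(2) by (subst AE_restrict_space_iff) (auto simp: fmeasurableD)
    qed
    ultimately show ?thesis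
      using F(3) polytopewise_affine_imp_locally_piecewise_affine[OF open_interior F(4)] by blast
  qed
  ultimately show "\<exists>L>0. \<forall>f :: real^2 \<Rightarrow> real. (\<forall>j. f constant_on interior (Q j)) \<longrightarrow>
    (\<forall>z\<in>B. 1 / C \<le> f z \<and> f z \<le> C) \<longrightarrow> integral B f = measure lebesgue B \<longrightarrow>
    (\<exists>F. F ` B = B \<and> bilipschitz_on L B F \<and> locally_piecewise_affine_on (interior B) F \<and>
      (AE z in lebesgue_on B. has_jacobian_at F (f z) z))" by blast
qed

end
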